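(* Let $F$ be a proper rational holomorphic map from the unit ball $\mathbb{B}^n\subset\mathbb{C}^n$ into the unit ball $\mathbb{B}^N\subset\mathbb{C}^N$, and let $\hat F:\mathbb{CP}^n\dashrightarrow\mathbb{CP}^N$ be the rational map it induces. Then $F$ is equivalent to a proper polynomial holomorphic map from $\mathbb{B}^n$ into $\mathbb{B}^N$ if and only if there exist hyperplanes $H\subset\mathbb{CP}^n$ and $H'\subset\mathbb{CP}^N$ such that $H\cap\overline{\mathbb{B}^n_1}=\emptyset$, $H'\cap\overline{\mathbb{B}^N_1}=\emptyset$ and $$\hat F(H)\subset H',\qquad \hat F(\mathbb{CP}^n\setminus H)\subset\mathbb{CP}^N\setminus H'.$$
   Context: Two proper rational holomorphic maps $F,G:\mathbb{B}^n\to\mathbb{B}^N$ are called equivalent if there are $\sigma\in \mathrm{Aut}(\mathbb{B}^n)$ and $\tau\in \mathrm{Aut}(\mathbb{B}^N)$ (holomorphic automorphisms) with $F=\tau\circ G\circ\sigma$. A polynomial map is a map all of whose components are holomorphic polynomials. Write $F=P/q=(P_1,\dots,P_N)/q$ with $P_1,\dots,P_N,q$ holomorphic polynomials on $\mathbb{C}^n$ having no nonconstant common factor, and set $k=\deg(F)=\max\{\deg P_1,\dots,\deg P_N,\deg q\}$. The induced rational map is $$\hat F([z:t])=\left[t^kP\left(\tfrac{z}{t}\right):t^kq\left(\tfrac{z}{t}\right)\right],\qquad [z:t]=[z_1:\dots:z_n:t]\in\mathbb{CP}^n .$$ $\hat F$ need not be defined everywhere: its poles (indeterminacy points) are the points where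 all its homogeneous components vanish. For $S\subset\mathbb{CP}^n$, $\hat F(S)$ denotes the set of images of the points of $S$ at which $\hat F$ is defined. $\mathbb{B}^n_1=\{[z_1:\dots:z_n:t]\in\mathbb{CP}^n : \sum_{j=1}^n|z_j|^2<|t|^2\}$, and $\overline{\mathbb{B}^n_1}$ is its closure in $\mathbb{CP}^n$; similarly for $N$. *)

theory Defs
  imports "HOL-Analysis.Analysis" "HOL-Library.Poly_Mapping"
begin

section \<open>Polynomials in several complex variables\<close>

text \<open>A polynomial is the finitely supported family of its coefficients, indexed by
  exponent vectors; the ring structure (hence \<open>dvd\<close>) is the convolution product of the library.\<close>

type_synonym 'n cpoly = "('n \<Rightarrow>\<^sub>0 nat) \<Rightarrow>\<^sub>0 complex"

definition mono_deg :: "('n::finite \<Rightarrow>\<^sub>0 nat) \<Rightarrow> nat" where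
  "mono_deg m = (\<Sum>i\<in>UNIV. Poly_Mapping.lookup m i)"

definition mono_eval :: "('n::finite \<Rightarrow>\<^sub>0 nat) \<Rightarrow> complex ^ 'n \<Rightarrow> complex" where
  "mono_eval m z = (\<Prod>i\<in>UNIV. (z $ i) ^ Poly_Mapping.lookup m i)"

definition cpoly_eval :: "('n::finite) cpoly \<Rightarrow> complex ^ 'n \<Rightarrow> complex" where
  "cpoly_eval p z = (\<Sum>m\<in>Poly_Mapping.keys p. Poly_Mapping.lookup p m * mono_eval m z)"

text \<open>Total degree, with the convention that the zero polynomial has degree 0.\<close>

definition tdeg :: "('n::finite) cpoly \<Rightarrow> nat" where
  "tdeg p = Max (insert 0 (mono_deg ` Poly_Mapping.keys p))"

text \<open>The polynomial \<open>t ^ k * p (z / t)\<close> for \<open>k \<ge> tdeg p\<close>, extended to \<open>t = 0\<close>;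
  see \<open>hom_eval_eq\<close> below.\<close>

definition hom_eval :: "nat \<Rightarrow> ('n::finite) cpoly \<Rightarrow> complex ^ 'n \<Rightarrow> complex \<Rightarrow> complex" where
  "hom_eval k p z t = (\<Sum>m\<in>Poly_Mapping.keys p. Poly_Mapping.lookup p m * t ^ (k - mono_deg m) * mono_eval m z)"

lemma mono_deg_le_tdeg: "m \<in> Poly_Mapping.keys p \<Longrightarrow> mono_deg m \<le> tdeg p"
  unfolding tdeg_def by (rule Max_ge) auto

lemma mono_eval_scale: "mono_eval m (c *s z) = c ^ mono_deg m * mono_eval m z"
  by (simp add: mono_eval_def mono_deg_def power_mult_distrib prod.distrib power_sum)

lemma hom_eval_eq:
  assumes "tdeg p \<le> k" "t \<noteq> 0"
  shows "hom_eval k p z t = t ^ k * cpoly_eval p ((1 / t) *s z)"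
  unfolding hom_eval_def cpoly_eval_def sum_distrib_left mono_eval_scale
proof (rule sum.cong[OF refl])
  fix m assume "m \<in> Poly_Mapping.keys p"
  then have "mono_deg m \<le> k" using mono_deg_le_tdeg assms(1) le_trans by blast
  then have "t ^ (k - mono_deg m) = t ^ k * (1 / t) ^ mono_deg m"
    using assms(2) by (simp add: power_diff power_divide)
  then show "Poly_Mapping.lookup p m * t ^ (k - mono_deg m) * mono_eval m z =
      t ^ k * (Poly_Mapping.lookup p m * ((1 / t) ^ mono_deg m * mono_eval m z))"
    by (simp only: mult_ac)
qed

lemma hom_eval_scale:
  assumes "tdeg p \<le> k"
  shows "hom_eval k p (c *s z) (c * t) = c ^ k * hom_eval k p z t"
  unfolding hom_eval_def sum_distrib_left mono_eval_scale
proof (rule sum.cong[OF refl])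
  fix m assume "m \<in> Poly_Mapping.keys p"
  then have "mono_deg m \<le> k" using mono_deg_le_tdeg assms le_trans by blast
  then have "c ^ k = c ^ (k - mono_deg m) * c ^ mono_deg m"
    by (simp flip: power_add)
  then show "Poly_Mapping.lookup p m * (c * t) ^ (k - mono_deg m) * (c ^ mono_deg m * mono_eval m z) =
      c ^ k * (Poly_Mapping.lookup p m * t ^ (k - mono_deg m) * mono_eval m z)"
    by (simp only: power_mult_distrib mult_ac)
qed


section \<open>Holomorphic maps between unit balls\<close>

text \<open>Meant for open \<open>S\<close>: the real derivative exists and is complex linear.\<close>

definition holomorphic_map_on :: "(complex ^ 'n \<Rightarrow> complex ^ 'N) \<Rightarrow> (complex ^ 'n) set \<Rightarrow> bool" where
  "holomorphic_map_on f S \<longleftrightarrow>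
     (\<forall>z\<in>S. \<exists>A :: complex ^ 'n ^ 'N. (f has_derivative (\<lambda>h. A *v h)) (at z))"

text \<open>Maps between balls are total functions of which only the values on the ball matter.\<close>

definition proper_ball_map :: "(complex ^ 'n \<Rightarrow> complex ^ 'N) \<Rightarrow> bool" where
  "proper_ball_map f \<longleftrightarrow>
     f ` ball 0 1 \<subseteq> ball 0 1 \<and>
     (\<forall>K. compact K \<and> K \<subseteq> ball 0 1 \<longrightarrow> compact {z \<in> ball 0 1. f z \<in> K})"

definition ball_aut :: "(complex ^ 'n \<Rightarrow> complex ^ 'n) set" where
  "ball_aut = {\<sigma>. bij_betw \<sigma> (ball 0 1) (ball 0 1) \<and>
     holomorphic_map_on \<sigma> (ball 0 1) \<and>
     holomorphic_map_on (inv_into (ball 0 1) \<sigma>) (ball 0 1)}"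

definition ball_equivalent ::
    "(complex ^ 'n \<Rightarrow> complex ^ 'N) \<Rightarrow> (complex ^ 'n \<Rightarrow> complex ^ 'N) \<Rightarrow> bool" where
  "ball_equivalent F G \<longleftrightarrow>
     (\<exists>\<sigma>\<in>ball_aut. \<exists>\<tau>\<in>ball_aut. \<forall>z\<in>ball 0 1. F z = \<tau> (G (\<sigma> z)))"

definition polynomial_ball_map :: "(complex ^ 'n \<Rightarrow> complex ^ 'N) \<Rightarrow> bool" where
  "polynomial_ball_map G \<longleftrightarrow>
     (\<exists>p :: 'n cpoly ^ 'N. \<forall>z\<in>ball 0 1. \<forall>j. G z $ j = cpoly_eval (p $ j) z)"

text \<open>\<open>F = P / q\<close> as a rational map on the ball, in lowest terms.  The denominator is not
  required a priori to be zero-free on the ball.\<close>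

definition lowest_terms_rep ::
    "(complex ^ 'n \<Rightarrow> complex ^ 'N) \<Rightarrow> 'n cpoly ^ 'N \<Rightarrow> 'n cpoly \<Rightarrow> bool" where
  "lowest_terms_rep F P q \<longleftrightarrow>
     q \<noteq> 0 \<and>
     (\<forall>z\<in>ball 0 1. cpoly_eval q z \<noteq> 0 \<longrightarrow>
        (\<forall>j. F z $ j = cpoly_eval (P $ j) z / cpoly_eval q z)) \<and>
     (\<forall>d. d dvd q \<and> (\<forall>j. d dvd P $ j) \<longrightarrow> tdeg d = 0)"


section \<open>Complex projective space\<close>

text \<open>Homogeneous coordinates \<open>[z : t]\<close> are pairs \<open>(z, t) \<noteq> 0\<close> up to a nonzero complex factor.\<close>

definition proj_rel :: "(complex ^ 'n) \<times> complex \<Rightarrow> (complex ^ 'n) \<times> complex \<Rightarrow> bool" where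
  "proj_rel x y \<longleftrightarrow> x \<noteq> 0 \<and> y \<noteq> 0 \<and> (\<exists>c. c \<noteq> 0 \<and> y = (c *s fst x, c * snd x))"

lemma part_equivp_proj_rel: "part_equivp (proj_rel :: (complex ^ 'n) \<times> complex \<Rightarrow> _)"
proof (rule part_equivpI)
  have "proj_rel (0, 1) (0 :: complex ^ 'n, 1)"
    unfolding proj_rel_def by (auto simp: prod_eq_iff intro!: exI[of _ 1])
  then show "\<exists>x :: (complex ^ 'n) \<times> complex. proj_rel x x" by blast
  show "symp (proj_rel :: (complex ^ 'n) \<times> complex \<Rightarrow> _)"
  proof (rule sympI)
    fix x y :: "(complex ^ 'n) \<times> complex"
    assume "proj_rel x y"
    then obtain c where c: "x \<noteq> 0" "y \<noteq> 0" "c \<noteq> 0" "y = (c *s fst x, c * snd x)"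
      unfolding proj_rel_def by blast
    then have "x = (inverse c *s fst y, inverse c * snd y)"
      by (simp add: prod_eq_iff vector_smult_assoc)
    then show "proj_rel y x"
      unfolding proj_rel_def using c by (metis nonzero_imp_inverse_nonzero)
  qed
  show "transp (proj_rel :: (complex ^ 'n) \<times> complex \<Rightarrow> _)"
  proof (rule transpI)
    fix x y z :: "(complex ^ 'n) \<times> complex"
    assume "proj_rel x y" "proj_rel y z"
    then obtain c d where "x \<noteq> 0" "z \<noteq> 0" "c \<noteq> 0" "y = (c *s fst x, c * snd x)"
        "d \<noteq> 0" "z = (d *s fst y, d * snd y)"
      unfolding proj_rel_def by blast
    then show "proj_rel x z"
      unfolding proj_rel_def by (auto simp: vector_smult_assoc intro!: exI[of _ "d * c"])
  qed
qed

quotient_type (overloaded) 'n cproj = "(complex ^ ('n::finite)) \<times> complex" / partial: proj_rel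
  by (rule part_equivp_proj_rel)

text \<open>The point \<open>[z : t]\<close>; only meaningful for \<open>(z, t) \<noteq> 0\<close>.\<close>

definition proj_pt :: "complex ^ 'n \<Rightarrow> complex \<Rightarrow> 'n cproj" where
  "proj_pt z t = abs_cproj (z, t)"

lemma proj_pt_eq_iff:
  assumes "(z, t) \<noteq> 0" "(w, s) \<noteq> 0"
  shows "proj_pt z t = proj_pt w s \<longleftrightarrow> (\<exists>c. c \<noteq> 0 \<and> w = c *s z \<and> s = c * t)"
proof -
  have refl: "proj_rel x x" if "x \<noteq> 0" for x :: "(complex ^ 'n) \<times> complex"
    using that unfolding proj_rel_def by (auto intro!: exI[of _ 1])
  have "proj_pt z t = proj_pt w s \<longleftrightarrow> proj_rel (z, t) (w, s)"
    unfolding proj_pt_def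
    using Quotient3_rel[OF Quotient3_cproj, of "(z, t)" "(w, s)"] refl[OF assms(1)] refl[OF assms(2)]
    by blast
  then show ?thesis using assms unfolding proj_rel_def by auto
qed

lemma proj_pt_cases:
  obtains z t where "(z, t) \<noteq> 0" "x = proj_pt z t"
proof -
  have "proj_rel (rep_cproj x) (rep_cproj x)" "abs_cproj (rep_cproj x) = x"
    using Quotient3_rep_reflp[OF Quotient3_cproj] Quotient3_abs_rep[OF Quotient3_cproj] by auto
  then show ?thesis
    using that[of "fst (rep_cproj x)" "snd (rep_cproj x)"]
    by (simp add: proj_pt_def proj_rel_def)
qed

text \<open>Quotient topology of the punctured vector space.\<close>

instantiation cproj :: (finite) topological_space
begin

definition open_cproj :: "'a cproj set \<Rightarrow> bool" where
  "open_cproj U \<longleftrightarrow> open {x :: (complex ^ 'a) \<times> complex. x \<noteq> 0 \<and> abs_cproj x \<in> U}"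

instance
proof
  show "open (UNIV :: 'a cproj set)"
  proof -
    have "{x :: (complex ^ 'a) \<times> complex. x \<noteq> 0 \<and> abs_cproj x \<in> UNIV} = - {0}" by auto
    then show ?thesis by (simp add: open_cproj_def open_Compl)
  qed
next
  fix S T :: "'a cproj set"
  assume "open S" "open T"
  moreover have "{x :: (complex ^ 'a) \<times> complex. x \<noteq> 0 \<and> abs_cproj x \<in> S \<inter> T} =
      {x. x \<noteq> 0 \<and> abs_cproj x \<in> S} \<inter> {x. x \<noteq> 0 \<and> abs_cproj x \<in> T}" by auto
  ultimately show "open (S \<inter> T)" by (simp add: open_cproj_def open_Int)
next
  fix K :: "'a cproj set set"
  assume "\<forall>S\<in>K. open S"
  moreover have "{x :: (complex ^ 'a) \<times> complex. x \<noteq> 0 \<and> abs_cproj x \<in> \<Union>K} =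
      (\<Union>S\<in>K. {x. x \<noteq> 0 \<and> abs_cproj x \<in> S})" by auto
  ultimately show "open (\<Union>K)" by (simp add: open_cproj_def open_UN)
qed

end

definition proj_ball :: "('n::finite) cproj set" where
  "proj_ball = {proj_pt z t | z t. (\<Sum>j\<in>UNIV. (cmod (z $ j))\<^sup>2) < (cmod t)\<^sup>2}"

definition proj_hyperplane :: "('n::finite) cproj set \<Rightarrow> bool" where
  "proj_hyperplane H \<longleftrightarrow>
     (\<exists>(a :: complex ^ 'n) b. (a, b) \<noteq> 0 \<and>
        H = {proj_pt z t | z t. (z, t) \<noteq> 0 \<and> (\<Sum>j\<in>UNIV. a $ j * z $ j) + b * t = 0})"


section \<open>The induced rational map\<close>

definition rat_deg :: "('n::finite) cpoly ^ 'N \<Rightarrow> 'n cpoly \<Rightarrow> nat" where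
  "rat_deg P q = Max (insert (tdeg q) (range (\<lambda>j. tdeg (P $ j))))"

text \<open>The rational map is given by its graph over the complement of its indeterminacy points,
  so that the relational image \<open>induced_map P q `` S\<close> consists of the images of those points
  of \<open>S\<close> at which the map is defined.\<close>

definition induced_map :: "('n::finite) cpoly ^ 'N \<Rightarrow> 'n cpoly \<Rightarrow> ('n cproj \<times> 'N cproj) set" where
  "induced_map P q =
     {(proj_pt z t, proj_pt (\<chi> j. hom_eval (rat_deg P q) (P $ j) z t) (hom_eval (rat_deg P q) q z t)) | z t.
        (z, t) \<noteq> 0 \<and>
        ((\<chi> j. hom_eval (rat_deg P q) (P $ j) z t), hom_eval (rat_deg P q) q z t) \<noteq> 0}"

lemma single_valued_induced_map: "single_valued (induced_map P q)"
proof (rule single_valuedI)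
  fix x y y'
  let ?k = "rat_deg P q"
  let ?P = "\<lambda>z t. (\<chi> j. hom_eval ?k (P $ j) z t)" and ?q = "hom_eval ?k q"
  assume 1: "(x, y) \<in> induced_map P q" and 2: "(x, y') \<in> induced_map P q"
  from 1 obtain z t where zt: "x = proj_pt z t" "y = proj_pt (?P z t) (?q z t)" "(z, t) \<noteq> 0"
      "(?P z t, ?q z t) \<noteq> 0"
    unfolding induced_map_def mem_Collect_eq prod.inject by (elim exE conjE) (rule that)
  from 2 obtain w s where ws: "x = proj_pt w s" "y' = proj_pt (?P w s) (?q w s)" "(w, s) \<noteq> 0"
      "(?P w s, ?q w s) \<noteq> 0"
    unfolding induced_map_def mem_Collect_eq prod.inject by (elim exE conjE) (rule that)
  have "proj_pt z t = proj_pt w s" using zt(1) ws(1) by simp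
  then obtain c where c: "c \<noteq> 0" "w = c *s z" "s = c * t"
    unfolding proj_pt_eq_iff[OF zt(3) ws(3)] by (elim exE conjE) (rule that)
  have "tdeg q \<le> ?k"
    unfolding rat_deg_def by (intro Max_ge) auto
  moreover have "tdeg (P $ j) \<le> ?k" for j
    unfolding rat_deg_def by (intro Max_ge) auto
  ultimately have "?P w s = c ^ ?k *s ?P z t" "?q w s = c ^ ?k * ?q z t"
    by (simp_all add: c hom_eval_scale vec_eq_iff)
  moreover have "c ^ ?k \<noteq> 0" using c by simp
  ultimately show "y = y'"
    unfolding zt(2) ws(2) proj_pt_eq_iff[OF zt(4) ws(4)] by (intro exI conjI)
qed

end

theory Submission
  imports Defs "HOL-Complex_Analysis.Conformal_Mappings"
    "HOL-Computational_Algebra.Fundamental_Theorem_Algebra"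
begin

text \<open>Every automorphism of the ball is induced by an invertible linear map of homogeneous coordinates.
  Composing \<open>F\<close> with automorphisms therefore replaces \<open>(P, q)\<close> by polynomials \<open>(N, D)\<close> which still
  have no common factor.  If \<open>N / D\<close> is a polynomial map on the ball, then \<open>D\<close> divides
  every \<open>N\<^sub>j\<close>, so \<open>D\<close> is constant, and its homogenization \<open>\<kappa> t\<^sup>k\<close> vanishes exactly at infinity: this is
  the hyperplane condition in the new coordinates.  Conversely, moving \<open>H\<close> and \<open>H'\<close> to infinity by
  automorphisms, the condition on the complement of \<open>H\<close> says that every \<open>N\<^sub>j\<close> vanishes where \<open>D\<close> does;
  were \<open>D\<close> not constant, this would give a common factor.\<close>

section \<open>Polynomial functions\<close>

text \<open>In the converse the obstacle is indeterminacy: at a zero of \<open>D\<close> off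
  \<open>H\<close> the map may simply be undefined, so the condition on complements yields no more
  than the vanishing of all components there. That this cannot happen along a hypersurface is a
  statement about common factors, proved by division in one variable and local bounds, with
  polynomials treated as functions; \<open>dvd\<close> between coefficient families returns only in
  the final pull-back to \<open>P\<close> and \<open>q\<close>. Disjointness from the closed ball
  means that a hyperplane is the polar of a point inside the ball with respect to the form |t|^2 -
  |z|^2. The involution exchanging that point with 0 carries it to infinity, which is where the
  automorphisms of the converse come from. A linear change of homogeneous coordinates may lower the
  degree of the affine components. Homogenization is therefore always done with the original k =
  \<open>rat_deg P q\<close>. Properness makes \<open>F\<close> nonconstant, hence k \<noteq> 0, and
  so \<kappa> t^k does vanish at infinity.\<close>

lemma cpoly_eval_superset:
  assumes "finite S" "Poly_Mapping.keys p \<subseteq> S"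
  shows "cpoly_eval p z = (\<Sum>m\<in>S. Poly_Mapping.lookup p m * mono_eval m z)"
  unfolding cpoly_eval_def
  by (rule sum.mono_neutral_left) (use assms in \<open>auto simp: in_keys_iff\<close>)

lemma mono_eval_add: "mono_eval (m + m') z = mono_eval m z * mono_eval m' z"
  by (simp add: mono_eval_def lookup_add power_add prod.distrib)

lemma mono_deg_add: "mono_deg (m + m') = mono_deg m + mono_deg m'"
  by (simp add: mono_deg_def lookup_add sum.distrib)

lemma cpoly_eval_0 [simp]: "cpoly_eval 0 z = 0"
  by (simp add: cpoly_eval_def)

lemma cpoly_eval_single [simp]: "cpoly_eval (Poly_Mapping.single m c) z = c * mono_eval m z"
  by (simp add: cpoly_eval_def)

lemma cpoly_eval_add [simp]: "cpoly_eval (p + q) z = cpoly_eval p z + cpoly_eval q z"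
proof -
  let ?S = "Poly_Mapping.keys p \<union> Poly_Mapping.keys q"
  have "Poly_Mapping.keys (p + q) \<subseteq> ?S" by (rule Poly_Mapping.keys_add)
  then show ?thesis
    by (simp add: cpoly_eval_superset[of ?S] lookup_add distrib_right sum.distrib)
qed

lemma cpoly_eval_sum [simp]: "cpoly_eval (sum f A) z = (\<Sum>x\<in>A. cpoly_eval (f x) z)"
  by (induction A rule: infinite_finite_induct) auto

lemma cpoly_eq_sum_single:
  fixes p :: "'n::finite cpoly"
  shows "p = (\<Sum>m\<in>Poly_Mapping.keys p. Poly_Mapping.single m (Poly_Mapping.lookup p m))"
proof (rule poly_mapping_eqI)
  fix m
  show "Poly_Mapping.lookup p m =
    Poly_Mapping.lookup (\<Sum>m\<in>Poly_Mapping.keys p. Poly_Mapping.single m (Poly_Mapping.lookup p m)) m"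
    by (cases "m \<in> Poly_Mapping.keys p") (auto simp: lookup_sum lookup_single when_def in_keys_iff)
qed

lemma cpoly_eval_mult [simp]:
  fixes p q :: "'n::finite cpoly"
  shows "cpoly_eval (p * q) z = cpoly_eval p z * cpoly_eval q z"
proof -
  have "p * q = (\<Sum>m\<in>Poly_Mapping.keys p. Poly_Mapping.single m (Poly_Mapping.lookup p m)) *
      (\<Sum>m\<in>Poly_Mapping.keys q. Poly_Mapping.single m (Poly_Mapping.lookup q m))"
    by (simp only: cpoly_eq_sum_single[symmetric])
  also have "\<dots> = (\<Sum>m\<in>Poly_Mapping.keys p. \<Sum>m'\<in>Poly_Mapping.keys q.
      Poly_Mapping.single (m + m') (Poly_Mapping.lookup p m * Poly_Mapping.lookup q m'))"
    by (simp add: sum_product mult_single)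
  finally have "cpoly_eval (p * q) z = (\<Sum>m\<in>Poly_Mapping.keys p. \<Sum>m'\<in>Poly_Mapping.keys q.
      (Poly_Mapping.lookup p m * Poly_Mapping.lookup q m') * (mono_eval m z * mono_eval m' z))"
    by (simp only: cpoly_eval_sum cpoly_eval_single mono_eval_add)
  also have "\<dots> = cpoly_eval p z * cpoly_eval q z"
    unfolding cpoly_eval_def sum_product by (intro sum.cong refl) (simp only: mult_ac)
  finally show ?thesis .
qed

lemma tdeg_le_iff: "tdeg p \<le> k \<longleftrightarrow> (\<forall>m\<in>Poly_Mapping.keys p. mono_deg m \<le> k)"
  unfolding tdeg_def by (subst Max_le_iff) auto

lemma tdeg_add_le: "tdeg p \<le> k \<Longrightarrow> tdeg q \<le> k \<Longrightarrow> tdeg (p + q) \<le> k"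
  unfolding tdeg_le_iff using Poly_Mapping.keys_add[of p q] by (meson UnE subsetD)

lemma tdeg_mult_le: "tdeg p \<le> k \<Longrightarrow> tdeg q \<le> l \<Longrightarrow> tdeg (p * q) \<le> k + l"
  unfolding tdeg_le_iff
proof
  fix m assume p: "\<forall>m\<in>Poly_Mapping.keys p. mono_deg m \<le> k" and q: "\<forall>m\<in>Poly_Mapping.keys q. mono_deg m \<le> l"
    and "m \<in> Poly_Mapping.keys (p * q)"
  then obtain a b where "m = a + b" "a \<in> Poly_Mapping.keys p" "b \<in> Poly_Mapping.keys q"
    using keys_mult[of p q] by blast
  then show "mono_deg m \<le> k + l" using p q by (simp add: mono_deg_add add_mono)
qed

lemma tdeg_0 [simp]: "tdeg 0 = 0"
  by (simp add: tdeg_def)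

lemma tdeg_0_eval:
  assumes "tdeg p = 0"
  shows "cpoly_eval p z = cpoly_eval p 0"
  unfolding cpoly_eval_def
proof (rule sum.cong[OF refl])
  fix m assume "m \<in> Poly_Mapping.keys p"
  then have "mono_deg m = 0" using mono_deg_le_tdeg[of m p] assms by simp
  then show "Poly_Mapping.lookup p m * mono_eval m z = Poly_Mapping.lookup p m * mono_eval m 0"
    by (simp add: mono_deg_def mono_eval_def)
qed

section \<open>Injectivity of evaluation\<close>

text \<open>Digits in base \<open>K\<close>: a new index gets weight 1 and the old weights are
  multiplied by \<open>K\<close>, so the residue modulo \<open>K\<close> recovers the new digit and
  the quotient leaves the old sum.\<close>

lemma exists_separating_weights:
  assumes "finite S"
  shows "\<exists>w :: 'a \<Rightarrow> nat. \<forall>f g. (\<forall>i\<in>S. f i < K \<and> g i < K) \<longrightarrow>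
    (\<Sum>i\<in>S. w i * f i) = (\<Sum>i\<in>S. w i * g i) \<longrightarrow> (\<forall>i\<in>S. f i = g i)"
  using assms
proof (induction S rule: finite_induct)
  case (insert a S)
  then obtain w :: "'a \<Rightarrow> nat" where w: "\<And>f g. \<forall>i\<in>S. f i < K \<and> g i < K \<Longrightarrow>
      (\<Sum>i\<in>S. w i * f i) = (\<Sum>i\<in>S. w i * g i) \<Longrightarrow> (\<forall>i\<in>S. f i = g i)"
    by blast
  define w' where "w' i = (if i = a then 1 else K * w i)" for i
  have sum_eq: "(\<Sum>i\<in>insert a S. w' i * f i) = f a + K * (\<Sum>i\<in>S. w i * f i)" for f
  proof -
    have "(\<Sum>i\<in>S. w' i * f i) = (\<Sum>i\<in>S. K * (w i * f i))"
      using insert.hyps by (intro sum.cong) (auto simp: w'_def)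
    then show ?thesis using insert.hyps by (simp add: w'_def sum_distrib_left)
  qed
  show ?case
  proof (intro exI[of _ w'] allI impI)
    fix f g :: "'a \<Rightarrow> nat"
    assume lt: "\<forall>i\<in>insert a S. f i < K \<and> g i < K"
      and eq: "(\<Sum>i\<in>insert a S. w' i * f i) = (\<Sum>i\<in>insert a S. w' i * g i)"
    have eq': "f a + K * (\<Sum>i\<in>S. w i * f i) = g a + K * (\<Sum>i\<in>S. w i * g i)"
      using eq unfolding sum_eq .
    have "(f a + K * (\<Sum>i\<in>S. w i * f i)) mod K = (g a + K * (\<Sum>i\<in>S. w i * g i)) mod K"
      unfolding eq' ..
    then have a: "f a = g a" using lt by simp
    with eq' lt have "(\<Sum>i\<in>S. w i * f i) = (\<Sum>i\<in>S. w i * g i)" by auto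
    with w[of f g] lt a show "\<forall>i\<in>insert a S. f i = g i" by auto
  qed
qed auto

text \<open>Kronecker substitution \<open>z\<^sub>i = x ^ w\<^sub>i\<close> reduces this to one variable.\<close>

lemma cpoly_eval_eq_0_iff:
  fixes p :: "'n::finite cpoly"
  shows "(\<forall>z. cpoly_eval p z = 0) \<longleftrightarrow> p = 0"
proof
  assume zero: "\<forall>z. cpoly_eval p z = 0"
  let ?S = "Poly_Mapping.keys p"
  \<comment> \<open>The base \<open>Suc (tdeg p)\<close> exceeds every exponent in \<open>p\<close>,
    so distinct monomials receive distinct powers \<open>e m\<close> and cannot cancel.\<close>
  obtain w :: "'n \<Rightarrow> nat" where w: "\<And>f g. \<forall>i. f i < Suc (tdeg p) \<and> g i < Suc (tdeg p) \<Longrightarrow>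
      (\<Sum>i\<in>UNIV. w i * f i) = (\<Sum>i\<in>UNIV. w i * g i) \<Longrightarrow> (\<forall>i. f i = g i)"
    using exists_separating_weights[of "UNIV :: 'n set" "Suc (tdeg p)"] by auto
  define e where "e m = (\<Sum>i\<in>UNIV. w i * Poly_Mapping.lookup m i)" for m :: "'n \<Rightarrow>\<^sub>0 nat"
  have bound: "Poly_Mapping.lookup m i < Suc (tdeg p)" if "m \<in> ?S" for m i
  proof -
    have "Poly_Mapping.lookup m i \<le> mono_deg m"
      unfolding mono_deg_def by (rule member_le_sum) auto
    then show ?thesis using mono_deg_le_tdeg[OF that] by simp
  qed
  have inj: "m = m'" if "m \<in> ?S" "m' \<in> ?S" "e m = e m'" for m m'
    using w[of "Poly_Mapping.lookup m" "Poly_Mapping.lookup m'"] bound that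
    by (auto simp: e_def intro!: poly_mapping_eqI)
  define r where "r = (\<Sum>m\<in>?S. Polynomial.monom (Poly_Mapping.lookup p m) (e m))"
  have "poly r x = cpoly_eval p (\<chi> i. x ^ w i)" for x
    by (simp add: r_def poly_sum poly_monom cpoly_eval_def mono_eval_def e_def power_sum power_mult)
  then have "r = 0" using zero by (simp flip: poly_all_0_iff_0)
  have "?S = {}"
  proof (rule ccontr)
    assume "?S \<noteq> {}"
    then obtain m where m: "m \<in> ?S" by blast
    have "Polynomial.coeff r (e m) = (\<Sum>m'\<in>?S. if m' = m then Poly_Mapping.lookup p m' else 0)"
      unfolding r_def coeff_sum by (rule sum.cong) (use m inj in auto)
    then have "Polynomial.coeff r (e m) = Poly_Mapping.lookup p m" using m by simp
    with \<open>r = 0\<close> m show False by (simp add: in_keys_iff)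
  qed
  then show "p = 0" by simp
qed auto

lemma cpoly_eval_inject:
  fixes p q :: "'n::finite cpoly"
  assumes "\<And>z. cpoly_eval p z = cpoly_eval q z"
  shows "p = q"
proof -
  have "cpoly_eval (p - q) z = 0" for z
    using cpoly_eval_add[of "p - q" q z] assms by simp
  then show ?thesis using cpoly_eval_eq_0_iff[of "p - q"] by simp
qed

section \<open>The ring of polynomial functions\<close>

text \<open>As functions, polynomials can be composed with linear maps at once. A bound instead of
  the exact degree survives cancellation and the zero polynomial.\<close>

definition polyfun_deg :: "nat \<Rightarrow> (complex ^ 'n::finite \<Rightarrow> complex) \<Rightarrow> bool" where
  "polyfun_deg k f \<longleftrightarrow> (\<exists>p. tdeg p \<le> k \<and> f = cpoly_eval p)"

definition polyfun :: "(complex ^ 'n::finite \<Rightarrow> complex) \<Rightarrow> bool" where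
  "polyfun f \<longleftrightarrow> (\<exists>p. f = cpoly_eval p)"

lemma polyfun_iff_deg: "polyfun f \<longleftrightarrow> (\<exists>k. polyfun_deg k f)"
  unfolding polyfun_def polyfun_deg_def by blast

lemma polyfun_eval: "polyfun (cpoly_eval p)"
  unfolding polyfun_def by blast

lemma mono_eval_0 [simp]: "mono_eval 0 z = 1"
  by (simp add: mono_eval_def)

lemma mono_deg_0 [simp]: "mono_deg 0 = 0"
  by (simp add: mono_deg_def)

lemma tdeg_single_le: "tdeg (Poly_Mapping.single m c) \<le> mono_deg m"
  unfolding tdeg_le_iff by simp

lemma polyfun_deg_const: "polyfun_deg k (\<lambda>z. c)"
  unfolding polyfun_deg_def
  by (rule exI[of _ "Poly_Mapping.single 0 c"]) (use tdeg_single_le[of 0 c] in \<open>auto intro: le_trans\<close>)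

lemma polyfun_deg_nth: "polyfun_deg 1 (\<lambda>z :: complex ^ 'n::finite. z $ i)"
proof -
  let ?m = "Poly_Mapping.single i (1::nat)"
  have "mono_deg ?m = 1" by (simp add: mono_deg_def lookup_single when_def)
  moreover have "mono_eval ?m z = z $ i" for z :: "complex ^ 'n"
  proof -
    have "mono_eval ?m z = (\<Prod>j\<in>UNIV. if j = i then z $ j else 1)"
      unfolding mono_eval_def by (rule prod.cong) (auto simp: lookup_single)
    then show ?thesis by simp
  qed
  ultimately show ?thesis
    unfolding polyfun_deg_def
    by (intro exI[of _ "Poly_Mapping.single ?m 1"]) (use tdeg_single_le[of ?m 1] in auto)
qed

lemma polyfun_deg_add: "polyfun_deg k f \<Longrightarrow> polyfun_deg k g \<Longrightarrow> polyfun_deg k (\<lambda>z. f z + g z)"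
  unfolding polyfun_deg_def
proof (elim exE conjE)
  fix p q assume "tdeg p \<le> k" "f = cpoly_eval p" "tdeg q \<le> k" "g = cpoly_eval q"
  then show "\<exists>p. tdeg p \<le> k \<and> (\<lambda>z. f z + g z) = cpoly_eval p"
    by (intro exI[of _ "p + q"]) (auto simp: tdeg_add_le)
qed

lemma polyfun_deg_mult:
  "polyfun_deg k f \<Longrightarrow> polyfun_deg l g \<Longrightarrow> polyfun_deg (k + l) (\<lambda>z. f z * g z)"
  unfolding polyfun_deg_def
proof (elim exE conjE)
  fix p q assume "tdeg p \<le> k" "f = cpoly_eval p" "tdeg q \<le> l" "g = cpoly_eval q"
  then show "\<exists>p. tdeg p \<le> k + l \<and> (\<lambda>z. f z * g z) = cpoly_eval p"
    by (intro exI[of _ "p * q"]) (auto simp: tdeg_mult_le)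
qed

lemma polyfun_deg_cmult: "polyfun_deg k f \<Longrightarrow> polyfun_deg k (\<lambda>z. c * f z)"
  using polyfun_deg_mult[OF polyfun_deg_const[of 0 c]] by simp

lemma polyfun_deg_sum:
  "(\<And>x. x \<in> A \<Longrightarrow> polyfun_deg k (f x)) \<Longrightarrow> polyfun_deg k (\<lambda>z. \<Sum>x\<in>A. f x z)"
  by (induction A rule: infinite_finite_induct) (auto intro: polyfun_deg_const polyfun_deg_add)

lemma polyfun_deg_power: "polyfun_deg k f \<Longrightarrow> polyfun_deg (n * k) (\<lambda>z. f z ^ n)"
  by (induction n) (auto intro: polyfun_deg_const polyfun_deg_mult)

lemma polyfun_deg_prod:
  "(\<And>x. x \<in> A \<Longrightarrow> polyfun_deg (k x) (f x)) \<Longrightarrow> polyfun_deg (sum k A) (\<lambda>z. \<Prod>x\<in>A. f x z)"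
  by (induction A rule: infinite_finite_induct) (auto intro: polyfun_deg_const polyfun_deg_mult)

lemma polyfun_const [intro!]: "polyfun (\<lambda>z. c)"
  using polyfun_deg_const polyfun_iff_deg by blast

lemma polyfun_nth [intro!]: "polyfun (\<lambda>z. z $ i)"
  using polyfun_deg_nth polyfun_iff_deg by blast

lemma polyfun_mult [intro]: "polyfun f \<Longrightarrow> polyfun g \<Longrightarrow> polyfun (\<lambda>z. f z * g z)"
  using polyfun_deg_mult polyfun_iff_deg by blast

lemma polyfun_add [intro]: "polyfun f \<Longrightarrow> polyfun g \<Longrightarrow> polyfun (\<lambda>z. f z + g z)"
  unfolding polyfun_def
proof (elim exE)
  fix p q assume "f = cpoly_eval p" "g = cpoly_eval q"
  then show "\<exists>p. (\<lambda>z. f z + g z) = cpoly_eval p"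
    by (intro exI[of _ "p + q"]) auto
qed

lemma polyfun_diff [intro]: "polyfun f \<Longrightarrow> polyfun g \<Longrightarrow> polyfun (\<lambda>z. f z - g z)"
  using polyfun_add[of f, OF _ polyfun_mult[OF polyfun_const[of "-1"], of g]] by simp

lemma polyfun_power [intro]: "polyfun f \<Longrightarrow> polyfun (\<lambda>z. f z ^ n)"
  using polyfun_deg_power polyfun_iff_deg by blast

lemma polyfun_sum [intro]: "(\<And>x. x \<in> A \<Longrightarrow> polyfun (f x)) \<Longrightarrow> polyfun (\<lambda>z. \<Sum>x\<in>A. f x z)"
  by (induction A rule: infinite_finite_induct) auto

lemma continuous_on_vector_smult [continuous_intros]:
  fixes f :: "'a::topological_space \<Rightarrow> complex" and g :: "'a \<Rightarrow> complex ^ 'n"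
  shows "continuous_on S f \<Longrightarrow> continuous_on S g \<Longrightarrow> continuous_on S (\<lambda>x. f x *s g x)"
  unfolding vector_scalar_mult_def by (intro continuous_intros)

lemma continuous_on_mono_eval [continuous_intros]:
  "continuous_on S f \<Longrightarrow> continuous_on S (\<lambda>x. mono_eval m (f x))"
  unfolding mono_eval_def by (intro continuous_intros)

lemma continuous_on_cpoly_eval [continuous_intros]:
  "continuous_on S f \<Longrightarrow> continuous_on S (\<lambda>x. cpoly_eval p (f x))"
  unfolding cpoly_eval_def by (intro continuous_intros)

lemma continuous_on_hom_eval [continuous_intros]:
  "continuous_on S f \<Longrightarrow> continuous_on S g \<Longrightarrow> continuous_on S (\<lambda>x. hom_eval k p (f x) (g x))"
  unfolding hom_eval_def by (intro continuous_intros)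

lemma polyfun_continuous_on: "polyfun f \<Longrightarrow> continuous_on S f"
  unfolding polyfun_def by (auto intro: continuous_intros)

lemma polyfun_deg_hom_eval:
  fixes f :: "complex ^ 'm::finite \<Rightarrow> complex ^ 'n::finite"
  assumes "tdeg p \<le> k" "\<And>i. polyfun_deg 1 (\<lambda>z. f z $ i)" "polyfun_deg 1 g"
  shows "polyfun_deg k (\<lambda>z. hom_eval k p (f z) (g z))"
  unfolding hom_eval_def
proof (rule polyfun_deg_sum)
  fix m assume "m \<in> Poly_Mapping.keys p"
  then have "mono_deg m \<le> k" using assms(1) by (auto simp: tdeg_le_iff)
  have "polyfun_deg (\<Sum>i\<in>UNIV. Poly_Mapping.lookup m i * 1) (\<lambda>z. mono_eval m (f z))"
    unfolding mono_eval_def by (intro polyfun_deg_prod polyfun_deg_power assms)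
  from polyfun_deg_mult[OF polyfun_deg_power[OF assms(3), of "k - mono_deg m"] this]
  have "polyfun_deg k (\<lambda>z. g z ^ (k - mono_deg m) * mono_eval m (f z))"
    using \<open>mono_deg m \<le> k\<close> by (simp add: mono_deg_def)
  from polyfun_deg_cmult[OF this]
  show "polyfun_deg k (\<lambda>z. Poly_Mapping.lookup p m * g z ^ (k - mono_deg m) * mono_eval m (f z))"
    by (simp add: mult.assoc)
qed

lemma hom_eval_1: "hom_eval k p z 1 = cpoly_eval p z"
  by (simp add: hom_eval_def cpoly_eval_def)

section \<open>Restriction to complex lines\<close>

text \<open>Kept as a formal polynomial in the line parameter, so that its coefficients can be
  followed as functions of the base point \<open>z\<close>.\<close>

definition line_poly :: "('n::finite) cpoly \<Rightarrow> complex ^ 'n \<Rightarrow> complex ^ 'n \<Rightarrow> complex poly" where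
  "line_poly p z v = (\<Sum>m\<in>Poly_Mapping.keys p. Polynomial.smult (Poly_Mapping.lookup p m)
     (\<Prod>i\<in>UNIV. [:z $ i, v $ i:] ^ Poly_Mapping.lookup m i))"

lemma poly_line_poly: "poly (line_poly p z v) s = cpoly_eval p (z + s *s v)"
  by (simp add: line_poly_def poly_sum poly_prod cpoly_eval_def mono_eval_def)

text \<open>Stated at the degree bounds instead of the degrees: in a family of polynomials the
  coefficient at the bound may vanish for some members, and the product formula must hold there
  too.\<close>

lemma degree_coeff_mult_le:
  fixes p q :: "'a::comm_semiring_1 poly"
  assumes "Polynomial.degree p \<le> a" "Polynomial.degree q \<le> b"
  shows "Polynomial.degree (p * q) \<le> a + b"
    and "Polynomial.coeff (p * q) (a + b) = Polynomial.coeff p a * Polynomial.coeff q b"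
proof -
  show "Polynomial.degree (p * q) \<le> a + b"
    using degree_mult_le[of p q] assms by linarith
  have "Polynomial.coeff (p * q) (a + b) =
      (\<Sum>i\<le>a + b. if i = a then Polynomial.coeff p a * Polynomial.coeff q b else 0)"
    unfolding coeff_mult
  proof (rule sum.cong[OF refl])
    fix i assume "i \<in> {..a + b}"
    consider "i = a" | "i < a" | "i > a" by linarith
    then show "Polynomial.coeff p i * Polynomial.coeff q (a + b - i) =
        (if i = a then Polynomial.coeff p a * Polynomial.coeff q b else 0)"
    proof cases
      case 2
      then have "Polynomial.coeff q (a + b - i) = 0" using assms by (intro coeff_eq_0) linarith
      then show ?thesis using 2 by simp
    next
      case 3
      then have "Polynomial.coeff p i = 0" using assms by (intro coeff_eq_0) linarith
      then show ?thesis using 3 by simp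
    qed simp
  qed
  then show "Polynomial.coeff (p * q) (a + b) = Polynomial.coeff p a * Polynomial.coeff q b"
    by simp
qed

lemma degree_coeff_power_le:
  fixes p :: "'a::comm_semiring_1 poly"
  assumes "Polynomial.degree p \<le> 1"
  shows "Polynomial.degree (p ^ n) \<le> n \<and> Polynomial.coeff (p ^ n) n = Polynomial.coeff p 1 ^ n"
proof (induction n)
  case (Suc n)
  then show ?case using degree_coeff_mult_le[OF assms, of "p ^ n" n] by simp
qed simp

lemma degree_coeff_prod_le:
  fixes p :: "'b \<Rightarrow> 'a::comm_semiring_1 poly"
  assumes "\<And>i. i \<in> A \<Longrightarrow> Polynomial.degree (p i) \<le> a i"
  shows "Polynomial.degree (prod p A) \<le> sum a A \<and>
    Polynomial.coeff (prod p A) (sum a A) = (\<Prod>i\<in>A. Polynomial.coeff (p i) (a i))"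
  using assms
proof (induction A rule: infinite_finite_induct)
  case (insert x A)
  then show ?case using degree_coeff_mult_le[of "p x" "a x" "prod p A" "sum a A"] by simp
qed auto

lemma line_mono:
  fixes m :: "'n::finite \<Rightarrow>\<^sub>0 nat"
  defines "r z v \<equiv> (\<Prod>i\<in>UNIV. [:z $ i, v $ i:] ^ Poly_Mapping.lookup m i)"
  shows "Polynomial.degree (r z v) \<le> mono_deg m" "Polynomial.coeff (r z v) (mono_deg m) = mono_eval m v"
proof -
  have 1: "Polynomial.degree ([:z $ i, v $ i:] ^ n) \<le> n \<and>
      Polynomial.coeff ([:z $ i, v $ i:] ^ n) n = (v $ i) ^ n" for i n
    using degree_coeff_power_le[of "[:z $ i, v $ i:]" n] by simp
  show "Polynomial.degree (r z v) \<le> mono_deg m" "Polynomial.coeff (r z v) (mono_deg m) = mono_eval m v"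
    using degree_coeff_prod_le[of UNIV "\<lambda>i. [:z $ i, v $ i:] ^ Poly_Mapping.lookup m i"
        "Poly_Mapping.lookup m"] 1
    by (auto simp: r_def mono_deg_def mono_eval_def)
qed

lemma degree_line_poly_le:
  assumes "tdeg p \<le> k"
  shows "Polynomial.degree (line_poly p z v) \<le> k"
  unfolding line_poly_def
proof (rule degree_sum_le)
  fix m assume "m \<in> Poly_Mapping.keys p"
  then have "mono_deg m \<le> k" using assms by (auto simp: tdeg_le_iff)
  then show "Polynomial.degree (Polynomial.smult (Poly_Mapping.lookup p m)
      (\<Prod>i\<in>UNIV. [:z $ i, v $ i:] ^ Poly_Mapping.lookup m i)) \<le> k"
    using line_mono(1)[where m=m and z=z and v=v] degree_smult_le le_trans by meson
qed simp

text \<open>The top coefficient is the homogeneous part of degree \<open>k\<close> at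
  \<open>v\<close> and does not depend on the base point. In a direction where it is nonzero,
  \<open>p\<close> is monic up to one constant on all parallel lines.\<close>

lemma coeff_line_poly_top:
  assumes "tdeg p \<le> k"
  shows "Polynomial.coeff (line_poly p z v) k = hom_eval k p v 0"
  unfolding line_poly_def hom_eval_def coeff_sum coeff_smult
proof (rule sum.cong[OF refl])
  fix m assume "m \<in> Poly_Mapping.keys p"
  then have "mono_deg m \<le> k" using assms by (auto simp: tdeg_le_iff)
  let ?r = "\<Prod>i\<in>UNIV. [:z $ i, v $ i:] ^ Poly_Mapping.lookup m i"
  show "Poly_Mapping.lookup p m * Polynomial.coeff ?r k =
      Poly_Mapping.lookup p m * 0 ^ (k - mono_deg m) * mono_eval m v"
  proof (cases "mono_deg m = k")
    case True
    then show ?thesis using line_mono(2)[where m=m and z=z and v=v] by simp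
  next
    case False
    then have "Polynomial.coeff ?r k = 0"
      using line_mono(1)[where m=m and z=z and v=v] \<open>mono_deg m \<le> k\<close> by (intro coeff_eq_0) linarith
    then show ?thesis using False \<open>mono_deg m \<le> k\<close> by simp
  qed
qed

text \<open>At t = 0 only the monomials of top degree survive, and they form a nonzero
  polynomial.\<close>

lemma hom_eval_top_nonzero:
  fixes p :: "'n::finite cpoly"
  assumes "p \<noteq> 0"
  obtains v where "hom_eval (tdeg p) p v 0 \<noteq> 0"
proof -
  let ?k = "tdeg p"
  define h where "h = (\<Sum>m\<in>{m\<in>Poly_Mapping.keys p. mono_deg m = ?k}.
      Poly_Mapping.single m (Poly_Mapping.lookup p m))"
  have eval: "cpoly_eval h v = hom_eval ?k p v 0" for v
  proof -
    have "hom_eval ?k p v 0 = (\<Sum>m\<in>Poly_Mapping.keys p.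
        if mono_deg m = ?k then Poly_Mapping.lookup p m * mono_eval m v else 0)"
      unfolding hom_eval_def
    proof (rule sum.cong[OF refl])
      fix m assume "m \<in> Poly_Mapping.keys p"
      then have "mono_deg m \<le> ?k" by (rule mono_deg_le_tdeg)
      then show "Poly_Mapping.lookup p m * 0 ^ (?k - mono_deg m) * mono_eval m v =
          (if mono_deg m = ?k then Poly_Mapping.lookup p m * mono_eval m v else 0)"
        by auto
    qed
    also have "\<dots> = cpoly_eval h v"
      by (simp only: h_def cpoly_eval_sum cpoly_eval_single) (simp only: sum.inter_filter finite_keys)
    finally show ?thesis by simp
  qed
  \<comment> \<open>Should the maximum be the inserted 0, all monomials have degree 0 and any of
    them attains it.\<close>
  have "?k \<in> insert 0 (mono_deg ` Poly_Mapping.keys p)"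
    unfolding tdeg_def by (rule Max_in) auto
  moreover have "Poly_Mapping.keys p \<noteq> {}" using assms by simp
  ultimately obtain m where m: "m \<in> Poly_Mapping.keys p" "mono_deg m = ?k"
    using mono_deg_le_tdeg by (metis all_not_in_conv image_iff insert_iff le_zero_eq)
  then have "Poly_Mapping.lookup h m = Poly_Mapping.lookup p m"
    by (simp add: h_def lookup_sum lookup_single when_def)
  then have "h \<noteq> 0" using m(1) by (auto simp: in_keys_iff)
  then show ?thesis using cpoly_eval_eq_0_iff[of h] eval that by metis
qed

section \<open>Density of the nonvanishing set\<close>

lemma finite_line_zeros:
  assumes "cpoly_eval p (z + s0 *s v) \<noteq> 0"
  shows "finite {s. cpoly_eval p (z + s *s v) = 0}"
proof -
  have "line_poly p z v \<noteq> 0" using assms poly_line_poly[of p z v s0] by auto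
  from poly_roots_finite[OF this] show ?thesis by (simp add: poly_line_poly)
qed

text \<open>On the line from \<open>z\<close> to \<open>z1\<close> the function has finitely many
  zeros, so points of that line arbitrarily near \<open>z\<close> avoid them.\<close>

lemma polyfun_nonzero_dense:
  fixes f :: "complex ^ 'n::finite \<Rightarrow> complex"
  assumes "polyfun f" "f z1 \<noteq> 0"
  shows "closure {z. f z \<noteq> 0} = UNIV"
proof -
  obtain p where p: "f = cpoly_eval p" using assms(1) unfolding polyfun_def by blast
  have "z \<in> closure {z. f z \<noteq> 0}" for z
    unfolding closure_approachable
  proof (intro allI impI)
    fix e :: real assume "e > 0"
    let ?Z = "{s. cpoly_eval p (z + s *s (z1 - z)) = 0}"
    have "finite ?Z" by (rule finite_line_zeros[of _ _ 1]) (use assms p in simp)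
    have "continuous_on UNIV (\<lambda>s::complex. z + s *s (z1 - z))" by (intro continuous_intros)
    then have "((\<lambda>s::complex. z + s *s (z1 - z)) \<longlongrightarrow> z + 0 *s (z1 - z)) (at 0)"
      unfolding continuous_on_def by blast
    then have "((\<lambda>s::complex. z + s *s (z1 - z)) \<longlongrightarrow> z) (at 0)" by simp
    then have "\<forall>\<^sub>F s in at 0. dist (z + s *s (z1 - z)) z < e"
      using \<open>e > 0\<close> by (rule tendstoD)
    moreover have "\<forall>\<^sub>F s in at 0. s \<notin> ?Z"
      using \<open>finite ?Z\<close> by (metis eventually_at_topological islimpt_finite islimpt_iff_eventually)
    ultimately have "\<forall>\<^sub>F s::complex in at 0. dist (z + s *s (z1 - z)) z < e \<and> s \<notin> ?Z"
      by (rule eventually_conj)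
    then obtain s where "dist (z + s *s (z1 - z)) z < e" "s \<notin> ?Z"
      using eventually_happens[of _ "at (0::complex)"] by auto
    then show "\<exists>y\<in>{z. f z \<noteq> 0}. dist y z < e" by (auto simp: p)
  qed
  then show ?thesis by auto
qed

lemma closed_eq_closure_UNIV:
  assumes "closed S" "closure A = UNIV" "A \<subseteq> S"
  shows "S = UNIV"
  using closure_minimal[OF assms(3,1)] assms(2) by auto

lemma polyfun_mult_eq_0:
  fixes f g :: "complex ^ 'n::finite \<Rightarrow> complex"
  assumes "polyfun f" "f z1 \<noteq> 0" "polyfun g" "\<And>z. f z \<noteq> 0 \<Longrightarrow> g z = 0"
  shows "g z = 0"
proof -
  have "closed {z. g z = 0}"
    using polyfun_continuous_on[OF assms(3), of UNIV] continuous_on_const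
    by (intro closed_Collect_eq) auto
  then have "{z. g z = 0} = UNIV"
    by (rule closed_eq_closure_UNIV[OF _ polyfun_nonzero_dense[OF assms(1,2)]]) (use assms in auto)
  then show ?thesis by blast
qed

lemma polyfun_eq_0_open:
  fixes f :: "complex ^ 'n::finite \<Rightarrow> complex"
  assumes "polyfun f" "open U" "U \<noteq> {}" "\<And>z. z \<in> U \<Longrightarrow> f z = 0"
  shows "f z = 0"
proof (rule ccontr)
  assume "f z \<noteq> 0"
  then have "closure {z. f z \<noteq> 0} = UNIV" using assms(1) by (rule polyfun_nonzero_dense[rotated])
  then show False using assms(2-4) by (metis (mono_tags, lifting) Int_UNIV_right disjoint_iff
        mem_Collect_eq open_Int_closure_eq_empty)
qed

text \<open>Since nonzero forms are nonzero on dense sets, some direction \<open>u\<close> is good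
  for both top forms; on the line through 0 along \<open>u\<close> the leading coefficients
  multiply.\<close>

lemma tdeg_mult:
  fixes p q :: "'n::finite cpoly"
  assumes "p \<noteq> 0" "q \<noteq> 0"
  shows "tdeg (p * q) = tdeg p + tdeg q"
proof (rule antisym)
  show "tdeg (p * q) \<le> tdeg p + tdeg q" by (rule tdeg_mult_le) auto
  obtain v where v: "hom_eval (tdeg p) p v 0 \<noteq> 0" using hom_eval_top_nonzero[OF assms(1)] .
  obtain w where w: "hom_eval (tdeg q) q w 0 \<noteq> 0" using hom_eval_top_nonzero[OF assms(2)] .
  have pf: "polyfun (\<lambda>v. hom_eval k r v 0)" if "tdeg r \<le> k" for k and r :: "'n cpoly"
    using polyfun_deg_hom_eval[OF that, of "\<lambda>z. z" "\<lambda>z. 0"]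
    by (auto simp: polyfun_iff_deg polyfun_deg_const polyfun_deg_nth intro: polyfun_deg_nth[unfolded One_nat_def])
  obtain u where u: "hom_eval (tdeg p) p u 0 \<noteq> 0" "hom_eval (tdeg q) q u 0 \<noteq> 0"
    using polyfun_mult_eq_0[OF pf[OF order_refl] v pf[OF order_refl, of q], of w] w by blast
  have eq: "line_poly (p * q) 0 u = line_poly p 0 u * line_poly q 0 u"
    by (simp add: poly_eq_poly_eq_iff[symmetric] fun_eq_iff poly_line_poly)
  have "Polynomial.coeff (line_poly (p * q) 0 u) (tdeg p + tdeg q) \<noteq> 0"
    unfolding eq using degree_coeff_mult_le(2)[OF degree_line_poly_le[OF order_refl, of p 0 u] degree_line_poly_le[OF order_refl, of q 0 u]] u
    by (simp add: coeff_line_poly_top)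
  then have "tdeg p + tdeg q \<le> Polynomial.degree (line_poly (p * q) 0 u)" by (rule le_degree)
  also have "\<dots> \<le> tdeg (p * q)" by (rule degree_line_poly_le) simp
  finally show "tdeg p + tdeg q \<le> tdeg (p * q)" .
qed

section \<open>Hypersurfaces and common factors\<close>

text \<open>Two rings occur below: all polynomial functions, and those constant along a direction.
  Both use the same division algorithm.\<close>

definition fun_subring :: "('a \<Rightarrow> complex) set \<Rightarrow> bool" where
  "fun_subring R \<longleftrightarrow> (\<forall>c. (\<lambda>_. c) \<in> R) \<and>
     (\<forall>f\<in>R. \<forall>g\<in>R. (\<lambda>z. f z + g z) \<in> R \<and> (\<lambda>z. f z * g z) \<in> R)"

text \<open>An element of R[s], viewed pointwise; the uniform degree bound is what makes a family of
  polynomials such an element.\<close>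

definition poly_family :: "('a \<Rightarrow> complex) set \<Rightarrow> ('a \<Rightarrow> complex poly) \<Rightarrow> bool" where
  "poly_family R W \<longleftrightarrow> (\<exists>m. \<forall>z. Polynomial.degree (W z) \<le> m) \<and>
     (\<forall>i. (\<lambda>z. Polynomial.coeff (W z) i) \<in> R)"

lemma fun_subring_polyfun: "fun_subring (Collect polyfun)"
  unfolding fun_subring_def by auto

lemma fun_subring_sum:
  assumes "fun_subring R" "\<And>x. x \<in> A \<Longrightarrow> f x \<in> R"
  shows "(\<lambda>z. \<Sum>x\<in>A. f x z) \<in> R"
  using assms(2)
  by (induction A rule: infinite_finite_induct) (use assms(1) in \<open>auto simp: fun_subring_def\<close>)

lemma poly_family_const:
  "fun_subring R \<Longrightarrow> poly_family R (\<lambda>_. p)"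
  unfolding poly_family_def fun_subring_def by auto

lemma poly_family_add:
  assumes "fun_subring R" "poly_family R V" "poly_family R W"
  shows "poly_family R (\<lambda>z. V z + W z)"
proof -
  obtain m n where "\<And>z. Polynomial.degree (V z) \<le> m" "\<And>z. Polynomial.degree (W z) \<le> n"
    using assms unfolding poly_family_def by blast
  then have "Polynomial.degree (V z + W z) \<le> max m n" for z
    by (meson degree_add_le max.coboundedI1 max.coboundedI2)
  then show ?thesis using assms unfolding poly_family_def fun_subring_def by auto
qed

lemma poly_family_mult:
  assumes "fun_subring R" "poly_family R V" "poly_family R W"
  shows "poly_family R (\<lambda>z. V z * W z)"
proof -
  obtain m n where "\<And>z. Polynomial.degree (V z) \<le> m" "\<And>z. Polynomial.degree (W z) \<le> n"
    using assms unfolding poly_family_def by blast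
  then have "Polynomial.degree (V z * W z) \<le> m + n" for z
    by (rule degree_coeff_mult_le(1))
  moreover have "(\<lambda>z. Polynomial.coeff (V z * W z) i) \<in> R" for i
    unfolding coeff_mult
    by (rule fun_subring_sum) (use assms in \<open>auto simp: poly_family_def fun_subring_def\<close>)
  ultimately show ?thesis unfolding poly_family_def by blast
qed

lemma poly_family_monom:
  assumes "fun_subring R" "c \<in> R"
  shows "poly_family R (\<lambda>z. Polynomial.monom (c z) n)"
proof -
  have "(\<lambda>z. Polynomial.coeff (Polynomial.monom (c z) n) i) \<in> R" for i
    using assms by (cases "i = n") (auto simp: fun_subring_def)
  then show ?thesis unfolding poly_family_def using degree_monom_le by blast
qed

lemma poly_family_smult:
  assumes "fun_subring R" "c \<in> R" "poly_family R W"
  shows "poly_family R (\<lambda>z. Polynomial.smult (c z) (W z))"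
  using poly_family_mult[OF assms(1) poly_family_monom[OF assms(1,2), of 0] assms(3)]
  by (simp add: monom_0)

lemma poly_family_diff:
  assumes "fun_subring R" "poly_family R V" "poly_family R W"
  shows "poly_family R (\<lambda>z. V z - W z)"
  using poly_family_add[OF assms(1,2) poly_family_mult[OF assms(1) poly_family_const[OF assms(1), of "-1"] assms(3)]]
  by simp

lemma fun_subring_power:
  assumes "fun_subring R" "c \<in> R"
  shows "(\<lambda>z. c z ^ k) \<in> R"
  by (induction k) (use assms in \<open>auto simp: fun_subring_def\<close>)

lemma poly_eq_sum_coeff:
  fixes p :: "complex poly"
  assumes "Polynomial.degree p \<le> m"
  shows "poly p x = (\<Sum>i\<le>m. Polynomial.coeff p i * x ^ i)"
  unfolding poly_altdef
  by (rule sum.mono_neutral_left) (use assms in \<open>auto simp: coeff_eq_0\<close>)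

lemma polyfun_poly_family:
  assumes "poly_family (Collect polyfun) W" "polyfun f"
  shows "polyfun (\<lambda>z. poly (W z) (f z))"
proof -
  obtain m where m: "\<And>z. Polynomial.degree (W z) \<le> m" using assms unfolding poly_family_def by blast
  have "polyfun (\<lambda>z. Polynomial.coeff (W z) i)" for i using assms unfolding poly_family_def by auto
  then show ?thesis unfolding poly_eq_sum_coeff[OF m]
    by (intro polyfun_sum polyfun_mult polyfun_power assms(2))
qed

text \<open>Pseudo-division: scaling by the coefficient of \<open>W\<close> at \<open>e\<close>
  before each cancellation avoids dividing in \<open>R\<close>. Here \<open>e\<close> only bounds
  the degree, so the identity also holds where that coefficient vanishes. The remainder is described
  by its coefficients, so that \<open>e = 0\<close> forces it to be 0.\<close>

lemma poly_family_pseudo_divide: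
  assumes R: "fun_subring R" and X: "poly_family R X" and W: "poly_family R W"
    and deg: "\<And>z. Polynomial.degree (W z) \<le> e"
  shows "\<exists>k Q S. poly_family R Q \<and> poly_family R S \<and> (\<forall>z i. e \<le> i \<longrightarrow> Polynomial.coeff (S z) i = 0) \<and>
    (\<forall>z. Polynomial.smult (Polynomial.coeff (W z) e ^ k) (X z) = W z * Q z + S z)"
proof -
  let ?c = "\<lambda>z. Polynomial.coeff (W z) e"
  have c: "?c \<in> R" using W unfolding poly_family_def by blast
  have *: "\<exists>k Q S. poly_family R Q \<and> poly_family R S \<and> (\<forall>z i. e \<le> i \<longrightarrow> Polynomial.coeff (S z) i = 0) \<and>
    (\<forall>z. Polynomial.smult (?c z ^ k) (X z) = W z * Q z + S z)"
    if "\<And>z i. m \<le> i \<Longrightarrow> Polynomial.coeff (X z) i = 0" "poly_family R X" for m X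
    using that
  proof (induction m arbitrary: X)
    case 0
    show ?case
      by (rule exI[of _ 0], rule exI[of _ "\<lambda>_. 0"], rule exI[of _ X])
        (use 0 poly_family_const[OF R, of 0] in auto)
  next
    case (Suc m)
    show ?case
    proof (cases "m < e")
      case True
      show ?thesis
        by (rule exI[of _ 0], rule exI[of _ "\<lambda>_. 0"], rule exI[of _ X])
          (use Suc.prems True poly_family_const[OF R, of 0] in auto)
    next
      case False
      define a where "a z = Polynomial.coeff (X z) m" for z
      define Y where "Y z = Polynomial.smult (?c z) (X z) - Polynomial.monom (a z) (m - e) * W z" for z
      have a: "a \<in> R" using Suc.prems(2) unfolding poly_family_def a_def by blast
      have Y: "poly_family R Y"
        unfolding Y_def
        by (intro poly_family_diff poly_family_smult poly_family_mult poly_family_monom R c a W Suc.prems)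
      have "Polynomial.coeff (Y z) i = 0" if "m \<le> i" for z i
      proof (cases "i = m")
        case True
        have "Polynomial.coeff (Polynomial.monom (a z) (m - e) * W z) ((m - e) + e) = a z * ?c z"
          using degree_coeff_mult_le(2)[OF degree_monom_le[of "a z" "m - e"] deg[of z]] by simp
        then have "Polynomial.coeff (Polynomial.monom (a z) (m - e) * W z) m = a z * ?c z"
          using False by simp
        then show ?thesis using True by (simp add: Y_def a_def)
      next
        case False
        then have i: "Suc m \<le> i" using that by simp
        have "Polynomial.degree (Polynomial.monom (a z) (m - e) * W z) \<le> (m - e) + e"
          by (rule degree_coeff_mult_le(1)[OF degree_monom_le deg])
        then have "Polynomial.coeff (Polynomial.monom (a z) (m - e) * W z) i = 0"
          using i \<open>\<not> m < e\<close> by (intro coeff_eq_0) linarith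
        then show ?thesis using Suc.prems(1)[OF i] by (simp add: Y_def)
      qed
      from Suc.IH[OF this Y] obtain k Q S where
        QS: "poly_family R Q" "poly_family R S" "\<forall>z i. e \<le> i \<longrightarrow> Polynomial.coeff (S z) i = 0"
        and eq: "\<And>z. Polynomial.smult (?c z ^ k) (Y z) = W z * Q z + S z" by blast
      define Q' where "Q' z = Q z + Polynomial.smult (?c z ^ k) (Polynomial.monom (a z) (m - e))" for z
      have "poly_family R Q'"
        unfolding Q'_def
        by (intro poly_family_add poly_family_smult poly_family_monom R a QS fun_subring_power c)
      moreover have "Polynomial.smult (?c z ^ Suc k) (X z) = W z * Q' z + S z" for z
      proof -
        have "Polynomial.smult (?c z) (X z) = Y z + Polynomial.monom (a z) (m - e) * W z"
          by (simp add: Y_def)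
        then have "Polynomial.smult (?c z ^ Suc k) (X z) =
            Polynomial.smult (?c z ^ k) (Y z + Polynomial.monom (a z) (m - e) * W z)"
          by (simp only: power_Suc2 smult_smult[symmetric])
        also have "\<dots> = W z * Q' z + S z"
          by (simp only: smult_add_right eq Q'_def) (simp add: algebra_simps)
        finally show ?thesis .
      qed
      ultimately show ?thesis using QS by blast
    qed
  qed
  obtain m where "\<And>z. Polynomial.degree (X z) \<le> m" using X unfolding poly_family_def by blast
  then have "Polynomial.coeff (X z) i = 0" if "Suc m \<le> i" for z i
    using that by (intro coeff_eq_0) (meson Suc_le_eq le_less_trans)
  from *[OF this X] show ?thesis .
qed

section \<open>Divisibility from local boundedness\<close>

text \<open>A root of \<open>q\<close> is a root of \<open>p\<close>. After cancelling the linear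
  factor the inequality holds off the root, and at the root by continuity, so the induction also
  accounts for multiplicities.\<close>

lemma poly_dvd_if_locally_bounded:
  fixes p q :: "complex poly"
  assumes "q \<noteq> 0" and B: "continuous_on UNIV B" and le: "\<And>s. cmod (poly p s) \<le> B s * cmod (poly q s)"
  shows "q dvd p"
  using assms(1) le
proof (induction "Polynomial.degree q" arbitrary: p q)
  case 0
  then show ?case by (metis is_unit_iff_degree unit_imp_dvd)
next
  case (Suc n)
  then obtain r where r: "poly q r = 0"
    using alg_closed_imp_poly_has_root[of q] by force
  then obtain q' where q': "q = [:-r, 1:] * q'" by (meson poly_eq_0_iff_dvd dvdE)
  have "poly p r = 0" using Suc.prems(2)[of r] r by simp
  then obtain p' where p': "p = [:-r, 1:] * p'" by (meson poly_eq_0_iff_dvd dvdE)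
  have "q' \<noteq> 0" using q' Suc.prems by auto
  have "Polynomial.degree q' = n"
    using Suc.hyps(2) \<open>q' \<noteq> 0\<close> unfolding q' by (subst (asm) degree_mult_eq) auto
  have *: "cmod (poly p' s) \<le> B s * cmod (poly q' s)" if "s \<noteq> r" for s
  proof -
    have "cmod (s - r) * cmod (poly p' s) \<le> cmod (s - r) * (B s * cmod (poly q' s))"
      using Suc.prems(2)[of s] by (simp add: p' q' norm_mult mult_ac left_diff_distrib[symmetric])
    then show ?thesis using that by simp
  qed
  have "closed {s. cmod (poly p' s) \<le> B s * cmod (poly q' s)}"
    by (intro closed_Collect_le continuous_intros B)
  moreover have "closure (- {r}) = (UNIV :: complex set)"
    by (simp add: closure_complement)
  moreover have "- {r} \<subseteq> {s. cmod (poly p' s) \<le> B s * cmod (poly q' s)}" using * by auto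
  ultimately have "{s. cmod (poly p' s) \<le> B s * cmod (poly q' s)} = UNIV"
    by (rule closed_eq_closure_UNIV)
  then have "q' dvd p'"
    using Suc.hyps(1)[of q' p'] \<open>Polynomial.degree q' = n\<close> \<open>q' \<noteq> 0\<close> by blast
  then show ?case unfolding p' q' by (rule mult_dvd_mono[OF dvd_refl])
qed

lemma poly_family_line_poly:
  assumes "\<And>i. (\<lambda>z. f z $ i) \<in> R" "fun_subring R"
  shows "poly_family R (\<lambda>z. line_poly p (f z) v)"
proof -
  have lin: "poly_family R (\<lambda>z. [:f z $ i, v $ i:])" for i
  proof -
    have "[:f z $ i, v $ i:] = Polynomial.monom (f z $ i) 0 + [:0, v $ i:]" for z
      by (simp add: monom_0)
    then show ?thesis
      using poly_family_add[OF assms(2) poly_family_monom[OF assms(2,1), of i 0] poly_family_const[OF assms(2)]]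
      by simp
  qed
  have pow: "poly_family R (\<lambda>z. [:f z $ i, v $ i:] ^ n)" for i n
    by (induction n)
      (auto intro: poly_family_mult[OF assms(2) lin] poly_family_const[OF assms(2)] simp del: mult_pCons_left)
  have "poly_family R (\<lambda>z. \<Prod>i\<in>I. [:f z $ i, v $ i:] ^ Poly_Mapping.lookup m i)" for m I
    by (induction I rule: infinite_finite_induct)
      (auto intro: poly_family_mult[OF assms(2)] pow poly_family_const[OF assms(2)])
  then have "poly_family R (\<lambda>z. Polynomial.smult (Poly_Mapping.lookup p m)
      (\<Prod>i\<in>UNIV. [:f z $ i, v $ i:] ^ Poly_Mapping.lookup m i))" for m
    by (intro poly_family_smult[OF assms(2)]) (use assms(2) in \<open>auto simp: fun_subring_def\<close>)
  then have "poly_family R (\<lambda>z. \<Sum>m\<in>M. Polynomial.smult (Poly_Mapping.lookup p m)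
      (\<Prod>i\<in>UNIV. [:f z $ i, v $ i:] ^ Poly_Mapping.lookup m i))" for M
    by (induction M rule: infinite_finite_induct)
      (auto intro: poly_family_add[OF assms(2)] poly_family_const[OF assms(2)])
  then show ?thesis unfolding line_poly_def .
qed

lemma dvd_remainder_eq_0:
  fixes W :: "complex poly"
  assumes "W dvd X" "Polynomial.smult a X = W * Q + S" "Polynomial.degree W = e" 
    and "\<And>i. e \<le> i \<Longrightarrow> Polynomial.coeff S i = 0"
  shows "S = 0"
proof (rule ccontr)
  assume "S \<noteq> 0"
  have "S = Polynomial.smult a X - W * Q" using assms(2) by simp
  then have "W dvd S" using assms(1) by (simp add: dvd_smult)
  then have "e \<le> Polynomial.degree S" using \<open>S \<noteq> 0\<close> assms(3) dvd_imp_degree_le by blast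
  then have "lead_coeff S = 0" using assms(4) by blast
  then show False using \<open>S \<noteq> 0\<close> by simp
qed

text \<open>Along a direction in which the leading coefficient of \<open>g\<close> is constant, divide with remainder on
  every line: boundedness of \<open>f / g\<close> forces the remainder to vanish.\<close>

lemma polyfun_dvd_if_locally_bounded:
  fixes f g :: "complex ^ 'n::finite \<Rightarrow> complex"
  assumes f: "polyfun f" and g: "polyfun g" and nz: "g z1 \<noteq> 0" and B: "continuous_on UNIV B"
    and le: "\<And>z. cmod (f z) \<le> B z * cmod (g z)"
  shows "\<exists>h. polyfun h \<and> (\<forall>z. f z = g z * h z)"
proof -
  obtain p where p: "f = cpoly_eval p" using f unfolding polyfun_def by blast
  obtain q where q: "g = cpoly_eval q" using g unfolding polyfun_def by blast
  have "q \<noteq> 0" using nz q by auto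
  then obtain v where v: "hom_eval (tdeg q) q v 0 \<noteq> 0" by (rule hom_eval_top_nonzero)
  let ?e = "tdeg q"
  let ?X = "\<lambda>z. line_poly p z v" and ?W = "\<lambda>z. line_poly q z v"
  let ?R = "Collect polyfun :: (complex ^ 'n \<Rightarrow> complex) set"
  define \<gamma> where "\<gamma> = hom_eval ?e q v 0"
  have lead: "Polynomial.coeff (?W z) ?e = \<gamma>" for z
    unfolding \<gamma>_def by (rule coeff_line_poly_top) simp
  have degle: "Polynomial.degree (?W z) \<le> ?e" for z by (rule degree_line_poly_le) simp
  have deg: "Polynomial.degree (?W z) = ?e" for z
    using lead[of z] v degle[of z] by (metis \<gamma>_def antisym le_degree)
  have fam: "poly_family ?R (\<lambda>z. line_poly r z v)" for r
    by (rule poly_family_line_poly) (auto intro: fun_subring_polyfun)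
  obtain k Q S where QS: "poly_family ?R Q" "\<And>z i. ?e \<le> i \<Longrightarrow> Polynomial.coeff (S z) i = 0"
    and eq: "\<And>z. Polynomial.smult (Polynomial.coeff (?W z) ?e ^ k) (?X z) = ?W z * Q z + S z"
    using poly_family_pseudo_divide[OF fun_subring_polyfun fam[of p] fam[of q] degle] by blast
  have "?W z dvd ?X z" for z
  proof (rule poly_dvd_if_locally_bounded)
    show "?W z \<noteq> 0" using lead[of z] v \<gamma>_def by auto
    show "continuous_on UNIV (\<lambda>s::complex. B (z + s *s v))"
      by (rule continuous_on_compose2[OF B])
        (auto intro!: continuous_intros)
    show "cmod (poly (?X z) s) \<le> B (z + s *s v) * cmod (poly (?W z) s)" for s
      using le[of "z + s *s v"] by (simp add: poly_line_poly p q)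
  qed
  then have "S z = 0" for z using dvd_remainder_eq_0[OF _ eq deg QS(2)] by blast
  then have eq': "Polynomial.smult (\<gamma> ^ k) (?X z) = ?W z * Q z" for z using eq[of z] lead by simp
  have "\<gamma> ^ k * f z = g z * poly (Q z) 0" for z
    using arg_cong[OF eq'[of z], of "\<lambda>r. poly r 0"] by (simp add: poly_line_poly p q)
  moreover have "polyfun (\<lambda>z. inverse (\<gamma> ^ k) * poly (Q z) 0)"
    by (intro polyfun_mult polyfun_const polyfun_poly_family QS)
  moreover have "\<gamma> ^ k \<noteq> 0" using v \<gamma>_def by simp
  ultimately show ?thesis
    by (intro exI[of _ "\<lambda>z. inverse (\<gamma> ^ k) * poly (Q z) 0"]) (auto simp: field_simps)
qed

section \<open>Bounds relating roots and coefficients\<close>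

text \<open>Multiplying by s - r with |r| \<le> B enlarges the greatest coefficient modulus at most
  by the factor 1 + B; split off the roots one at a time.\<close>

lemma coeff_bound_by_roots:
  fixes p :: "complex poly"
  assumes "\<And>s. poly p s = 0 \<Longrightarrow> cmod s \<le> B" "0 \<le> B"
  shows "cmod (Polynomial.coeff p i) \<le> cmod (lead_coeff p) * (1 + B) ^ Polynomial.degree p"
  using assms(1)
proof (induction "Polynomial.degree p" arbitrary: p i)
  case 0
  then obtain c where "p = [:c:]" by (metis degree_eq_zeroE)
  then show ?case by (cases i) auto
next
  case (Suc n)
  then obtain r where r: "poly p r = 0"
    using alg_closed_imp_poly_has_root[of p] by force
  then obtain q where q: "p = [:-r, 1:] * q" by (meson poly_eq_0_iff_dvd dvdE)
  have "q \<noteq> 0" using q Suc by auto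
  have degq: "Polynomial.degree q = n"
    using Suc.hyps(2) \<open>q \<noteq> 0\<close> unfolding q by (subst (asm) degree_mult_eq) auto
  have lead: "lead_coeff p = lead_coeff q" unfolding q by (simp only: lead_coeff_mult) simp
  let ?M = "cmod (lead_coeff q) * (1 + B) ^ n"
  have IH: "cmod (Polynomial.coeff q j) \<le> ?M" for j
    using Suc.hyps(1)[of q j] degq Suc.prems q by auto
  have "cmod r \<le> B" using Suc.prems r by blast
  have "Polynomial.coeff p i = (case i of 0 \<Rightarrow> 0 | Suc j \<Rightarrow> Polynomial.coeff q j) - r * Polynomial.coeff q i"
    unfolding q by (cases i) (auto simp: coeff_pCons)
  then have "cmod (Polynomial.coeff p i) \<le>
      cmod (case i of 0 \<Rightarrow> 0 | Suc j \<Rightarrow> Polynomial.coeff q j) + cmod r * cmod (Polynomial.coeff q i)"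
    by (metis norm_mult norm_triangle_ineq4)
  also have "\<dots> \<le> ?M + B * ?M"
    using IH \<open>cmod r \<le> B\<close> \<open>0 \<le> B\<close> by (intro add_mono mult_mono) (auto split: nat.split)
  also have "\<dots> = cmod (lead_coeff p) * (1 + B) ^ Polynomial.degree p"
    using lead Suc.hyps(2)[symmetric] by (simp add: algebra_simps)
  finally show ?case .
qed

text \<open>Cauchy's bound: if |s| > 1, the lower terms are controlled by |s|^(d - 1), which cancels
  against the leading term. It is continuous in the coefficients when the leading one is a nonzero
  constant.\<close>

lemma poly_root_bound:
  fixes p :: "complex poly"
  assumes "Polynomial.degree p = d" "p \<noteq> 0" "poly p s = 0"
  shows "cmod s \<le> 1 + (\<Sum>i<d. cmod (Polynomial.coeff p i)) / cmod (lead_coeff p)"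
proof (cases "cmod s \<le> 1")
  case True
  have "0 \<le> (\<Sum>i<d. cmod (Polynomial.coeff p i)) / cmod (lead_coeff p)"
    by (intro divide_nonneg_nonneg sum_nonneg) auto
  then show ?thesis using True by linarith
next
  case False
  have "d \<noteq> 0"
  proof
    assume "d = 0"
    then obtain c where "p = [:c:]" using assms(1) by (metis degree_eq_zeroE)
    then show False using assms(2,3) by simp
  qed
  then obtain n where d: "d = Suc n" by (cases d) auto
  have "0 = (\<Sum>i\<le>d. Polynomial.coeff p i * s ^ i)"
    using assms poly_eq_sum_coeff[of p d s] by simp
  also have "\<dots> = (\<Sum>i<d. Polynomial.coeff p i * s ^ i) + lead_coeff p * s ^ d"
    using assms(1) by (simp add: lessThan_Suc_atMost[symmetric])
  finally have "cmod (lead_coeff p) * cmod s ^ d = cmod (\<Sum>i<d. Polynomial.coeff p i * s ^ i)"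
    by (metis add_eq_0_iff norm_minus_cancel norm_mult norm_power)
  also have "\<dots> \<le> (\<Sum>i<d. cmod (Polynomial.coeff p i) * cmod s ^ n)"
  proof (rule sum_norm_le)
    fix i assume "i \<in> {..<d}"
    then have "cmod s ^ i \<le> cmod s ^ n" using False d by (intro power_increasing) auto
    then show "cmod (Polynomial.coeff p i * s ^ i) \<le> cmod (Polynomial.coeff p i) * cmod s ^ n"
      by (simp add: norm_mult norm_power mult_left_mono)
  qed
  also have "\<dots> = (\<Sum>i<d. cmod (Polynomial.coeff p i)) * cmod s ^ n" by (simp only: sum_distrib_right)
  finally have "cmod (lead_coeff p) * cmod s * cmod s ^ n \<le> (\<Sum>i<d. cmod (Polynomial.coeff p i)) * cmod s ^ n"
    by (simp only: d power_Suc mult.assoc)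
  moreover have "cmod s ^ n > 0" using False by (intro zero_less_power) linarith
  ultimately have "cmod (lead_coeff p) * cmod s \<le> (\<Sum>i<d. cmod (Polynomial.coeff p i))"
    by (simp only: mult_le_cancel_right_pos)
  moreover have "cmod (lead_coeff p) > 0" using assms(2) by simp
  ultimately have "cmod s \<le> (\<Sum>i<d. cmod (Polynomial.coeff p i)) / cmod (lead_coeff p)"
    by (simp add: pos_le_divide_eq mult.commute)
  then show ?thesis by linarith
qed

text \<open>In coordinates \<open>(\<pi> z, l z)\<close> adapted to a direction \<open>v\<close> in which \<open>D\<close> is monic, take a polynomial \<open>W\<close>
  of minimal degree in the last variable among those vanishing on the zero set of \<open>D\<close>.
  Pseudo-division shows that \<open>W\<close> divides \<open>D\<close> and all \<open>N j\<close> up to powers of its leading coefficient \<open>c\<close>.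
  Since the roots of \<open>W\<close> are roots of \<open>D\<close>, they are locally bounded, so \<open>c\<close> divides \<open>W\<close>, and
  \<open>W / c\<close> is a common factor.  This replaces the Nullstellensatz and unique factorization.\<close>

lemma common_factor_of_vanishing:
  fixes D :: "complex ^ 'n::finite \<Rightarrow> complex" and N :: "'j \<Rightarrow> complex ^ 'n \<Rightarrow> complex"
  assumes D: "polyfun D" and N: "\<And>j. polyfun (N j)"
    and vanish: "\<And>z j. D z = 0 \<Longrightarrow> N j z = 0" and nonconst: "D a \<noteq> D b"
  obtains d a' b' where "polyfun d" "d a' \<noteq> d b'" "\<exists>h. polyfun h \<and> (\<forall>z. D z = d z * h z)"
    "\<And>j. \<exists>h. polyfun h \<and> (\<forall>z. N j z = d z * h z)"
proof -
  obtain p where p: "D = cpoly_eval p" using D unfolding polyfun_def by blast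
  obtain r where r: "\<And>j. N j = cpoly_eval (r j)" using N unfolding polyfun_def by metis
  let ?k = "tdeg p"
  have "?k \<noteq> 0" using nonconst p tdeg_0_eval by metis
  have "p \<noteq> 0" using nonconst p by auto
  then obtain v where v: "hom_eval ?k p v 0 \<noteq> 0" by (rule hom_eval_top_nonzero)
  define \<delta> where "\<delta> = hom_eval ?k p v 0"
  have "\<delta> \<noteq> 0" using v \<delta>_def by simp
  have "v \<noteq> 0"
  proof
    assume "v = 0"
    have "hom_eval ?k p (0 *s 0) (0 * 0) = 0 ^ ?k * hom_eval ?k p 0 0"
      by (rule hom_eval_scale) simp
    then have "hom_eval ?k p 0 0 = 0" using \<open>?k \<noteq> 0\<close> by (simp add: zero_power)
    then show False using v \<open>v = 0\<close> by simp
  qed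
  then obtain i0 where i0: "v $ i0 \<noteq> 0" by (auto simp: vec_eq_iff)
  \<comment> \<open>A linear form with value 1 at \<open>v\<close>. Then \<open>\<pi>\<close> is the
    projection along \<open>v\<close> onto its kernel, and \<open>z\<close> has parameter
    \<open>l z\<close> on the line through \<open>\<pi> z\<close>.\<close>
  define l where "l z = inverse (v $ i0) * z $ i0" for z :: "complex ^ 'n"
  define \<pi> where "\<pi> z = z - l z *s v" for z :: "complex ^ 'n"
  have l_shift: "l (z + s *s v) = l z + s" for z s using i0 by (simp add: l_def field_simps)
  have \<pi>_shift: "\<pi> (z + s *s v) = \<pi> z" for z s
    by (simp add: \<pi>_def l_shift vector_sadd_rdistrib)
  have \<pi>_l: "\<pi> z + l z *s v = z" for z by (simp add: \<pi>_def)
  have pl: "polyfun l" unfolding l_def by (intro polyfun_mult polyfun_const polyfun_nth)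
  have p\<pi>: "polyfun (\<lambda>z. \<pi> z $ i)" for i
  proof -
    have "polyfun (\<lambda>z. z $ i - l z * v $ i)"
      by (intro polyfun_diff polyfun_mult pl polyfun_const polyfun_nth)
    then show ?thesis by (simp add: \<pi>_def)
  qed
  \<comment> \<open>Polynomials in the remaining coordinates, encoded as polynomial functions
    constant along \<open>v\<close>.\<close>
  define R where "R = {f. polyfun f \<and> (\<forall>z s. f (z + s *s v) = f z)}"
  have R: "fun_subring R" unfolding fun_subring_def R_def by auto
  let ?P = "Collect polyfun :: (complex ^ 'n \<Rightarrow> complex) set"
  have fam_mono: "poly_family ?P W" if "poly_family R W" for W
    using that unfolding poly_family_def R_def by auto
  have lines: "poly_family R (\<lambda>z. line_poly q (\<pi> z) v)" for q
    by (rule poly_family_line_poly[OF _ R]) (auto simp: R_def p\<pi> \<pi>_shift)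
  let ?D = "\<lambda>z. line_poly p (\<pi> z) v"
  have lead: "Polynomial.coeff (?D z) ?k = \<delta>" for z
    unfolding \<delta>_def by (rule coeff_line_poly_top) simp
  have degle: "Polynomial.degree (?D z) \<le> ?k" for z by (rule degree_line_poly_le) simp
  have deg: "Polynomial.degree (?D z) = ?k" for z
    using lead[of z] \<open>\<delta> \<noteq> 0\<close> degle[of z] by (metis antisym le_degree)
  have D0: "?D z \<noteq> 0" for z using lead[of z] \<open>\<delta> \<noteq> 0\<close> by auto
  \<comment> \<open>The ideal of the zero set of \<open>D\<close> in R[s]; multiplicities are
    ignored, since the hypothesis speaks of zeros only.\<close>
  define J where "J W \<longleftrightarrow> poly_family R W \<and> (\<forall>z s. poly (?D z) s = 0 \<longrightarrow> poly (W z) s = 0)" for W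
  have JD: "J ?D" unfolding J_def using lines by blast
  have JN: "J (\<lambda>z. line_poly (r j) (\<pi> z) v)" for j
    unfolding J_def using lines vanish by (auto simp: poly_line_poly p r)
  define M where "M e \<longleftrightarrow> (\<exists>W. J W \<and> (\<forall>z. Polynomial.degree (W z) \<le> e) \<and> (\<exists>z. W z \<noteq> 0))" for e
  have "M ?k" unfolding M_def using JD degle D0 by blast
  then obtain e where "M e" and least: "\<And>e'. e' < e \<Longrightarrow> \<not> M e'"
    using exists_least_iff[of M] by blast
  then obtain W z0 where JW: "J W" and degW: "\<And>z. Polynomial.degree (W z) \<le> e" and z0: "W z0 \<noteq> 0"
    unfolding M_def by blast
  have famW: "poly_family R W" using JW J_def by blast
  define c where "c z = Polynomial.coeff (W z) e" for z
  have cR: "c \<in> R" using famW unfolding poly_family_def c_def by blast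
  then have c: "polyfun c" and c_shift: "\<And>z s. c (z + s *s v) = c z" unfolding R_def by auto
  have "\<exists>z. c z \<noteq> 0"
  proof (rule ccontr)
    assume "\<nexists>z. c z \<noteq> 0"
    then have c0: "Polynomial.coeff (W z) e = 0" for z by (simp add: c_def)
    then have "e \<noteq> 0" using z0 degW[of z0] by (metis le_zero_eq leading_coeff_0_iff)
    have "Polynomial.degree (W z) \<le> e - 1" for z
    proof (rule degree_le, intro allI impI)
      fix i assume "e - 1 < i"
      then consider "i = e" | "e < i" by linarith
      then show "Polynomial.coeff (W z) i = 0"
        using c0[of z] degW[of z] by cases (auto intro: coeff_eq_0)
    qed
    then have "M (e - 1)" unfolding M_def using JW z0 by blast
    then show False using least[of "e - 1"] \<open>e \<noteq> 0\<close> by simp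
  qed
  then obtain z1 where z1: "c z1 \<noteq> 0" by blast
  have "e \<noteq> 0"
  proof
    assume "e = 0"
    obtain s where "poly (?D z1) s = 0"
      using alg_closed_imp_poly_has_root[of "?D z1"] deg \<open>?k \<noteq> 0\<close> by auto
    then have "poly (W z1) s = 0" using JW J_def by blast
    moreover obtain w where "W z1 = [:w:]" using degW[of z1] \<open>e = 0\<close> by (metis degree_eq_zeroE le_zero_eq)
    ultimately show False using z1 \<open>e = 0\<close> by (simp add: c_def)
  qed
  \<comment> \<open>The remainder lies in the same ideal and has degree below \<open>e\<close>, so
    minimality makes it zero; where \<open>c\<close> does not vanish, its power can be
    cancelled.\<close>
  have dvd: "W z dvd X z" if X: "J X" and cz: "c z \<noteq> 0" for X z
  proof -
    obtain k Q S where QS: "poly_family R S" "\<And>z i. e \<le> i \<Longrightarrow> Polynomial.coeff (S z) i = 0"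
      and eq: "\<And>z. Polynomial.smult (c z ^ k) (X z) = W z * Q z + S z"
      using poly_family_pseudo_divide[OF R _ famW degW, of X] X unfolding J_def c_def by blast
    have "J S"
      unfolding J_def
    proof (intro conjI allI impI QS(1))
      fix z s assume "poly (?D z) s = 0"
      then have "poly (X z) s = 0" "poly (W z) s = 0" using X JW unfolding J_def by auto
      then show "poly (S z) s = 0" using arg_cong[OF eq[of z], of "\<lambda>q. poly q s"] by simp
    qed
    moreover have "Polynomial.degree (S z) \<le> e - 1" for z
      by (rule degree_le) (use QS(2) in auto)
    ultimately have "S z = 0" using least[of "e - 1"] \<open>e \<noteq> 0\<close> unfolding M_def by auto
    then have "Polynomial.smult (c z ^ k) (X z) = W z * Q z" using eq[of z] by simp
    then have "W z dvd Polynomial.smult (c z ^ k) (X z)" by simp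
    then show ?thesis using cz by (simp add: dvd_smult_iff)
  qed
  \<comment> \<open>The Cauchy bound for the roots of \<open>?D z\<close>. As the leading
    coefficient is the constant \<open>\<delta>\<close>, it is continuous everywhere, including the
    zeros of \<open>c\<close>.\<close>
  define B where "B z = 1 + (\<Sum>i<?k. cmod (Polynomial.coeff (?D z) i)) / cmod \<delta>" for z
  have B0: "0 \<le> B z" for z
    unfolding B_def by (intro add_nonneg_nonneg divide_nonneg_nonneg sum_nonneg) auto
  have "continuous_on UNIV (\<lambda>z. Polynomial.coeff (?D z) i)" for i
    by (rule polyfun_continuous_on) (use lines[of p] in \<open>auto simp: poly_family_def R_def\<close>)
  then have contB: "continuous_on UNIV B"
    unfolding B_def using \<open>\<delta> \<noteq> 0\<close> by (intro continuous_intros) auto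
  have degWz: "Polynomial.degree (W z) = e" if "c z \<noteq> 0" for z
    using that degW[of z] unfolding c_def by (metis antisym le_degree)
  have dense: "closure {z. c z \<noteq> 0} = UNIV" by (rule polyfun_nonzero_dense[OF c z1])
  have coeffW: "polyfun (\<lambda>z. Polynomial.coeff (W z) i)" for i
    using famW unfolding poly_family_def R_def by auto
  \<comment> \<open>Where \<open>c\<close> is nonzero, the roots of \<open>W z\<close> are among
    those of \<open>?D z\<close>, hence bounded by \<open>B z\<close>; density extends the estimate
    to the zeros of \<open>c\<close>.\<close>
  have bound: "cmod (Polynomial.coeff (W z) i) \<le> (1 + B z) ^ e * cmod (c z)" for z i
  proof -
    have "{z. c z \<noteq> 0} \<subseteq> {z. cmod (Polynomial.coeff (W z) i) \<le> (1 + B z) ^ e * cmod (c z)}"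
    proof safe
      fix z assume "c z \<noteq> 0"
      have "cmod s \<le> B z" if "poly (W z) s = 0" for s
      proof -
        have "poly (?D z) s = 0" using dvd[OF JD \<open>c z \<noteq> 0\<close>] that by (metis dvdE mult_zero_left poly_mult)
        then show ?thesis using poly_root_bound[OF deg D0] lead deg unfolding B_def by metis
      qed
      from coeff_bound_by_roots[of "W z" "B z" i, OF this B0]
      show "cmod (Polynomial.coeff (W z) i) \<le> (1 + B z) ^ e * cmod (c z)"
        using degWz[OF \<open>c z \<noteq> 0\<close>] by (simp add: c_def mult.commute)
    qed
    moreover have "closed {z. cmod (Polynomial.coeff (W z) i) \<le> (1 + B z) ^ e * cmod (c z)}"
      by (intro closed_Collect_le continuous_intros contB polyfun_continuous_on coeffW c)
    ultimately show ?thesis using closed_eq_closure_UNIV[OF _ dense] by blast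
  qed
  have "\<exists>h. polyfun h \<and> (\<forall>z. Polynomial.coeff (W z) i = c z * h z)" for i
    by (rule polyfun_dvd_if_locally_bounded[OF coeffW c z1 _ bound]) (intro continuous_intros contB)
  then obtain h where h: "\<And>i. polyfun (h i)" "\<And>i z. Polynomial.coeff (W z) i = c z * h i z" by metis
  define V where "V z = (\<Sum>i\<le>e. Polynomial.monom (h i z) i)" for z
  have coeffV: "Polynomial.coeff (V z) i = (if i \<le> e then h i z else 0)" for z i
    unfolding V_def coeff_sum coeff_monom by (subst sum.delta) auto
  have he: "h e z = 1" for z
  proof -
    have "h e z - 1 = 0"
    proof (rule polyfun_mult_eq_0[OF c z1])
      show "polyfun (\<lambda>z. h e z - 1)" by (intro polyfun_diff h polyfun_const)
      fix w assume "c w \<noteq> 0"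
      moreover have "c w = c w * h e w" using h(2)[of w e] unfolding c_def .
      ultimately show "h e w - 1 = 0" by simp
    qed
    then show ?thesis by simp
  qed
  have degVle: "Polynomial.degree (V z) \<le> e" for z by (rule degree_le) (simp add: coeffV)
  have degV: "Polynomial.degree (V z) = e" for z
    using degVle[of z] he[of z] by (intro antisym le_degree) (auto simp: coeffV)
  have famV: "poly_family ?P V"
  proof -
    have "polyfun (\<lambda>z. if i \<le> e then h i z else 0)" for i using h(1) by (cases "i \<le> e") auto
    then show ?thesis unfolding poly_family_def using degVle by (auto simp: coeffV)
  qed
  have WV: "W z = Polynomial.smult (c z) (V z)" for z
    using degW[of z] by (intro poly_eqI) (auto simp: coeffV h(2)[symmetric] intro: coeff_eq_0)
  \<comment> \<open>Division by the monic \<open>V\<close> needs no denominators. Its remainder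
    vanishes where \<open>c\<close> does not, hence identically.\<close>
  have factor: "\<exists>Q. polyfun Q \<and> (\<forall>z. poly (X z) (l z) = poly (V z) (l z) * Q z)" if X: "J X" for X
  proof -
    have famX: "poly_family ?P X" using X fam_mono J_def by blast
    obtain k Q S where QS: "poly_family ?P Q" "poly_family ?P S" "\<And>z i. e \<le> i \<Longrightarrow> Polynomial.coeff (S z) i = 0"
      and eq: "\<And>z. Polynomial.smult (Polynomial.coeff (V z) e ^ k) (X z) = V z * Q z + S z"
      using poly_family_pseudo_divide[OF fun_subring_polyfun famX famV degVle] by blast
    have S0: "S z = 0" if "c z \<noteq> 0" for z
    proof (rule dvd_remainder_eq_0[OF _ eq degV QS(3)])
      show "V z dvd X z" using dvd[OF X that] that unfolding WV by (simp add: smult_dvd_iff)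
    qed
    have "Polynomial.coeff (S z) i = 0" for z i
    proof (rule polyfun_mult_eq_0[OF c z1])
      show "polyfun (\<lambda>z. Polynomial.coeff (S z) i)" using QS(2) unfolding poly_family_def by blast
    qed (simp add: S0)
    then have "S z = 0" for z by (intro poly_eqI) simp
    then have "X z = V z * Q z" for z using eq[of z] by (simp add: coeffV he)
    then show ?thesis
      by (intro exI[of _ "\<lambda>z. poly (Q z) (l z)"] conjI polyfun_poly_family QS(1) pl) auto
  qed
  have self: "poly (line_poly q (\<pi> z) v) (l z) = cpoly_eval q z" for q z
    by (simp add: poly_line_poly \<pi>_l)
  let ?d = "\<lambda>z. poly (V z) (l z)"
  \<comment> \<open>On the line through \<open>z1\<close> along \<open>v\<close> the factor takes
    the values of the single polynomial \<open>V z1\<close> of positive degree \<open>e\<close>, so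
    it is not constant.\<close>
  have "V (z1 + s *s v) = V z1" for s
  proof -
    have "h i (z1 + s *s v) = h i z1" for i
    proof -
      have "Polynomial.coeff (W (z1 + s *s v)) i = Polynomial.coeff (W z1) i"
        using famW unfolding poly_family_def R_def by auto
      then show ?thesis using h(2)[of "z1 + s *s v" i] h(2)[of z1 i] c_shift z1 by simp
    qed
    then show ?thesis by (simp add: V_def)
  qed
  then have d_line: "?d (z1 + (s - l z1) *s v) = poly (V z1) s" for s by (simp only: l_shift) simp
  obtain s where s: "poly (V z1) s = 0"
    using alg_closed_imp_poly_has_root[of "V z1"] degV \<open>e \<noteq> 0\<close> by auto
  have "V z1 \<noteq> 0" using degV[of z1] \<open>e \<noteq> 0\<close> by auto
  then obtain t where t: "poly (V z1) t \<noteq> 0" using poly_all_0_iff_0 by blast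
  show thesis
  proof (rule that)
    show "polyfun ?d" by (rule polyfun_poly_family[OF famV pl])
    show "?d (z1 + (s - l z1) *s v) \<noteq> ?d (z1 + (t - l z1) *s v)" unfolding d_line using s t by simp
    show "\<exists>h. polyfun h \<and> (\<forall>z. D z = ?d z * h z)" using factor[OF JD] by (simp add: self p)
    show "\<exists>h. polyfun h \<and> (\<forall>z. N j z = ?d z * h z)" for j using factor[OF JN] by (simp add: self r)
  qed
qed

section \<open>Automorphisms of the ball\<close>

definition herm :: "complex ^ 'n \<Rightarrow> complex ^ 'n \<Rightarrow> complex" where
  "herm z a = (\<Sum>i\<in>UNIV. z $ i * cnj (a $ i))"

lemma herm_add_left: "herm (z + w) a = herm z a + herm w a"
  and herm_diff_left: "herm (z - w) a = herm z a - herm w a"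
  and herm_smult_left: "herm (c *s z) a = c * herm z a"
  and herm_0_left [simp]: "herm 0 a = 0"
  and herm_diff_right: "herm z (a - b) = herm z a - herm z b"
  and herm_smult_right: "herm z (c *s a) = cnj c * herm z a"
  by (simp_all add: herm_def sum.distrib sum_subtractf sum_distrib_left algebra_simps)

lemma cnj_herm: "cnj (herm z a) = herm a z"
  by (simp add: herm_def mult.commute)

lemma norm_square_eq: "(norm (z :: complex ^ 'n))\<^sup>2 = (\<Sum>i\<in>UNIV. (cmod (z $ i))\<^sup>2)"
  by (simp add: norm_vec_def L2_set_def sum_nonneg)

lemma cmod_square: "(complex_of_real (cmod t))\<^sup>2 = t * cnj t"
  by (simp only: complex_norm_square[symmetric] of_real_power)

lemma herm_self: "herm z z = (complex_of_real (norm z))\<^sup>2"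
  by (simp only: herm_def norm_square_eq of_real_sum complex_norm_square flip: of_real_power)

lemma cmod_herm_le: "cmod (herm z a) \<le> norm z * norm a"
proof -
  have "cmod (herm z a) \<le> (\<Sum>i\<in>UNIV. cmod (z $ i) * cmod (a $ i))"
    unfolding herm_def by (rule sum_norm_le) (simp add: norm_mult)
  also have "\<dots> \<le> norm z * norm a"
    unfolding norm_vec_def using L2_set_mult_ineq[of "\<lambda>i. cmod (z $ i)" "\<lambda>i. cmod (a $ i)" UNIV] by simp
  finally show ?thesis .
qed

lemma norm_vector_smult: "norm (c *s z) = cmod c * norm (z :: complex ^ 'n)"
  by (simp add: norm_vec_def norm_mult L2_set_right_distrib)

lemma scaleR_eq_smult: "r *\<^sub>R z = complex_of_real r *s (z :: complex ^ 'n)"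
  unfolding vec_eq_iff vector_smult_component vector_scaleR_component by (simp add: scaleR_conv_of_real)

lemma bounded_linear_herm: "bounded_linear (\<lambda>z. herm z a)"
  unfolding herm_def
  by (intro bounded_linear_sum bounded_linear_mult_const bounded_linear_vec_nth)

lemma bounded_bilinear_vector_smult:
  "bounded_bilinear (\<lambda>(c::complex) (z::complex ^ 'n). c *s z)"
proof
  show "\<exists>K. \<forall>(a::complex) (b::complex ^ 'n). norm (a *s b) \<le> norm a * norm b * K"
    by (rule exI[of _ 1]) (simp add: norm_vector_smult)
qed (auto simp: vec_eq_iff algebra_simps)

definition mob_defect :: "complex ^ 'n \<Rightarrow> real" where
  "mob_defect a = sqrt (1 - (norm a)\<^sup>2)"

text \<open>For \<open>\<bar>a\<bar> < 1\<close> this linear map is, up to a scalar, an involution preserving the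
  Hermitian form \<open>\<bar>t\<bar>\<^sup>2 - \<bar>z\<bar>\<^sup>2\<close>; it exchanges \<open>[0 : 1]\<close> and \<open>[a : 1]\<close>.\<close>

definition mob_lift :: "complex ^ 'n \<Rightarrow> (complex ^ 'n) \<times> complex \<Rightarrow> (complex ^ 'n) \<times> complex" where
  "mob_lift a x =
     ((snd x - herm (fst x) a / (1 + of_real (mob_defect a))) *s a - of_real (mob_defect a) *s fst x,
      snd x - herm (fst x) a)"

text \<open>The usual involution (a - P z - s Q z) / (1 - <z,a>), with P the orthogonal projection
  to the line of \<open>a\<close>, Q = 1 - P and s = \<open>mob_defect a\<close>. Because (1 - s) /
  |a|^2 = 1 / (1 + s), the lift avoids division by |a|^2 and covers \<open>a = 0\<close>.\<close>

definition mob :: "complex ^ 'n \<Rightarrow> complex ^ 'n \<Rightarrow> complex ^ 'n" where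
  "mob a z = (1 / (1 - herm z a)) *s fst (mob_lift a (z, 1))"

definition hscale :: "complex \<Rightarrow> (complex ^ 'n) \<times> complex \<Rightarrow> (complex ^ 'n) \<times> complex" where
  "hscale c x = (c *s fst x, c * snd x)"

definition hlinear :: "((complex ^ 'n) \<times> complex \<Rightarrow> (complex ^ 'm) \<times> complex) \<Rightarrow> bool" where
  "hlinear T \<longleftrightarrow> (\<forall>x y. T (x + y) = T x + T y) \<and> (\<forall>c x. T (hscale c x) = hscale c (T x))"

lemma hscale_hscale: "hscale a (hscale b x) = hscale (a * b) x"
  by (simp add: hscale_def vector_smult_assoc)

lemma hscale_1 [simp]: "hscale 1 x = x"
  by (simp add: hscale_def)

lemma hscale_0 [simp]: "hscale 0 x = 0"
  by (simp add: hscale_def prod_eq_iff)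

lemma snd_hscale [simp]: "snd (hscale c x) = c * snd x"
  and fst_hscale [simp]: "fst (hscale c x) = c *s fst x"
  by (simp_all add: hscale_def)

lemma hlinear_hscale: "hlinear T \<Longrightarrow> T (hscale c x) = hscale c (T x)"
  and hlinear_add: "hlinear T \<Longrightarrow> T (x + y) = T x + T y"
  unfolding hlinear_def by (blast, blast)

lemma hlinear_0: "hlinear T \<Longrightarrow> T 0 = 0"
  using hlinear_hscale[of T 0 0] by simp

lemma hlinear_comp:
  assumes "hlinear S" "hlinear T"
  shows "hlinear (\<lambda>x. S (T x))"
  unfolding hlinear_def
  by (simp only: hlinear_add[OF assms(1)] hlinear_add[OF assms(2)]
      hlinear_hscale[OF assms(1)] hlinear_hscale[OF assms(2)] simp_thms)

lemma hlinear_scale: "hlinear (hscale c)"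
  unfolding hlinear_def hscale_def by (auto simp: vec_eq_iff algebra_simps)

lemma hlinear_mob_lift: "hlinear (mob_lift a)"
  unfolding hlinear_def mob_lift_def hscale_def
  by (auto simp: herm_add_left herm_smult_left vec_eq_iff algebra_simps add_divide_distrib)

lemma mob_defect:
  assumes "norm a < 1"
  shows "0 < mob_defect a" "(complex_of_real (norm a))\<^sup>2 = 1 - (of_real (mob_defect a))\<^sup>2"
proof -
  have "(norm a)\<^sup>2 < 1" using assms by (simp add: abs_square_less_1)
  then show "0 < mob_defect a" by (simp add: mob_defect_def)
  have "(norm a)\<^sup>2 = 1 - (mob_defect a)\<^sup>2" using \<open>(norm a)\<^sup>2 < 1\<close> by (simp add: mob_defect_def)
  then show "(complex_of_real (norm a))\<^sup>2 = 1 - (of_real (mob_defect a))\<^sup>2"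
    by (metis of_real_diff of_real_1 of_real_power)
qed

lemma one_plus_mob_defect:
  assumes "norm a < 1"
  shows "1 + complex_of_real (mob_defect a) \<noteq> 0"
proof
  assume "1 + complex_of_real (mob_defect a) = 0"
  then have "1 + mob_defect a = 0" by (metis of_real_1 of_real_add of_real_eq_0_iff)
  then show False using mob_defect(1)[OF assms] by simp
qed

lemma mob_lift_mob_lift:
  assumes "norm a < 1"
  shows "mob_lift a (mob_lift a x) = hscale ((of_real (mob_defect a))\<^sup>2) x"
proof -
  let ?s = "complex_of_real (mob_defect a)"
  obtain z t where x: "x = (z, t)" by (cases x)
  \<comment> \<open>With this \<open>w\<close> the fraction disappears, and |a|^2 = 1 - s^2 turns
    the claim into a polynomial identity in s.\<close>
  define w where "w = herm z a / (1 + ?s)"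
  have u: "herm z a = (1 + ?s) * w" using one_plus_mob_defect[OF assms] by (simp add: w_def)
  have lift: "mob_lift a x = ((t - w) *s a - ?s *s z, t - (1 + ?s) * w)"
    by (simp add: x mob_lift_def w_def[symmetric]) (simp add: u)
  have u': "herm ((t - w) *s a - ?s *s z) a = (1 + ?s) * (t * (1 - ?s) - w)"
    by (simp add: herm_diff_left herm_smult_left herm_self mob_defect(2)[OF assms] u)
      (simp add: algebra_simps power2_eq_square)
  have div: "(1 + ?s) * (t * (1 - ?s) - w) / (1 + ?s) = t * (1 - ?s) - w"
    using one_plus_mob_defect[OF assms] by simp
  show ?thesis
    unfolding lift unfolding mob_lift_def fst_conv snd_conv unfolding u' div
    by (simp add: x hscale_def prod_eq_iff vec_eq_iff) (simp add: algebra_simps power2_eq_square)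
qed

lemma mob_lift_form:
  assumes "norm a < 1"
  shows "(cmod (snd (mob_lift a x)))\<^sup>2 - (norm (fst (mob_lift a x)))\<^sup>2 =
    (mob_defect a)\<^sup>2 * ((cmod (snd x))\<^sup>2 - (norm (fst x))\<^sup>2)"
proof -
  let ?s = "complex_of_real (mob_defect a)"
  obtain z t where x: "x = (z, t)" by (cases x)
  define w where "w = herm z a / (1 + ?s)"
  have u: "herm z a = (1 + ?s) * w" using one_plus_mob_defect[OF assms] by (simp add: w_def)
  have u': "herm a z = (1 + ?s) * cnj w" unfolding cnj_herm[of z a, symmetric] u by simp
  have lift: "mob_lift a x = ((t - w) *s a - ?s *s z, t - (1 + ?s) * w)"
    by (simp add: x mob_lift_def w_def[symmetric]) (simp add: u)
  have "complex_of_real ((cmod (snd (mob_lift a x)))\<^sup>2 - (norm (fst (mob_lift a x)))\<^sup>2) =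
     complex_of_real ((mob_defect a)\<^sup>2 * ((cmod (snd x))\<^sup>2 - (norm (fst x))\<^sup>2))"
    unfolding of_real_diff of_real_mult of_real_power herm_self[symmetric] cmod_square lift
    unfolding x fst_conv snd_conv
    by (simp add: herm_diff_left herm_diff_right herm_smult_left herm_smult_right u u'
        herm_self[of a] mob_defect(2)[OF assms])
      (simp add: algebra_simps power2_eq_square)
  then show ?thesis by (simp only: of_real_eq_iff)
qed

lemma ball_denominator_nonzero:
  assumes "norm a < 1" "norm z \<le> cmod t" "t \<noteq> 0"
  shows "t - herm z a \<noteq> 0"
proof
  assume "t - herm z a = 0"
  then have "cmod t = cmod (herm z a)" by simp
  also have "\<dots> \<le> norm z * norm a" by (rule cmod_herm_le)
  also have "\<dots> \<le> cmod t * norm a" using assms by (intro mult_right_mono) auto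
  also have "\<dots> < cmod t * 1" using assms by (intro mult_strict_left_mono) auto
  finally show False by simp
qed

lemma mob_lift_mob:
  assumes "norm a < 1" "norm z < 1"
  shows "mob_lift a (z, 1) = hscale (1 - herm z a) (mob a z, 1)" "1 - herm z a \<noteq> 0"
proof -
  show nz: "1 - herm z a \<noteq> 0" using ball_denominator_nonzero[of a z 1] assms by simp
  then show "mob_lift a (z, 1) = hscale (1 - herm z a) (mob a z, 1)"
    by (simp add: mob_def hscale_def prod_eq_iff vector_smult_assoc) (simp add: mob_lift_def)
qed

lemma norm_mob_less:
  assumes "norm a < 1" "norm z < 1"
  shows "norm (mob a z) < 1"
proof -
  let ?c = "1 - herm z a"
  have "(cmod ?c)\<^sup>2 - (cmod ?c * norm (mob a z))\<^sup>2 = (mob_defect a)\<^sup>2 * (1 - (norm z)\<^sup>2)"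
    using mob_lift_form[OF assms(1), of "(z, 1)"]
    unfolding mob_lift_mob(1)[OF assms] fst_hscale snd_hscale fst_conv snd_conv norm_vector_smult by simp
  also have "\<dots> > 0"
    using mob_defect(1)[OF assms(1)] assms(2) by (simp add: abs_square_less_1)
  finally have "(cmod ?c)\<^sup>2 * (norm (mob a z))\<^sup>2 < (cmod ?c)\<^sup>2 * 1"
    by (simp add: power_mult_distrib)
  then have "(norm (mob a z))\<^sup>2 < 1"
    by (metis mult_less_cancel_left zero_le_power2 not_le)
  then show ?thesis by (simp add: abs_square_less_1)
qed

lemma mob_mob:
  assumes "norm a < 1" "norm z < 1"
  shows "mob a (mob a z) = z"
proof -
  let ?c = "1 - herm z a" and ?d = "1 - herm (mob a z) a" and ?s2 = "(complex_of_real (mob_defect a))\<^sup>2"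
  have "hscale ?s2 (z, 1) = mob_lift a (mob_lift a (z, 1))"
    by (rule mob_lift_mob_lift[OF assms(1), symmetric])
  also have "\<dots> = hscale (?c * ?d) (mob a (mob a z), 1)"
    by (simp only: mob_lift_mob(1)[OF assms] hlinear_hscale[OF hlinear_mob_lift]
        mob_lift_mob(1)[OF assms(1) norm_mob_less[OF assms]] hscale_hscale)
  finally have "?s2 *s z = (?c * ?d) *s mob a (mob a z)" "?s2 = ?c * ?d" by (auto simp: hscale_def)
  moreover have "?s2 \<noteq> 0" using mob_defect(1)[OF assms(1)] by simp
  ultimately show ?thesis by simp
qed

lemma mob_0: "mob a 0 = a"
  by (simp add: mob_def mob_lift_def)

lemma mob_self:
  assumes "norm a < 1"
  shows "mob a a = 0"
  using mob_mob[OF assms, of 0] mob_0[of a] by simp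

section \<open>Holomorphic maps and automorphisms\<close>

lemma holomorphic_map_onI:
  fixes f :: "complex ^ 'n::finite \<Rightarrow> complex ^ 'm::finite"
  assumes "\<And>z. z \<in> S \<Longrightarrow> \<exists>f'. (f has_derivative f') (at z) \<and> (\<forall>c h. f' (c *s h) = c *s f' h)"
  shows "holomorphic_map_on f S"
  unfolding holomorphic_map_on_def
proof
  fix z assume "z \<in> S"
  then obtain f' where f': "(f has_derivative f') (at z)" "\<And>c h. f' (c *s h) = c *s f' h"
    using assms by blast
  have "linear f'" using f'(1) has_derivative_linear by blast
  then have "Vector_Spaces.linear (*s) (*s) f'"
    using f'(2) by (simp add: Vector_Spaces.linear_iff vector_space_over_itself.vector_space_axioms vec.vector_space_axioms linear_add)
  then have "f' = (\<lambda>h. matrix f' *v h)" by (simp add: matrix_works)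
  then show "\<exists>A :: complex ^ 'n ^ 'm. (f has_derivative (\<lambda>h. A *v h)) (at z)" using f'(1) by metis
qed

lemma holomorphic_map_on_compose:
  assumes "holomorphic_map_on f S" "holomorphic_map_on g T" "f ` S \<subseteq> T"
  shows "holomorphic_map_on (\<lambda>z. g (f z)) S"
  unfolding holomorphic_map_on_def
proof
  fix z assume "z \<in> S"
  then obtain A B where "(f has_derivative (\<lambda>h. A *v h)) (at z)" "(g has_derivative (\<lambda>h. B *v h)) (at (f z))"
    using assms unfolding holomorphic_map_on_def by blast
  from has_derivative_compose[OF this]
  show "\<exists>A. ((\<lambda>z. g (f z)) has_derivative (\<lambda>h. A *v h)) (at z)"
    unfolding matrix_vector_mul_assoc by blast
qed

lemma holomorphic_map_on_transform:
  assumes "holomorphic_map_on f S" "open S" "\<And>z. z \<in> S \<Longrightarrow> f z = g z"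
  shows "holomorphic_map_on g S"
  using assms unfolding holomorphic_map_on_def by (metis has_derivative_transform_within_open)

lemma holomorphic_map_on_continuous_on:
  assumes "holomorphic_map_on f S"
  shows "continuous_on S f"
  using assms unfolding holomorphic_map_on_def
  by (meson continuous_at_imp_continuous_on has_derivative_continuous)

lemma holomorphic_mob:
  assumes "norm a < 1"
  shows "holomorphic_map_on (mob a) (ball 0 1)"
proof (rule holomorphic_map_onI)
  fix z assume "z \<in> ball (0 :: complex ^ 'a) 1"
  then have nz: "1 - herm z a \<noteq> 0" using mob_lift_mob(2)[OF assms] by simp
  let ?s = "complex_of_real (mob_defect a)"
  note herm = bounded_linear.has_derivative[OF bounded_linear_herm]
  note smult = bounded_bilinear.FDERIV[OF bounded_bilinear_vector_smult]
  let ?g = "\<lambda>z. (1 - herm z a / (1 + ?s)) *s a - ?s *s z"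
  let ?g' = "\<lambda>h. (- (herm h a / (1 + ?s))) *s a - ?s *s h"
  have g: "(?g has_derivative ?g') (at z)"
  proof -
    have "((\<lambda>z. herm z a / (1 + ?s)) has_derivative (\<lambda>h. herm h a / (1 + ?s))) (at z)"
      by (intro bounded_linear.has_derivative[OF bounded_linear_divide] herm has_derivative_ident)
    from has_derivative_diff[OF has_derivative_const this, of 1]
    have "((\<lambda>z. 1 - herm z a / (1 + ?s)) has_derivative (\<lambda>h. - (herm h a / (1 + ?s)))) (at z)"
      by simp
    from smult[OF this has_derivative_const[of a]]
    have 1: "((\<lambda>z. (1 - herm z a / (1 + ?s)) *s a) has_derivative (\<lambda>h. (- (herm h a / (1 + ?s))) *s a)) (at z)"
      by simp
    from smult[OF has_derivative_const[of ?s] has_derivative_ident, of z UNIV]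
    have 2: "((\<lambda>z. ?s *s z) has_derivative (\<lambda>h. ?s *s h)) (at z)" by simp
    from has_derivative_diff[OF 1 2] show ?thesis .
  qed
  have r: "((\<lambda>z. 1 / (1 - herm z a)) has_derivative (\<lambda>h. herm h a / (1 - herm z a)\<^sup>2)) (at z)"
    using nz by (auto intro!: derivative_eq_intros herm[of "\<lambda>z. z"] simp: field_simps power2_eq_square)
  have D: "((\<lambda>z. (1 / (1 - herm z a)) *s ?g z) has_derivative
      (\<lambda>h. (1 / (1 - herm z a)) *s ?g' h + (herm h a / (1 - herm z a)\<^sup>2) *s ?g z)) (at z)"
    by (rule smult[OF r g])
  have mob: "mob a = (\<lambda>z. (1 / (1 - herm z a)) *s ?g z)"
    by (auto simp: mob_def mob_lift_def)
  have lin: "(1 / (1 - herm z a)) *s ?g' (c *s h) + (herm (c *s h) a / (1 - herm z a)\<^sup>2) *s ?g z =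
      c *s ((1 / (1 - herm z a)) *s ?g' h + (herm h a / (1 - herm z a)\<^sup>2) *s ?g z)" for c h
    by (simp add: herm_smult_left vec_eq_iff) (simp add: algebra_simps add_divide_distrib diff_divide_distrib)
  show "\<exists>f'. (mob a has_derivative f') (at z) \<and> (\<forall>c h. f' (c *s h) = c *s f' h)"
    unfolding mob by (rule exI, rule conjI[OF D], intro allI, rule lin)
qed

lemma ball_autI:
  assumes "\<And>z. norm z < 1 \<Longrightarrow> norm (f z) < 1" "\<And>z. norm z < 1 \<Longrightarrow> norm (g z) < 1"
    and "\<And>z. norm z < 1 \<Longrightarrow> g (f z) = z" "\<And>z. norm z < 1 \<Longrightarrow> f (g z) = z"
    and "holomorphic_map_on f (ball 0 1)" "holomorphic_map_on g (ball 0 1)"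
  shows "f \<in> ball_aut"
proof -
  have bij: "bij_betw f (ball 0 1) (ball 0 1)"
    by (rule bij_betw_byWitness[of _ g]) (use assms(1-4) in auto)
  have "g z = inv_into (ball 0 1) f z" if "z \<in> ball 0 1" for z
    by (rule inv_into_f_eq[symmetric]) (use bij that assms(1-4) in \<open>auto simp: bij_betw_def\<close>)
  then have "holomorphic_map_on (inv_into (ball 0 1) f) (ball 0 1)"
    by (intro holomorphic_map_on_transform[OF assms(6)]) auto
  then show ?thesis using bij assms(5) by (simp add: ball_aut_def)
qed

lemma ball_autE:
  assumes "f \<in> ball_aut"
  obtains g where "g \<in> ball_aut" "\<And>z. norm z < 1 \<Longrightarrow> norm (f z) < 1" "\<And>z. norm z < 1 \<Longrightarrow> norm (g z) < 1"
    "\<And>z. norm z < 1 \<Longrightarrow> g (f z) = z" "\<And>z. norm z < 1 \<Longrightarrow> f (g z) = z"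
    "holomorphic_map_on f (ball 0 1)" "holomorphic_map_on g (ball 0 1)"
proof -
  let ?g = "inv_into (ball 0 1) f"
  have bij: "bij_betw f (ball 0 1) (ball 0 1)" and hol: "holomorphic_map_on f (ball 0 1)" "holomorphic_map_on ?g (ball 0 1)"
    using assms by (auto simp: ball_aut_def)
  have 1: "norm (f z) < 1" if "norm z < 1" for z using bij_betwE[OF bij] that by auto
  have 2: "norm (?g z) < 1" if "norm z < 1" for z
    using bij_betwE[OF bij_betw_inv_into[OF bij]] that by auto
  have 3: "?g (f z) = z" if "norm z < 1" for z using bij_betw_inv_into_left[OF bij] that by auto
  have 4: "f (?g z) = z" if "norm z < 1" for z using bij_betw_inv_into_right[OF bij] that by auto
  show thesis
    by (rule that[OF ball_autI[OF 2 1 4 3 hol(2,1)] 1 2 3 4 hol])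
qed

lemma mob_ball_aut: "norm a < 1 \<Longrightarrow> mob a \<in> ball_aut"
  by (rule ball_autI[of _ "mob a"]) (auto intro: norm_mob_less mob_mob holomorphic_mob)

section \<open>The Schwarz lemma and automorphisms fixing the origin\<close>

text \<open>Restriction to a disc through the origin, followed by a linear functional, gives a
  function to which the one-variable Schwarz lemma applies.\<close>

lemma holomorphic_slice:
  fixes f :: "complex ^ 'n::finite \<Rightarrow> complex ^ 'm::finite"
  assumes "holomorphic_map_on f (ball 0 1)" "norm u = 1"
  shows "(\<lambda>\<zeta>. herm (f (\<zeta> *s u)) w / c) holomorphic_on ball 0 1"
  unfolding holomorphic_on_def
proof
  fix \<zeta> :: complex assume \<zeta>: "\<zeta> \<in> ball 0 1"
  then have "\<zeta> *s u \<in> ball 0 1" using assms(2) by (simp add: norm_vector_smult)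
  then obtain A where A: "(f has_derivative (\<lambda>h. A *v h)) (at (\<zeta> *s u))"
    using assms(1) unfolding holomorphic_map_on_def by blast
  have "((\<lambda>\<zeta>. \<zeta> *s u) has_derivative (\<lambda>h. h *s u)) (at \<zeta>)"
    using bounded_bilinear.FDERIV[OF bounded_bilinear_vector_smult has_derivative_ident has_derivative_const[of u], of \<zeta> UNIV]
    by simp
  from bounded_linear.has_derivative[OF bounded_linear_herm has_derivative_compose[OF this A], of w]
  have "((\<lambda>\<zeta>. herm (f (\<zeta> *s u)) w) has_derivative (\<lambda>h. herm (A *v (h *s u)) w)) (at \<zeta>)" .
  moreover have "(\<lambda>h. herm (A *v (h *s u)) w) = (*) (herm (A *v u) w)"
    by (simp add: vector_scalar_commute herm_smult_left fun_eq_iff mult.commute)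
  ultimately have "((\<lambda>\<zeta>. herm (f (\<zeta> *s u)) w) has_field_derivative herm (A *v u) w) (at \<zeta>)"
    by (simp add: has_field_derivative_def)
  then have "((\<lambda>\<zeta>. herm (f (\<zeta> *s u)) w / c) has_field_derivative herm (A *v u) w / c) (at \<zeta>)"
    by (rule DERIV_cdivide)
  then show "(\<lambda>\<zeta>. herm (f (\<zeta> *s u)) w / c) field_differentiable at \<zeta> within ball 0 1"
    using field_differentiable_at_within field_differentiable_def by blast
qed

text \<open>Schwarz lemma for the projection to \<open>f z\<close> of the disc through \<open>0\<close> and \<open>z\<close>.\<close>

lemma Schwarz_slice:
  fixes f :: "complex ^ 'n::finite \<Rightarrow> complex ^ 'm::finite"
  assumes hol: "holomorphic_map_on f (ball 0 1)" and f0: "f 0 = 0"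
    and bd: "\<And>z. norm z < 1 \<Longrightarrow> norm (f z) < 1" and z: "norm z < 1" "z \<noteq> 0" and w: "f z \<noteq> 0"
  shows "norm (f z) \<le> norm z"
    and "norm (f z) = norm z \<Longrightarrow> cmod \<zeta> < 1 \<Longrightarrow>
      herm (f ((\<zeta> / norm z) *s z)) (f z) = \<zeta> * norm z"
proof -
  let ?u = "(1 / complex_of_real (norm z)) *s z"
  have u: "norm ?u = 1" using z by (simp add: norm_vector_smult norm_divide)
  let ?g = "\<lambda>\<zeta>. herm (f (\<zeta> *s ?u)) (f z) / norm (f z)"
  have g: "?g holomorphic_on ball 0 1" by (rule holomorphic_slice[OF hol u])
  have g0: "?g 0 = 0" by (simp add: f0)
  have lt: "cmod (?g \<zeta>) < 1" if "cmod \<zeta> < 1" for \<zeta>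
  proof -
    have "cmod (herm (f (\<zeta> *s ?u)) (f z)) \<le> norm (f (\<zeta> *s ?u)) * norm (f z)" by (rule cmod_herm_le)
    also have "\<dots> < 1 * norm (f z)"
    proof (rule mult_strict_right_mono)
      have "norm (\<zeta> *s ?u) < 1" unfolding norm_vector_smult[of \<zeta>] u using that by simp
      then show "norm (f (\<zeta> *s ?u)) < 1" by (rule bd)
    qed (use w in simp)
    finally show ?thesis using w by (simp add: norm_divide divide_simps)
  qed
  have zu: "complex_of_real (norm z) *s ?u = z" using z by (simp add: vector_smult_assoc)
  then have gz: "?g (of_real (norm z)) = norm (f z)"
    using w by (simp only: zu herm_self power2_eq_square nonzero_mult_div_cancel_right of_real_eq_0_iff norm_eq_zero not_False_eq_True)
  have "cmod (?g (of_real (norm z))) \<le> cmod (of_real (norm z))"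
    by (rule Schwarz_Lemma(1)[OF g g0 lt]) (use z in auto)
  then show "norm (f z) \<le> norm z" unfolding gz by simp
  assume eq: "norm (f z) = norm z" and \<zeta>: "cmod \<zeta> < 1"
  have "\<exists>\<alpha>. (\<forall>\<zeta>. cmod \<zeta> < 1 \<longrightarrow> ?g \<zeta> = \<alpha> * \<zeta>) \<and> cmod \<alpha> = 1"
  proof (rule Schwarz_Lemma(3)[OF g g0 lt, of 0], goal_cases)
    case 3
    have "cmod (of_real (norm z)) < 1" "complex_of_real (norm z) \<noteq> 0" using z by auto
    moreover have "cmod (?g (of_real (norm z))) = cmod (of_real (norm z))" unfolding gz by (simp add: eq)
    ultimately show ?case by blast
  qed auto
  then obtain \<alpha> where \<alpha>: "\<And>\<zeta>. cmod \<zeta> < 1 \<Longrightarrow> ?g \<zeta> = \<alpha> * \<zeta>" by blast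
  \<comment> \<open>Equality makes \<open>?g\<close> a rotation, and at |z| it takes the positive
    value |f z| = |z|.\<close>
  have "\<alpha> = 1" using \<alpha>[of "of_real (norm z)"] gz eq z by simp
  then have "?g \<zeta> = \<zeta>" using \<alpha>[OF \<zeta>] by simp
  then show "herm (f ((\<zeta> / norm z) *s z)) (f z) = \<zeta> * norm z"
    using w eq z by (simp add: vector_smult_assoc divide_simps)
qed

text \<open>The equality case of Cauchy-Schwarz, by expanding |x - c w|^2.\<close>

lemma eq_smult_if_herm_eq:
  fixes x w :: "complex ^ 'n"
  assumes "norm x = cmod c * norm w" "herm x w = c * (norm w)\<^sup>2"
  shows "x = c *s w"
proof -
  have "herm w x = cnj c * (norm w)\<^sup>2" using assms(2) cnj_herm[of x w] by simp
  moreover have "herm x x = (c * cnj c) * (norm w)\<^sup>2"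
    unfolding herm_self assms(1) by (simp add: power_mult_distrib cmod_square)
  ultimately have "herm (x - c *s w) (x - c *s w) = 0"
    using assms(2)
    by (simp add: herm_diff_left herm_diff_right herm_smult_left herm_smult_right herm_self[of w] mult_ac)
  then show ?thesis by (simp add: herm_self)
qed

text \<open>Schwarz for \<open>f\<close> and for its inverse shows that norms are preserved. The
  equality case then gives complex homogeneity on each disc through 0, and a homogeneous map
  coincides with its derivative at 0.\<close>

lemma ball_aut_fixing_0_linear:
  fixes f :: "complex ^ 'n::finite \<Rightarrow> complex ^ 'n"
  assumes "f \<in> ball_aut" "f 0 = 0"
  shows "\<exists>A :: complex ^ 'n ^ 'n. \<forall>z. norm z < 1 \<longrightarrow> f z = A *v z"
proof -
  obtain g where "g \<in> ball_aut" and g: "\<And>z. norm z < 1 \<Longrightarrow> norm (f z) < 1" "\<And>z. norm z < 1 \<Longrightarrow> norm (g z) < 1"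
    "\<And>z. norm z < 1 \<Longrightarrow> g (f z) = z" "\<And>z. norm z < 1 \<Longrightarrow> f (g z) = z"
    "holomorphic_map_on f (ball 0 1)" "holomorphic_map_on g (ball 0 1)"
    by (rule ball_autE[OF assms(1)]) (rule that)
  have g0: "g 0 = 0" using g(3)[of 0] assms(2) by simp
  have norm_f: "norm (f z) = norm z" if "norm z < 1" for z
  proof (cases "z = 0")
    case False
    then have "f z \<noteq> 0" using g(3)[OF that] g0 by auto
    have "norm (f z) \<le> norm z" by (rule Schwarz_slice(1)[OF g(5) assms(2) g(1) that False \<open>f z \<noteq> 0\<close>])
    moreover have "norm (g (f z)) \<le> norm (f z)"
      by (rule Schwarz_slice(1)[OF g(6) g0 g(2) g(1)[OF that] \<open>f z \<noteq> 0\<close>]) (use g(3)[OF that] False in auto)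
    ultimately show ?thesis using g(3)[OF that] by simp
  qed (simp add: assms)
  have homog: "f (c *s z) = c *s f z" if "norm z < 1" "cmod c * norm z < 1" for c z
  proof (cases "z = 0")
    case False
    then have "f z \<noteq> 0" using norm_f[OF that(1)] by auto
    let ?\<zeta> = "c * complex_of_real (norm z)"
    have "cmod ?\<zeta> < 1" using that by (simp add: norm_mult)
    from Schwarz_slice(2)[OF g(5) assms(2) g(1) that(1) False \<open>f z \<noteq> 0\<close> norm_f[OF that(1)] this]
    have "herm (f (c *s z)) (f z) = c * (norm z)\<^sup>2"
      using False by (simp add: power2_eq_square)
    moreover have "norm (f (c *s z)) = cmod c * norm z"
      using norm_f[of "c *s z"] that by (simp add: norm_vector_smult)
    ultimately show ?thesis
      using norm_f[OF that(1)] by (intro eq_smult_if_herm_eq) auto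
  qed (simp add: assms)
  obtain A where A: "(f has_derivative (\<lambda>h. A *v h)) (at 0)"
    using g(5) unfolding holomorphic_map_on_def by force
  have "f z = A *v z" if z: "norm z < 1" for z
  proof -
    have "((\<lambda>r::real. r *\<^sub>R z) has_derivative (\<lambda>r. r *\<^sub>R z)) (at 0)"
      by (auto intro!: derivative_eq_intros)
    from has_derivative_compose[OF this, of f] A
    have 1: "((\<lambda>r::real. f (r *\<^sub>R z)) has_derivative (\<lambda>r. A *v (r *\<^sub>R z))) (at 0)" by simp
    have "((\<lambda>r::real. r *\<^sub>R f z) has_derivative (\<lambda>r. r *\<^sub>R f z)) (at 0)"
      by (auto intro!: derivative_eq_intros)
    moreover have "r *\<^sub>R f z = f (r *\<^sub>R z)" if "r \<in> {-1<..<1}" for r :: real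
    proof -
      have "\<bar>r\<bar> \<le> 1" using that by auto
      then have "\<bar>r\<bar> * norm z < 1"
        using z mult_left_le_one_le[of "norm z" "\<bar>r\<bar>"] by simp
      then show ?thesis unfolding scaleR_eq_smult using homog[OF z, of "complex_of_real r"] by simp
    qed
    ultimately have 2: "((\<lambda>r::real. f (r *\<^sub>R z)) has_derivative (\<lambda>r. r *\<^sub>R f z)) (at 0)"
      using has_derivative_transform_within_open[of "\<lambda>r. r *\<^sub>R f z" _ 0 UNIV "{-1<..<1}" "\<lambda>r. f (r *\<^sub>R z)"]
      by simp
    have "(\<lambda>r. A *v (r *\<^sub>R z)) = (\<lambda>r. r *\<^sub>R f z)" by (rule has_derivative_unique[OF 1 2])
    from fun_cong[OF this, of 1] show ?thesis by simp
  qed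
  then show ?thesis by blast
qed

section \<open>Automorphisms as linear maps of homogeneous coordinates\<close>

text \<open>The scaling of \<open>T\<close> is fixed by its last component t - <z,a>: the hyperplane
  that \<open>T\<close> sends to infinity is then visibly the polar of \<open>a\<close>.\<close>

definition lifts :: "((complex ^ 'n) \<times> complex \<Rightarrow> (complex ^ 'n) \<times> complex) \<Rightarrow>
    ((complex ^ 'n) \<times> complex \<Rightarrow> (complex ^ 'n) \<times> complex) \<Rightarrow> complex ^ 'n \<Rightarrow>
    (complex ^ 'n \<Rightarrow> complex ^ 'n) \<Rightarrow> bool" where
  "lifts T T' a \<sigma> \<longleftrightarrow> norm a < 1 \<and> hlinear T \<and> hlinear T' \<and> (\<forall>x. T (T' x) = x) \<and> (\<forall>x. T' (T x) = x) \<and>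
     (\<forall>z t. snd (T (z, t)) = t - herm z a) \<and>
     (\<forall>z. norm z < 1 \<longrightarrow> T (z, 1) = hscale (1 - herm z a) (\<sigma> z, 1))"

lemma lifts_mob:
  assumes "norm a < 1"
  shows "lifts (mob_lift a) (\<lambda>x. hscale (inverse ((of_real (mob_defect a))\<^sup>2)) (mob_lift a x)) a (mob a)"
proof -
  have "(of_real (mob_defect a))\<^sup>2 \<noteq> (0::complex)" using mob_defect(1)[OF assms] by simp
  then show ?thesis
    unfolding lifts_def
    using assms mob_lift_mob(1)[OF assms] hlinear_comp[OF hlinear_scale hlinear_mob_lift]
    by (simp add: hlinear_mob_lift hlinear_hscale[OF hlinear_mob_lift] mob_lift_mob_lift[OF assms] hscale_hscale)
      (simp add: mob_lift_def)
qed

text \<open>With \<open>a\<close> the preimage of 0, \<open>\<sigma>\<close> after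
  \<open>mob a\<close> fixes 0 and is linear, so \<open>\<sigma>\<close> is a matrix after
  \<open>mob a\<close>. The matrix leaves the last coordinate alone and keeps the normalization of
  \<open>mob_lift a\<close>.\<close>

lemma ball_aut_lifts:
  fixes \<sigma> :: "complex ^ 'n::finite \<Rightarrow> complex ^ 'n"
  assumes "\<sigma> \<in> ball_aut"
  obtains T T' a where "lifts T T' a \<sigma>"
proof -
  obtain \<tau> where "\<tau> \<in> ball_aut" and \<tau>: "\<And>z. norm z < 1 \<Longrightarrow> norm (\<sigma> z) < 1" "\<And>z. norm z < 1 \<Longrightarrow> norm (\<tau> z) < 1"
    "\<And>z. norm z < 1 \<Longrightarrow> \<tau> (\<sigma> z) = z" "\<And>z. norm z < 1 \<Longrightarrow> \<sigma> (\<tau> z) = z"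
    "holomorphic_map_on \<sigma> (ball 0 1)" "holomorphic_map_on \<tau> (ball 0 1)"
    by (rule ball_autE[OF assms(1)]) (rule that)
  define a where "a = \<tau> 0"
  have a: "norm a < 1" unfolding a_def using \<tau>(2) by simp
  let ?f = "\<lambda>z. \<sigma> (mob a z)" and ?g = "\<lambda>z. mob a (\<tau> z)"
  have hol: "holomorphic_map_on ?f (ball 0 1)" "holomorphic_map_on ?g (ball 0 1)"
    by (rule holomorphic_map_on_compose[OF holomorphic_mob[OF a] \<tau>(5)], force simp: a norm_mob_less)
      (rule holomorphic_map_on_compose[OF \<tau>(6) holomorphic_mob[OF a]], force simp: \<tau>(2))
  have f: "?f \<in> ball_aut"
    by (rule ball_autI[OF _ _ _ _ hol]) (simp_all add: a \<tau> mob_mob norm_mob_less)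
  have g: "?g \<in> ball_aut"
    by (rule ball_autI[OF _ _ _ _ hol(2,1)]) (simp_all add: a \<tau> mob_mob norm_mob_less)
  have "?f 0 = 0" "?g 0 = 0" using \<tau>(4)[of 0] mob_self[OF a] by (simp_all add: mob_0 a_def)
  then obtain A B :: "complex ^ 'n ^ 'n" where A: "\<And>z. norm z < 1 \<Longrightarrow> ?f z = A *v z" and B: "\<And>z. norm z < 1 \<Longrightarrow> ?g z = B *v z"
    using ball_aut_fixing_0_linear[OF f] ball_aut_fixing_0_linear[OF g] by blast
  \<comment> \<open>Both matrices are determined by their action on the ball; the scalar 1 / (1 +
    |z|) moves an arbitrary vector into it.\<close>
  have inverse: "M *v (M' *v z) = z" if "\<And>z. norm z < 1 \<Longrightarrow> M *v (M' *v z) = z" for M M' :: "complex ^ 'n ^ 'n" and z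
  proof -
    define c where "c = complex_of_real (1 / (1 + norm z))"
    have "1 + norm z > 0" by (simp add: add_pos_nonneg)
    then have "c \<noteq> 0" and "norm (c *s z) < 1"
      by (auto simp: c_def norm_vector_smult norm_divide divide_simps simp flip: of_real_add)
    from that[OF this(2)] have "c *s (M *v (M' *v z)) = c *s z" by (simp add: vector_scalar_commute)
    then show ?thesis using \<open>c \<noteq> 0\<close> by simp
  qed
  have "A *v (B *v z) = z" if "norm z < 1" for z
    unfolding B[OF that, symmetric] using A[of "?g z"] that \<tau>(2,4) a by (simp add: mob_mob norm_mob_less)
  then have AB: "A *v (B *v z) = z" for z by (rule inverse)
  have "B *v (A *v z) = z" if "norm z < 1" for z
    unfolding A[OF that, symmetric] using B[of "?f z"] that \<tau>(1,3) a by (simp add: mob_mob norm_mob_less)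
  then have BA: "B *v (A *v z) = z" for z by (rule inverse)
  obtain M' where M': "lifts (mob_lift a) M' a (mob a)" using lifts_mob[OF a] by blast
  let ?A = "\<lambda>x. (A *v fst x, snd x)" and ?B = "\<lambda>x. (B *v fst x, snd x)"
  have lin: "hlinear (\<lambda>x. (C *v fst x, snd x))" for C :: "complex ^ 'n ^ 'n"
    unfolding hlinear_def hscale_def by (auto simp: matrix_vector_right_distrib vector_scalar_commute)
  have \<sigma>_eq: "\<sigma> z = A *v mob a z" if "norm z < 1" for z
    using A[of "mob a z"] that a by (simp add: mob_mob norm_mob_less)
  have "lifts (\<lambda>x. ?A (mob_lift a x)) (\<lambda>x. M' (?B x)) a \<sigma>"
    unfolding lifts_def
  proof (intro conjI allI impI)
    show "hlinear (\<lambda>x. ?A (mob_lift a x))" by (rule hlinear_comp[OF lin hlinear_mob_lift])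
    show "hlinear (\<lambda>x. M' (?B x))" by (rule hlinear_comp[OF _ lin]) (use M' lifts_def in blast)
    fix z :: "complex ^ 'n" assume "norm z < 1"
    show "?A (mob_lift a (z, 1)) = hscale (1 - herm z a) (\<sigma> z, 1)"
      unfolding mob_lift_mob(1)[OF a \<open>norm z < 1\<close>] \<sigma>_eq[OF \<open>norm z < 1\<close>]
      by (simp only: hscale_def fst_conv snd_conv vector_scalar_commute)
  qed (use M' a AB BA in \<open>auto simp: lifts_def\<close>)
  then show thesis by (rule that)
qed

section \<open>Homogeneous coordinates\<close>

text \<open>Indexing by \<open>option\<close> treats the numerators (\<open>Some j\<close>) and the
  denominator (\<open>None\<close>) uniformly as homogeneous components.\<close>

primrec hcomp :: "'n option \<Rightarrow> (complex ^ 'n) \<times> complex \<Rightarrow> complex" where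
  "hcomp None x = snd x"
| "hcomp (Some j) x = fst x $ j"

lemma hcomp_add: "hcomp i (x + y) = hcomp i x + hcomp i y"
  by (cases i) auto

lemma hcomp_hscale: "hcomp i (hscale c x) = c * hcomp i x"
  by (cases i) auto

lemma hcomp_0 [simp]: "hcomp i 0 = 0"
  by (cases i) auto

lemma hcomp_sum: "hcomp i (sum f A) = (\<Sum>x\<in>A. hcomp i (f x))"
  by (induction A rule: infinite_finite_induct) (auto simp: hcomp_add)

lemma hcomp_eqI: "(\<And>i. hcomp i x = hcomp i y) \<Longrightarrow> x = y"
  by (metis hcomp.simps prod_eq_iff vec_eq_iff)

lemma hlinear_sum:
  assumes "hlinear T"
  shows "T (sum f A) = (\<Sum>x\<in>A. T (f x))"
  by (induction A rule: infinite_finite_induct) (auto simp: hlinear_0[OF assms] hlinear_add[OF assms])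

lemma hlinear_coordinates:
  assumes "hlinear T"
  obtains m c where "\<And>x. hcomp i (T x) = (\<Sum>j\<in>UNIV. m j * fst x $ j) + c * snd x"
proof -
  define m where "m j = hcomp i (T (axis j 1, 0))" for j
  define c where "c = hcomp i (T (0, 1))"
  have "hcomp i (T x) = (\<Sum>j\<in>UNIV. m j * fst x $ j) + c * snd x" for x
  proof -
    have "x = (\<Sum>j\<in>UNIV. hscale (fst x $ j) (axis j 1, 0)) + hscale (snd x) (0, 1)"
    proof (rule hcomp_eqI)
      fix i show "hcomp i x = hcomp i ((\<Sum>j\<in>UNIV. hscale (fst x $ j) (axis j 1, 0)) + hscale (snd x) (0, 1))"
        by (cases i) (simp_all add: hcomp_add hcomp_sum hcomp_hscale axis_def mult.commute[of _ "if _ then _ else _"] if_distrib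
            del: hcomp.simps, simp_all add: axis_def if_distrib cong: if_cong)
    qed
    then have "T x = T ((\<Sum>j\<in>UNIV. hscale (fst x $ j) (axis j 1, 0)) + hscale (snd x) (0, 1))" by simp
    also have "\<dots> = (\<Sum>j\<in>UNIV. hscale (fst x $ j) (T (axis j 1, 0))) + hscale (snd x) (T (0, 1))"
      by (simp only: hlinear_add[OF assms] hlinear_sum[OF assms] hlinear_hscale[OF assms])
    finally show ?thesis by (simp add: hcomp_add hcomp_sum hcomp_hscale m_def c_def mult.commute)
  qed
  then show thesis by (rule that)
qed

lemma polyfun_deg_hlinear:
  assumes "hlinear T" "\<And>i. polyfun_deg k (\<lambda>z. hcomp i (f z))"
  shows "polyfun_deg k (\<lambda>z. hcomp i (T (f z)))"
proof -
  obtain m c where mc: "\<And>x. hcomp i (T x) = (\<Sum>j\<in>UNIV. m j * fst x $ j) + c * snd x"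
    using hlinear_coordinates[OF assms(1)] by blast
  show ?thesis
    unfolding mc
    by (intro polyfun_deg_add polyfun_deg_sum polyfun_deg_cmult)
      (use assms(2)[of None] assms(2)[of "Some _"] in auto)
qed

lemma polyfun_deg_affine_chart: "polyfun_deg 1 (\<lambda>z. hcomp i (z, 1))"
  by (cases i) (auto intro: polyfun_deg_const polyfun_deg_nth[unfolded One_nat_def])

lemma continuous_on_hcompI:
  assumes "\<And>i. continuous_on S (\<lambda>x. hcomp i (f x))"
  shows "continuous_on S f"
proof -
  have "continuous_on S (\<lambda>x. (\<chi> j. hcomp (Some j) (f x), hcomp None (f x)))"
    by (intro continuous_intros assms)
  then show ?thesis by simp
qed

lemma continuous_on_hlinear:
  assumes "hlinear T"
  shows "continuous_on S T"
proof (rule continuous_on_hcompI)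
  fix i
  obtain m c where mc: "\<And>x. hcomp i (T x) = (\<Sum>j\<in>UNIV. m j * fst x $ j) + c * snd x"
    using hlinear_coordinates[OF assms(1)] by blast
  show "continuous_on S (\<lambda>x. hcomp i (T x))" unfolding mc by (intro continuous_intros)
qed

text \<open>Homogeneous identities are checked for t \<noteq> 0 by scaling to t = 1; density of that
  set carries them to infinity.\<close>

lemma closed_UNIV_if_affine_chart:
  fixes S :: "((complex ^ 'n) \<times> complex) set"
  assumes "closed S" "\<And>z t. t \<noteq> 0 \<Longrightarrow> (z, t) \<in> S"
  shows "x \<in> S"
proof -
  have "closure ((UNIV :: (complex ^ 'n) set) \<times> (- {0 :: complex})) = UNIV"
    by (simp add: closure_Times closure_complement)
  then have "S = UNIV" by (rule closed_eq_closure_UNIV[OF assms(1)]) (use assms(2) in auto)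
  then show ?thesis by simp
qed

section \<open>The induced map in homogeneous coordinates\<close>

definition homog_map :: "('n::finite) cpoly ^ 'N::finite \<Rightarrow> 'n cpoly \<Rightarrow>
    (complex ^ 'n) \<times> complex \<Rightarrow> (complex ^ 'N) \<times> complex" where
  "homog_map P q x = ((\<chi> j. hom_eval (rat_deg P q) (P $ j) (fst x) (snd x)), hom_eval (rat_deg P q) q (fst x) (snd x))"

definition numden :: "('n::finite) cpoly ^ 'N::finite \<Rightarrow> 'n cpoly \<Rightarrow> 'N option \<Rightarrow> 'n cpoly" where
  "numden P q i = (case i of None \<Rightarrow> q | Some j \<Rightarrow> P $ j)"

lemma hcomp_homog_map:
  "hcomp i (homog_map P q x) = hom_eval (rat_deg P q) (numden P q i) (fst x) (snd x)"
  by (cases i) (simp_all add: homog_map_def numden_def)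

lemma tdeg_numden_le: "tdeg (numden P q i) \<le> rat_deg P q"
  unfolding rat_deg_def by (rule Max_ge) (auto simp: numden_def split: option.split)

lemma homog_map_hscale: "homog_map P q (hscale c x) = hscale (c ^ rat_deg P q) (homog_map P q x)"
  by (rule hcomp_eqI) (simp add: hcomp_homog_map hcomp_hscale hom_eval_scale[OF tdeg_numden_le])

lemma homog_map_chart: "hcomp i (homog_map P q (z, 1)) = cpoly_eval (numden P q i) z"
  by (simp add: hcomp_homog_map hom_eval_1)

lemma continuous_on_homog_map: "continuous_on S (homog_map P q)"
  by (rule continuous_on_hcompI) (simp add: hcomp_homog_map, intro continuous_intros)

lemma homog_map_not_0_at_infinity:
  fixes P :: "'n::finite cpoly ^ 'N::finite"
  assumes "q \<noteq> 0"
  obtains v where "homog_map P q (v, 0) \<noteq> 0"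
proof -
  \<comment> \<open>If k = 0, the zero polynomial also has \<open>tdeg\<close> equal to k, so the
    nonzero \<open>q\<close> is taken; if k > 0, any component of degree k is nonzero.\<close>
  obtain i where i: "tdeg (numden P q i) = rat_deg P q" "numden P q i \<noteq> 0"
  proof (cases "rat_deg P q = 0")
    case True
    then show thesis using that[of None] tdeg_numden_le[of P q None] assms by (simp add: numden_def)
  next
    case False
    have "rat_deg P q \<in> insert (tdeg q) (range (\<lambda>j. tdeg (P $ j)))"
      unfolding rat_deg_def by (rule Max_in) auto
    then have "\<exists>i. tdeg (numden P q i) = rat_deg P q"
      by (auto simp: numden_def intro: exI[of _ None] exI[of _ "Some _"])
    then show thesis using that False by (metis tdeg_0)
  qed
  then obtain v where "hom_eval (rat_deg P q) (numden P q i) v 0 \<noteq> 0"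
    using hom_eval_top_nonzero[of "numden P q i"] by metis
  then have "hcomp i (homog_map P q (v, 0)) \<noteq> 0" by (simp add: hcomp_homog_map)
  then have "homog_map P q (v, 0) \<noteq> 0" by (metis hcomp_0)
  then show thesis by (rule that)
qed

text \<open>A common factor \<open>d\<close> in the new coordinates homogenizes and pulls back to a common factor of \<open>P\<close>
  and \<open>q\<close>, which is a constant; then \<open>d\<close> is a power of the linear form \<open>t\<close> in the old coordinates, so
  that all homogeneous components of the map would vanish at infinity, against the choice of its degree.\<close>

lemma no_common_factor_after_linear_change:
  fixes P :: "'n::finite cpoly ^ 'N::finite" and q :: "'n cpoly" and d :: "complex ^ 'n \<Rightarrow> complex"
  assumes q: "q \<noteq> 0" and coprime: "\<And>d. d dvd q \<Longrightarrow> (\<And>j. d dvd P $ j) \<Longrightarrow> tdeg d = 0"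
    and A: "hlinear A" "hlinear A'" "\<And>x. A (A' x) = x"
    and B: "hlinear B" "hlinear B'" "\<And>y. B' (B y) = y"
    and d: "polyfun d"
    and dvd: "\<And>i. \<exists>h. polyfun h \<and> (\<forall>z. hcomp i (B (homog_map P q (A (z, 1)))) = d z * h z)"
  shows "d z = d w"
proof (rule ccontr)
  assume nonconst: "d z \<noteq> d w"
  let ?k = "rat_deg P q"
  let ?T = "\<lambda>x. B (homog_map P q (A x))"
  obtain p where p: "d = cpoly_eval p" using d unfolding polyfun_def by blast
  define a where "a = tdeg p"
  then have p_deg: "tdeg p \<le> a" by simp
  have "a \<noteq> 0" using nonconst p tdeg_0_eval a_def by metis
  have "p \<noteq> 0" using nonconst p by auto
  have "\<exists>e. \<forall>z. hcomp i (?T (z, 1)) = d z * cpoly_eval e z" for i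
    using dvd[of i] unfolding polyfun_def by blast
  then obtain e where e: "\<And>i z. hcomp i (?T (z, 1)) = d z * cpoly_eval (e i) z" by metis
  have hom_deg: "polyfun_deg k (\<lambda>z. hom_eval k r (fst (S (z, 1))) (snd (S (z, 1))))"
    if "hlinear S" "tdeg r \<le> k" for S :: "(complex ^ 'n) \<times> complex \<Rightarrow> (complex ^ 'n) \<times> complex"
      and k and r :: "'n cpoly"
    using polyfun_deg_hlinear[OF that(1) polyfun_deg_affine_chart, of "Some _"]
      polyfun_deg_hlinear[OF that(1) polyfun_deg_affine_chart, of None]
    by (intro polyfun_deg_hom_eval that) auto
  \<comment> \<open>Subtraction is truncated, and a zero cofactor says nothing about
    \<open>a\<close>, hence the conditional. For a nonzero cofactor additivity of the degree gives
    both claims.\<close>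
  have "tdeg (e i) \<le> ?k - a \<and> (e i \<noteq> 0 \<longrightarrow> a \<le> ?k)" for i
  proof (cases "e i = 0")
    case False
    have "polyfun_deg ?k (\<lambda>z. hcomp i (?T (z, 1)))"
      by (rule polyfun_deg_hlinear[OF B(1)], unfold hcomp_homog_map) (rule hom_deg[OF A(1) tdeg_numden_le])
    then obtain n where n: "tdeg n \<le> ?k" "(\<lambda>z. hcomp i (?T (z, 1))) = cpoly_eval n"
      unfolding polyfun_deg_def by blast
    have "n = p * e i" by (rule cpoly_eval_inject) (simp add: n(2)[symmetric] e p)
    then show ?thesis using n(1) tdeg_mult[OF \<open>p \<noteq> 0\<close> False] by (simp add: a_def)
  qed simp
  then have e_deg: "\<And>i. tdeg (e i) \<le> ?k - a" and a_le: "\<And>i. e i \<noteq> 0 \<Longrightarrow> a \<le> ?k" by auto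
  let ?dh = "\<lambda>x. hom_eval a p (fst x) (snd x)"
  let ?eh = "\<lambda>i x. hom_eval (?k - a) (e i) (fst x) (snd x)"
  have factor: "hcomp i (?T x) = ?dh x * ?eh i x" for i x
  proof -
    have "closed {x. hcomp i (?T x) = ?dh x * ?eh i x}"
    proof (rule closed_Collect_eq)
      have "continuous_on UNIV ?T"
        by (rule continuous_on_compose2[OF continuous_on_hlinear[OF B(1), of UNIV]],
            rule continuous_on_compose2[OF continuous_on_homog_map[of UNIV]])
          (auto intro: continuous_on_hlinear A)
      then show "continuous_on UNIV (\<lambda>x. hcomp i (?T x))"
        by (cases i) (auto intro!: continuous_intros)
      show "continuous_on UNIV (\<lambda>x. ?dh x * ?eh i x)" by (intro continuous_intros)
    qed
    moreover have "hcomp i (?T (z, t)) = ?dh (z, t) * ?eh i (z, t)" if "t \<noteq> 0" for z t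
    proof -
      have "(z, t) = hscale t ((1 / t) *s z, 1)" using that by (simp add: hscale_def)
      then have "hcomp i (?T (z, t)) = t ^ ?k * (d ((1 / t) *s z) * cpoly_eval (e i) ((1 / t) *s z))"
        by (simp only: hlinear_hscale[OF A(1)] homog_map_hscale hlinear_hscale[OF B(1)] hcomp_hscale e)
      moreover have "e i \<noteq> 0 \<Longrightarrow> t ^ ?k = t ^ a * t ^ (?k - a)"
        using a_le[of i] by (simp flip: power_add)
      ultimately show ?thesis
        using that by (cases "e i = 0") (auto simp: hom_eval_eq e_deg p_deg p hom_eval_def[of _ 0])
    qed
    ultimately show ?thesis using closed_UNIV_if_affine_chart by blast
  qed
  define E where "E x = ((\<chi> j. ?eh (Some j) x), ?eh None x)" for x
  have E: "hcomp i (E x) = ?eh i x" for i x by (cases i) (simp_all add: E_def)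
  have "?T x = hscale (?dh x) (E x)" for x
    by (rule hcomp_eqI) (simp add: factor hcomp_hscale E)
  then have "B' (?T (A' x)) = B' (hscale (?dh (A' x)) (E (A' x)))" for x by simp
  then have Y: "homog_map P q x = hscale (?dh (A' x)) (B' (E (A' x)))" for x
    by (simp add: A B hlinear_hscale[OF B(2)])
  obtain D where D: "(\<lambda>z. ?dh (A' (z, 1))) = cpoly_eval D"
    using hom_deg[OF A(2), of p a] unfolding a_def polyfun_deg_def by blast
  have "\<exists>f. (\<lambda>z. hcomp i (B' (E (A' (z, 1))))) = cpoly_eval f" for i
    using polyfun_deg_hlinear[OF B(2), of "?k - a" "\<lambda>z. E (A' (z, 1))" i] hom_deg[OF A(2) e_deg]
    unfolding E polyfun_deg_def by blast
  then obtain f where f: "\<And>i z. hcomp i (B' (E (A' (z, 1)))) = cpoly_eval (f i) z" by metis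
  have "numden P q i = D * f i" for i
    by (rule cpoly_eval_inject)
      (simp add: homog_map_chart[symmetric] Y hcomp_hscale f fun_cong[OF D, symmetric])
  then have "D dvd numden P q i" for i by simp
  from this[of None] this[of "Some _"] have "tdeg D = 0" by (intro coprime) (simp_all add: numden_def)
  then obtain \<kappa> where \<kappa>: "\<And>z. ?dh (A' (z, 1)) = \<kappa>"
    using tdeg_0_eval fun_cong[OF D] by metis
  \<comment> \<open>The pulled-back factor is homogeneous of degree \<open>a\<close> and constant on
    t = 1, which leaves a multiple of t^a.\<close>
  have "?dh (A' x) = \<kappa> * snd x ^ a" for x
  proof -
    have "closed {x. ?dh (A' x) = \<kappa> * snd x ^ a}"
      by (intro closed_Collect_eq continuous_intros continuous_on_hlinear A)
    moreover have "?dh (A' (z, t)) = \<kappa> * t ^ a" if "t \<noteq> 0" for z t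
    proof -
      have "(z, t) = hscale t ((1 / t) *s z, 1)" using that by (simp add: hscale_def)
      then show ?thesis
        using hom_eval_scale[of p a] \<kappa>
        by (simp add: hlinear_hscale[OF A(2)] a_def)
    qed
    ultimately show ?thesis using closed_UNIV_if_affine_chart[of "{x. ?dh (A' x) = \<kappa> * snd x ^ a}" x] by auto
  qed
  from this[of "(_, 0)"] have "homog_map P q (v, 0) = 0" for v
    using \<open>a \<noteq> 0\<close> by (simp add: Y zero_power)
  moreover obtain v where "homog_map P q (v, 0) \<noteq> 0" using homog_map_not_0_at_infinity[OF q] .
  ultimately show False by simp
qed

section \<open>Hyperplanes avoiding the closed ball\<close>

definition hyperplane :: "complex ^ 'n::finite \<Rightarrow> complex \<Rightarrow> 'n cproj set" where
  "hyperplane a b = {proj_pt z t | z t. (z, t) \<noteq> 0 \<and> (\<Sum>j\<in>UNIV. a $ j * z $ j) + b * t = 0}"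

lemma proj_hyperplane_iff: "proj_hyperplane H \<longleftrightarrow> (\<exists>a b. (a, b) \<noteq> 0 \<and> H = hyperplane a b)"
  by (simp add: proj_hyperplane_def hyperplane_def)

lemma proj_pt_in_hyperplane:
  assumes "(z, t) \<noteq> 0"
  shows "proj_pt z t \<in> hyperplane a b \<longleftrightarrow> (\<Sum>j\<in>UNIV. a $ j * z $ j) + b * t = 0"
proof
  assume "proj_pt z t \<in> hyperplane a b"
  then obtain w s where ws: "(w, s) \<noteq> 0" "(\<Sum>j\<in>UNIV. a $ j * w $ j) + b * s = 0" "proj_pt z t = proj_pt w s"
    unfolding hyperplane_def by blast
  then obtain c where c: "c \<noteq> 0" "w = c *s z" "s = c * t"
    using proj_pt_eq_iff[OF assms ws(1)] by blast
  have "(\<Sum>j\<in>UNIV. a $ j * w $ j) + b * s = c * ((\<Sum>j\<in>UNIV. a $ j * z $ j) + b * t)"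
    by (simp add: c sum_distrib_left algebra_simps)
  then show "(\<Sum>j\<in>UNIV. a $ j * z $ j) + b * t = 0" using ws(2) c(1) by simp
qed (use assms hyperplane_def in blast)

text \<open>An upper bound for the closure of \<open>proj_ball\<close>. Openness of the complement
  is tested on the punctured vector space, where it is a strict inequality between continuous
  functions.\<close>

lemma closed_affine_ball_preimage:
  "closed {proj_pt z t | z t. (z, t) \<noteq> 0 \<and> norm (z :: complex ^ 'n::finite) \<le> cmod t}"
  unfolding closed_def open_cproj_def
proof -
  let ?C = "{proj_pt z t | z t. (z, t) \<noteq> 0 \<and> norm (z :: complex ^ 'n) \<le> cmod t}"
  have iff: "proj_pt z t \<in> ?C \<longleftrightarrow> norm z \<le> cmod t" if zt: "(z, t) \<noteq> 0" for z :: "complex ^ 'n" and t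
  proof
    assume "proj_pt z t \<in> ?C"
    then obtain w s where ws: "(w, s) \<noteq> 0" "norm w \<le> cmod s" "proj_pt z t = proj_pt w s" by blast
    then obtain c where c: "c \<noteq> 0" "w = c *s z" "s = c * t"
      using proj_pt_eq_iff[OF zt ws(1)] by blast
    then show "norm z \<le> cmod t" using ws(2) by (simp add: norm_vector_smult norm_mult)
  qed (use zt in blast)
  have "{x :: (complex ^ 'n) \<times> complex. x \<noteq> 0 \<and> abs_cproj x \<in> - ?C} = {x. cmod (snd x) < norm (fst x)}"
  proof (rule set_eqI, rule iffI)
    fix x :: "(complex ^ 'n) \<times> complex"
    assume "x \<in> {x. x \<noteq> 0 \<and> abs_cproj x \<in> - ?C}"
    then show "x \<in> {x. cmod (snd x) < norm (fst x)}"
      using iff[of "fst x" "snd x"] by (auto simp: proj_pt_def)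
  next
    fix x :: "(complex ^ 'n) \<times> complex"
    assume x: "x \<in> {x. cmod (snd x) < norm (fst x)}"
    then have "x \<noteq> 0" by auto
    then show "x \<in> {x. x \<noteq> 0 \<and> abs_cproj x \<in> - ?C}"
      using x iff[of "fst x" "snd x"] by (simp add: proj_pt_def)
  qed
  moreover have "open {x :: (complex ^ 'n) \<times> complex. cmod (snd x) < norm (fst x)}"
    by (intro open_Collect_less continuous_intros)
  ultimately show "open {x :: (complex ^ 'n) \<times> complex. x \<noteq> 0 \<and> abs_cproj x \<in> - ?C}" by simp
qed

text \<open>Boundary points are approached radially, by \<open>r *\<^sub>R z\<close> with r <
  1.\<close>

lemma proj_pt_in_closure_ball:
  fixes z :: "complex ^ 'n::finite"
  assumes "norm z \<le> 1"
  shows "proj_pt z 1 \<in> closure proj_ball"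
proof (rule ccontr)
  assume "proj_pt z 1 \<notin> closure proj_ball"
  then have z: "proj_pt z 1 \<in> - closure proj_ball" by simp
  let ?U = "{x :: (complex ^ 'n) \<times> complex. x \<noteq> 0 \<and> abs_cproj x \<in> - closure proj_ball}"
  have "open ?U" using open_Compl[OF closed_closure[of "proj_ball :: 'n cproj set"]] by (simp only: open_cproj_def)
  moreover have "continuous_on UNIV (\<lambda>r::real. (r *\<^sub>R z, 1::complex))" by (intro continuous_intros)
  ultimately have open_V: "open ((\<lambda>r::real. (r *\<^sub>R z, 1::complex)) -` ?U)"
    by (rule open_vimage)
  define V where "V = (\<lambda>r::real. (r *\<^sub>R z, 1::complex)) -` ?U"
  have "1 \<in> V" using z by (simp add: V_def proj_pt_def prod_eq_iff)
  then obtain e where "e > 0" and e: "\<And>r. dist r 1 < e \<Longrightarrow> r \<in> V"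
    using open_V unfolding V_def[symmetric] open_dist by blast
  define r where "r = max 0 (1 - e / 2)"
  have r: "0 \<le> r" "r < 1" "dist r 1 < e" using \<open>e > 0\<close> by (auto simp: r_def dist_real_def max_def)
  have "norm (r *\<^sub>R z) \<le> r * 1" using r assms by (simp add: mult_left_le)
  then have "norm (r *\<^sub>R z) < 1" using r by simp
  then have "(norm (r *\<^sub>R z))\<^sup>2 < 1" by (simp only: abs_square_less_1 abs_norm_cancel)
  then have "proj_pt (r *\<^sub>R z) 1 \<in> proj_ball"
    unfolding norm_square_eq proj_ball_def
    by (intro CollectI exI[of _ "r *\<^sub>R z"] exI[of _ 1] conjI refl) simp
  moreover have "proj_pt (r *\<^sub>R z) 1 \<in> - closure proj_ball" using e[OF r(3)] by (simp add: V_def proj_pt_def)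
  ultimately show False using closure_subset by blast
qed

lemma hyperplane_avoids_closed_ball_iff:
  fixes a :: "complex ^ 'n::finite"
  shows "hyperplane a b \<inter> closure proj_ball = {} \<longleftrightarrow> norm a < cmod b"
proof
  assume disj: "hyperplane a b \<inter> closure proj_ball = {}"
  show "norm a < cmod b"
  proof (rule ccontr)
    assume "\<not> norm a < cmod b"
    then have le: "cmod b \<le> norm a" by simp
    \<comment> \<open>The point of the affine hyperplane nearest to the origin, at distance |b| /
      |a| \<le> 1. For \<open>a = 0\<close> division by zero gives \<open>z = 0\<close>, which
      solves the equation because then \<open>b = 0\<close>.\<close>
    define z where "z = (- b / (complex_of_real (norm a))\<^sup>2) *s (\<chi> j. cnj (a $ j))"
    have "norm (\<chi> j. cnj (a $ j)) = norm a" by (simp add: norm_vec_def)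
    then have "norm z = cmod b / (norm a)\<^sup>2 * norm a"
      by (simp add: z_def norm_vector_smult norm_divide norm_power)
    also have "\<dots> \<le> 1"
      using le by (cases "norm a = 0") (auto simp: power2_eq_square divide_simps)
    finally have "proj_pt z 1 \<in> closure proj_ball" by (rule proj_pt_in_closure_ball)
    moreover have "(\<Sum>j\<in>UNIV. a $ j * z $ j) + b * 1 = 0"
    proof (cases "a = 0")
      case True
      then show ?thesis using le by simp
    next
      case False
      have "(\<Sum>j\<in>UNIV. a $ j * z $ j) = (- b / (complex_of_real (norm a))\<^sup>2) * herm a a"
        by (simp add: z_def herm_def sum_distrib_left mult_ac)
      then show ?thesis using False by (simp add: herm_self)
    qed
    then have "proj_pt z 1 \<in> hyperplane a b" by (subst proj_pt_in_hyperplane) (auto simp: prod_eq_iff)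
    ultimately show False using disj by blast
  qed
next
  assume lt: "norm a < cmod b"
  let ?C = "{proj_pt z t | z t. (z, t) \<noteq> 0 \<and> norm (z :: complex ^ 'n) \<le> cmod t}"
  have "proj_ball \<subseteq> ?C"
  proof
    fix x :: "'n cproj" assume "x \<in> proj_ball"
    then obtain z t where zt: "x = proj_pt z t" "(norm z)\<^sup>2 < (cmod t)\<^sup>2"
      unfolding proj_ball_def norm_square_eq by blast
    then have "norm z < cmod t" by (simp add: power2_less_imp_less)
    moreover from this have "(z, t) \<noteq> 0" by (auto simp: prod_eq_iff)
    ultimately show "x \<in> ?C" using zt(1) less_imp_le by blast
  qed
  then have "closure proj_ball \<subseteq> ?C" using closed_affine_ball_preimage by (rule closure_minimal)
  moreover have "proj_pt z t \<notin> hyperplane a b" if zt: "(z, t) \<noteq> 0" "norm z \<le> cmod t" for z t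
  proof
    assume "proj_pt z t \<in> hyperplane a b"
    then have "(\<Sum>j\<in>UNIV. a $ j * z $ j) = - (b * t)"
      using proj_pt_in_hyperplane[OF zt(1)] by (simp add: eq_neg_iff_add_eq_0)
    moreover have "herm a (\<chi> j. cnj (z $ j)) = (\<Sum>j\<in>UNIV. a $ j * z $ j)" by (simp add: herm_def)
    moreover have "norm (\<chi> j. cnj (z $ j)) = norm z" by (simp add: norm_vec_def)
    ultimately have "cmod b * cmod t \<le> norm a * norm z"
      using cmod_herm_le[of a "\<chi> j. cnj (z $ j)"] by (simp add: norm_mult)
    also have "\<dots> \<le> norm a * cmod t" using zt(2) by (rule mult_left_mono) simp
    finally have "cmod b * cmod t \<le> norm a * cmod t" .
    moreover have "t \<noteq> 0" using zt by (auto simp: prod_eq_iff)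
    ultimately show False using lt by simp
  qed
  ultimately show "hyperplane a b \<inter> closure proj_ball = {}" by blast
qed

lemma induced_map_iff:
  "(x, y) \<in> induced_map P q \<longleftrightarrow> (\<exists>u. u \<noteq> 0 \<and> homog_map P q u \<noteq> 0 \<and>
     x = proj_pt (fst u) (snd u) \<and> y = proj_pt (fst (homog_map P q u)) (snd (homog_map P q u)))"
  unfolding induced_map_def homog_map_def by auto

lemma proj_pt_in_hyperplane_lift:
  fixes u :: "(complex ^ 'n::finite) \<times> complex"
  assumes "u \<noteq> 0"
  shows "proj_pt (fst u) (snd u) \<in> hyperplane (\<chi> j. - cnj (a $ j)) 1 \<longleftrightarrow> snd u - herm (fst u) a = 0"
proof -
  have "(\<Sum>j\<in>UNIV. (\<chi> j. - cnj (a $ j)) $ j * fst u $ j) = - herm (fst u) a"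
    by (simp add: herm_def sum_negf mult.commute)
  then show ?thesis using proj_pt_in_hyperplane[of "fst u" "snd u"] assms by simp
qed

section \<open>Proper rational maps of balls\<close>

lemma proper_ball_map_norm_less:
  assumes "proper_ball_map f" "norm z < 1"
  shows "norm (f z) < 1"
proof -
  have "f z \<in> f ` ball 0 1" using assms(2) by simp
  then have "f z \<in> ball 0 1" using assms(1) unfolding proper_ball_map_def by blast
  then show ?thesis by simp
qed

lemma proper_ball_map_compose_auts:
  fixes F :: "complex ^ 'n::finite \<Rightarrow> complex ^ 'N::finite"
  assumes F: "proper_ball_map F" and \<sigma>: "\<sigma> \<in> ball_aut" and \<tau>: "\<tau> \<in> ball_aut"
    and G: "\<And>z. norm z < 1 \<Longrightarrow> G z = \<tau> (F (\<sigma> z))"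
  shows "proper_ball_map G"
proof -
  obtain \<sigma>' where "\<sigma>' \<in> ball_aut" and s: "\<And>z. norm z < 1 \<Longrightarrow> norm (\<sigma> z) < 1" "\<And>z. norm z < 1 \<Longrightarrow> norm (\<sigma>' z) < 1"
    "\<And>z. norm z < 1 \<Longrightarrow> \<sigma>' (\<sigma> z) = z" "\<And>z. norm z < 1 \<Longrightarrow> \<sigma> (\<sigma>' z) = z"
    "holomorphic_map_on \<sigma> (ball 0 1)" "holomorphic_map_on \<sigma>' (ball 0 1)"
    by (rule ball_autE[OF \<sigma>]) (rule that)
  obtain \<tau>' where "\<tau>' \<in> ball_aut" and t: "\<And>z. norm z < 1 \<Longrightarrow> norm (\<tau> z) < 1" "\<And>z. norm z < 1 \<Longrightarrow> norm (\<tau>' z) < 1"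
    "\<And>z. norm z < 1 \<Longrightarrow> \<tau>' (\<tau> z) = z" "\<And>z. norm z < 1 \<Longrightarrow> \<tau> (\<tau>' z) = z"
    "holomorphic_map_on \<tau> (ball 0 1)" "holomorphic_map_on \<tau>' (ball 0 1)"
    by (rule ball_autE[OF \<tau>]) (rule that)
  note F1 = proper_ball_map_norm_less[OF F]
  have "compact {z \<in> ball 0 1. G z \<in> K}" if K: "compact K" "K \<subseteq> ball 0 1" for K
  proof -
    have "compact (\<tau>' ` K)"
      by (rule compact_continuous_image[OF continuous_on_subset[OF holomorphic_map_on_continuous_on[OF t(6)] K(2)] K(1)])
    moreover have "\<tau>' ` K \<subseteq> ball 0 1" using K(2) t(2) by auto
    ultimately have "compact {w \<in> ball 0 1. F w \<in> \<tau>' ` K}" using F unfolding proper_ball_map_def by blast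
    then have "compact (\<sigma>' ` {w \<in> ball 0 1. F w \<in> \<tau>' ` K})"
      by (rule compact_continuous_image[rotated])
        (rule continuous_on_subset[OF holomorphic_map_on_continuous_on[OF s(6)]], blast)
    moreover have "{z \<in> ball 0 1. G z \<in> K} = \<sigma>' ` {w \<in> ball 0 1. F w \<in> \<tau>' ` K}"
    proof (intro equalityI subsetI)
      fix z assume "z \<in> {z \<in> ball 0 1. G z \<in> K}"
      then have z: "norm z < 1" "G z \<in> K" by auto
      have "F (\<sigma> z) = \<tau>' (G z)" using z(1) by (simp add: G t(3) F1 s(1))
      then have "\<sigma> z \<in> {w \<in> ball 0 1. F w \<in> \<tau>' ` K}" using z s(1) by auto
      moreover have "z = \<sigma>' (\<sigma> z)" using s(3)[OF z(1)] by simp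
      ultimately show "z \<in> \<sigma>' ` {w \<in> ball 0 1. F w \<in> \<tau>' ` K}" by blast
    next
      fix z assume "z \<in> \<sigma>' ` {w \<in> ball 0 1. F w \<in> \<tau>' ` K}"
      then obtain w y where w: "norm w < 1" "z = \<sigma>' w" and y: "y \<in> K" "F w = \<tau>' y" by auto
      have "norm y < 1" using y(1) K(2) by auto
      then have "G z = y" using w by (simp add: G s(2,4) y(2) t(4))
      then show "z \<in> {z \<in> ball 0 1. G z \<in> K}" using y(1) w s(2) by auto
    qed
    ultimately show ?thesis by simp
  qed
  moreover have "G ` ball 0 1 \<subseteq> ball 0 1" using G F1 s(1) t(1) by auto
  ultimately show ?thesis unfolding proper_ball_map_def by blast
qed

text \<open>For a constant map the preimage of the compact set \<open>{F 0}\<close> would be the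
  whole open ball.\<close>

lemma proper_ball_map_not_constant:
  fixes F :: "complex ^ 'n::finite \<Rightarrow> complex ^ 'N::finite"
  assumes "proper_ball_map F"
  shows "\<exists>z. norm z < 1 \<and> F z \<noteq> F 0"
proof (rule ccontr)
  assume nex: "\<not> ?thesis"
  have "F z \<in> {F 0}" if "z \<in> ball 0 1" for z
    using nex that unfolding mem_ball dist_0_norm singleton_iff by blast
  then have "{z \<in> ball 0 1. F z \<in> {F 0}} = ball 0 1" by blast
  moreover have "compact {z \<in> ball 0 1. F z \<in> {F 0}}"
  proof -
    have "F 0 \<in> ball 0 1" using proper_ball_map_norm_less[OF assms, of 0] by simp
    then have "compact {F 0} \<and> {F 0} \<subseteq> ball 0 1" by simp
    then show ?thesis using assms unfolding proper_ball_map_def by blast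
  qed
  ultimately have "closed (ball (0 :: complex ^ 'n) 1)" by (simp add: compact_imp_closed)
  moreover have "ball (0 :: complex ^ 'n) 1 \<noteq> {}" by simp
  ultimately have "ball (0 :: complex ^ 'n) 1 = UNIV" using clopen open_ball by blast
  moreover have "bounded (ball (0 :: complex ^ 'n) 1)" by simp
  ultimately show False by (metis not_bounded_UNIV)
qed

section \<open>Lowest terms and the two implications\<close>

locale rational_ball_map =
  fixes F :: "complex ^ 'n::finite \<Rightarrow> complex ^ 'N::finite"
    and P :: "'n cpoly ^ 'N" and q :: "'n cpoly"
  assumes holo: "holomorphic_map_on F (ball 0 1)"
    and proper: "proper_ball_map F"
    and rational: "lowest_terms_rep F P q"
begin

lemma q_nonzero: "q \<noteq> 0"
  using rational unfolding lowest_terms_rep_def by blast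

lemma coprime: "d dvd q \<Longrightarrow> (\<And>j. d dvd P $ j) \<Longrightarrow> tdeg d = 0"
  using rational unfolding lowest_terms_rep_def by blast

lemma norm_F: "norm z < 1 \<Longrightarrow> norm (F z) < 1"
  by (rule proper_ball_map_norm_less[OF proper])

lemma denominator_nonzero_somewhere:
  obtains z where "norm z < 1" "cpoly_eval q z \<noteq> 0"
proof -
  have "\<exists>z\<in>ball 0 1. cpoly_eval q z \<noteq> 0"
  proof (rule ccontr)
    assume "\<not> ?thesis"
    then have zero: "cpoly_eval q z = 0" if "z \<in> ball 0 1" for z using that by blast
    have "ball (0 :: complex ^ 'n) 1 \<noteq> {}" by simp
    then have "cpoly_eval q z = 0" for z
      by (rule polyfun_eq_0_open[OF polyfun_eval open_ball _ zero])
    then show False using q_nonzero cpoly_eval_eq_0_iff by blast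
  qed
  then show thesis using that by auto
qed

text \<open>Cleared of denominators, the identity also covers zeros of \<open>q\<close> in the ball:
  around a point where it fails, continuity would make \<open>q\<close> vanish on an open
  set.\<close>

lemma numerator_eq:
  assumes "norm z < 1"
  shows "cpoly_eval (P $ j) z = cpoly_eval q z * F z $ j"
proof (rule ccontr)
  assume ne: "cpoly_eval (P $ j) z \<noteq> cpoly_eval q z * F z $ j"
  let ?f = "\<lambda>z. cpoly_eval (P $ j) z - cpoly_eval q z * F z $ j"
  let ?U = "{z \<in> ball 0 1. ?f z \<in> - {0}}"
  have "continuous_on (ball 0 1) ?f"
    by (intro continuous_intros holomorphic_map_on_continuous_on[OF holo])
  then have "open ?U"
    by (rule continuous_open_preimage[unfolded vimage_def Collect_conj_eq[symmetric] Int_def mem_Collect_eq]) auto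
  moreover have "z \<in> ?U" using ne assms by auto
  moreover have "cpoly_eval q w = 0" if "w \<in> ?U" for w
  proof (rule ccontr)
    assume "cpoly_eval q w \<noteq> 0"
    then have "F w $ j = cpoly_eval (P $ j) w / cpoly_eval q w"
      using rational that unfolding lowest_terms_rep_def by blast
    then show False using that \<open>cpoly_eval q w \<noteq> 0\<close> by simp
  qed
  ultimately have "cpoly_eval q w = 0" for w
    using polyfun_eq_0_open[OF polyfun_eval[of q], of ?U w] by blast
  then show False using q_nonzero cpoly_eval_eq_0_iff by blast
qed

lemma homog_map_ball:
  assumes "norm z < 1"
  shows "homog_map P q (z, 1) = hscale (cpoly_eval q z) (F z, 1)"
proof (rule hcomp_eqI)
  fix i show "hcomp i (homog_map P q (z, 1)) = hcomp i (hscale (cpoly_eval q z) (F z, 1))"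
    by (cases i) (simp_all only: homog_map_chart numden_def option.case hcomp_hscale hcomp.simps
        fst_conv snd_conv numerator_eq[OF assms] mult_1_right)
qed

lemma transformed_ball:
  assumes "hlinear B" "A (w, 1) = hscale e (z, 1)" "norm z < 1" "B (F z, 1) = hscale f (y, 1)"
  shows "B (homog_map P q (A (w, 1))) = hscale (e ^ rat_deg P q * cpoly_eval q z * f) (y, 1)"
  by (simp only: assms homog_map_hscale homog_map_ball[OF assms(3)] hlinear_hscale[OF assms(1)] hscale_hscale mult.assoc)

lemma rat_deg_nonzero: "rat_deg P q \<noteq> 0"
proof
  assume "rat_deg P q = 0"
  then have deg: "tdeg (P $ j) = 0" "tdeg q = 0" for j
    using tdeg_numden_le[of P q "Some j"] tdeg_numden_le[of P q None] by (simp_all add: numden_def)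
  obtain z0 where "cpoly_eval q z0 \<noteq> 0" using denominator_nonzero_somewhere by blast
  then have q0: "cpoly_eval q 0 \<noteq> 0" using tdeg_0_eval[OF deg(2), of z0] by simp
  have "F z $ j = cpoly_eval (P $ j) 0 / cpoly_eval q 0" if "norm z < 1" for z j
    using numerator_eq[OF that, of j] tdeg_0_eval[OF deg(1), of j z] tdeg_0_eval[OF deg(2), of z] q0
    by (simp add: field_simps)
  then have "F z = F 0" if "norm z < 1" for z using that by (simp add: vec_eq_iff)
  then show False using proper_ball_map_not_constant[OF proper] by blast
qed

lemma polyfun_transformed:
  assumes "hlinear A" "hlinear B"
  shows "polyfun (\<lambda>z. hcomp i (B (homog_map P q (A (z, 1)))))"
proof -
  have "polyfun_deg (rat_deg P q) (\<lambda>z. hcomp j (homog_map P q (A (z, 1))))" for j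
    unfolding hcomp_homog_map
    using polyfun_deg_hlinear[OF assms(1) polyfun_deg_affine_chart, of "Some _"]
      polyfun_deg_hlinear[OF assms(1) polyfun_deg_affine_chart, of None]
    by (intro polyfun_deg_hom_eval tdeg_numden_le) auto
  from polyfun_deg_hlinear[OF assms(2) this] show ?thesis unfolding polyfun_iff_deg by blast
qed

text \<open>\<open>H\<close> and \<open>H'\<close> are the hyperplanes that the lifts of
  \<open>\<sigma>\<close> and of the inverse of \<open>\<tau>\<close> send to infinity.\<close>

lemma hyperplanes_if_equivalent:
  assumes poly: "polynomial_ball_map G" and proper_G: "proper_ball_map G" and equiv: "ball_equivalent F G"
  shows "\<exists>(H :: 'n cproj set) (H' :: 'N cproj set).
    proj_hyperplane H \<and> proj_hyperplane H' \<and> H \<inter> closure proj_ball = {} \<and> H' \<inter> closure proj_ball = {} \<and>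
    induced_map P q `` H \<subseteq> H' \<and> induced_map P q `` (UNIV - H) \<subseteq> UNIV - H'"
proof -
  obtain \<sigma> \<tau> where \<sigma>: "\<sigma> \<in> ball_aut" and \<tau>: "\<tau> \<in> ball_aut"
    and FG: "\<And>z. norm z < 1 \<Longrightarrow> F z = \<tau> (G (\<sigma> z))"
    using equiv unfolding ball_equivalent_def by auto
  obtain \<sigma>' where "\<sigma>' \<in> ball_aut" and s: "\<And>z. norm z < 1 \<Longrightarrow> norm (\<sigma> z) < 1" "\<And>z. norm z < 1 \<Longrightarrow> norm (\<sigma>' z) < 1"
    "\<And>z. norm z < 1 \<Longrightarrow> \<sigma>' (\<sigma> z) = z" "\<And>z. norm z < 1 \<Longrightarrow> \<sigma> (\<sigma>' z) = z"
    "holomorphic_map_on \<sigma> (ball 0 1)" "holomorphic_map_on \<sigma>' (ball 0 1)"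
    by (rule ball_autE[OF \<sigma>]) (rule that)
  obtain \<tau>' where \<tau>': "\<tau>' \<in> ball_aut" and t: "\<And>z. norm z < 1 \<Longrightarrow> norm (\<tau> z) < 1" "\<And>z. norm z < 1 \<Longrightarrow> norm (\<tau>' z) < 1"
    "\<And>z. norm z < 1 \<Longrightarrow> \<tau>' (\<tau> z) = z" "\<And>z. norm z < 1 \<Longrightarrow> \<tau> (\<tau>' z) = z"
    "holomorphic_map_on \<tau> (ball 0 1)" "holomorphic_map_on \<tau>' (ball 0 1)"
    by (rule ball_autE[OF \<tau>]) (rule that)
  obtain p where p: "\<And>z j. norm z < 1 \<Longrightarrow> G z $ j = cpoly_eval (p $ j) z"
    using poly unfolding polynomial_ball_map_def by auto
  obtain S A a where "lifts S A a \<sigma>" using ball_aut_lifts[OF \<sigma>] .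
  then have a: "norm a < 1" and S: "hlinear S" "hlinear A" "\<And>x. S (A x) = x" "\<And>x. A (S x) = x"
    "\<And>z t. snd (S (z, t)) = t - herm z a" "\<And>z. norm z < 1 \<Longrightarrow> S (z, 1) = hscale (1 - herm z a) (\<sigma> z, 1)"
    unfolding lifts_def by blast+
  obtain B B' b where "lifts B B' b \<tau>'" using ball_aut_lifts[OF \<tau>'] .
  then have b: "norm b < 1" and B: "hlinear B" "hlinear B'" "\<And>x. B (B' x) = x" "\<And>x. B' (B x) = x"
    "\<And>z t. snd (B (z, t)) = t - herm z b" "\<And>z. norm z < 1 \<Longrightarrow> B (z, 1) = hscale (1 - herm z b) (\<tau>' z, 1)"
    unfolding lifts_def by blast+
  \<comment> \<open>A homogeneous form of \<open>G\<close>, obtained as the inverse of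
    \<open>\<tau>\<close> after \<open>F\<close> after the inverse of \<open>\<sigma>\<close>;
    \<open>A\<close> inverts the lift of \<open>\<sigma>\<close>.\<close>
  let ?T = "\<lambda>x. B (homog_map P q (A x))"
  let ?D = "\<lambda>z. snd (?T (z, 1))"
  have T_ball: "\<exists>c. ?T (\<sigma> z, 1) = hscale c (G (\<sigma> z), 1) \<and> (cpoly_eval q z \<noteq> 0 \<longrightarrow> c \<noteq> 0)"
    if z: "norm z < 1" for z
  proof -
    let ?c = "1 - herm z a" and ?f = "1 - herm (F z) b"
    have c: "?c \<noteq> 0" using ball_denominator_nonzero[OF a, of z 1] z by simp
    have f: "?f \<noteq> 0" using ball_denominator_nonzero[OF b, of "F z" 1] norm_F[OF z] by simp
    have "(\<sigma> z, 1) = hscale (inverse ?c) (S (z, 1))" using c by (simp add: S(6)[OF z] hscale_hscale)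
    then have "A (\<sigma> z, 1) = hscale (inverse ?c) (z, 1)" by (simp only: hlinear_hscale[OF S(2)] S(4))
    moreover have "norm (G (\<sigma> z)) < 1"
      by (rule proper_ball_map_norm_less[OF proper_G s(1)[OF z]])
    then have "\<tau>' (F z) = G (\<sigma> z)" by (simp add: FG[OF z] t(3))
    then have "B (F z, 1) = hscale ?f (G (\<sigma> z), 1)" using B(6)[OF norm_F[OF z]] by simp
    ultimately have "?T (\<sigma> z, 1) = hscale (inverse ?c ^ rat_deg P q * cpoly_eval q z * ?f) (G (\<sigma> z), 1)"
      by (intro transformed_ball[OF B(1) _ z])
    then show ?thesis using c f by auto
  qed
  have pf: "polyfun (\<lambda>z. hcomp i (?T (z, 1)))" for i by (rule polyfun_transformed[OF S(2) B(1)])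
  \<comment> \<open>Known on the ball because \<open>?T\<close> represents \<open>G\<close> there;
    the identity principle makes it a divisibility by \<open>?D\<close> on the whole space.\<close>
  have N: "fst (?T (z, 1)) $ j = ?D z * cpoly_eval (p $ j) z" for z j
  proof -
    have "fst (?T (z, 1)) $ j - ?D z * cpoly_eval (p $ j) z = 0"
    proof (rule polyfun_eq_0_open[of _ "ball 0 1"])
      show "polyfun (\<lambda>z. fst (?T (z, 1)) $ j - ?D z * cpoly_eval (p $ j) z)"
        using pf[of "Some j"] pf[of None] by (intro polyfun_diff polyfun_mult polyfun_eval) auto
      fix w :: "complex ^ 'n" assume "w \<in> ball 0 1"
      then have w: "norm w < 1" by simp
      obtain c where "?T (\<sigma> (\<sigma>' w), 1) = hscale c (G (\<sigma> (\<sigma>' w)), 1)"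
        using T_ball[OF s(2)[OF w]] by blast
      then have "?T (w, 1) = hscale c (G w, 1)" by (simp only: s(4)[OF w])
      then show "fst (?T (w, 1)) $ j - ?D w * cpoly_eval (p $ j) w = 0" by (simp add: p[OF w])
    qed auto
    then show ?thesis by simp
  qed
  have "?D z = ?D 0" for z
  proof (rule no_common_factor_after_linear_change[where A = A and A' = S and B = B and B' = B' and P = P and q = q])
    show "polyfun ?D" using pf[of None] by simp
    fix i show "\<exists>h. polyfun h \<and> (\<forall>z. hcomp i (?T (z, 1)) = ?D z * h z)"
    proof (cases i)
      case None
      then show ?thesis by (intro exI[of _ "\<lambda>_. 1"]) auto
    next
      case (Some j)
      then show ?thesis by (intro exI[of _ "cpoly_eval (p $ j)"]) (simp add: N polyfun_eval)
    qed
  qed (use q_nonzero coprime S B in auto)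
  then obtain \<kappa> where \<kappa>: "\<And>z. ?D z = \<kappa>" by blast
  have "\<kappa> \<noteq> 0"
  proof -
    obtain z where z: "norm z < 1" "cpoly_eval q z \<noteq> 0" by (rule denominator_nonzero_somewhere)
    then obtain c where "?T (\<sigma> z, 1) = hscale c (G (\<sigma> z), 1)" "c \<noteq> 0" using T_ball by blast
    then show ?thesis using \<kappa>[of "\<sigma> z"] by simp
  qed
  have snd_T: "snd (?T x) = \<kappa> * snd x ^ rat_deg P q" for x
  proof -
    have "continuous_on UNIV ?T"
      by (rule continuous_on_compose2[OF continuous_on_hlinear[OF B(1), of UNIV]],
          rule continuous_on_compose2[OF continuous_on_homog_map[of UNIV]])
        (auto intro: continuous_on_hlinear S)
    then have "closed {x. snd (?T x) = \<kappa> * snd x ^ rat_deg P q}"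
      by (intro closed_Collect_eq continuous_intros)
    moreover have "snd (?T (z, t)) = \<kappa> * t ^ rat_deg P q" if "t \<noteq> 0" for z t
    proof -
      have "(z, t) = hscale t ((1 / t) *s z, 1)" using that by (simp add: hscale_def)
      then show ?thesis
        by (simp only: hlinear_hscale[OF S(2)] homog_map_hscale hlinear_hscale[OF B(1)] snd_hscale \<kappa> mult.commute)
    qed
    ultimately show ?thesis using closed_UNIV_if_affine_chart[of "{x. snd (?T x) = \<kappa> * snd x ^ rat_deg P q}" x] by auto
  qed
  let ?H = "hyperplane (\<chi> j. - cnj (a $ j)) 1" and ?H' = "hyperplane (\<chi> j. - cnj (b $ j)) 1"
  have hyper: "proj_hyperplane (hyperplane v 1)" for v :: "complex ^ 'm::finite"
    unfolding proj_hyperplane_iff by (rule exI[of _ v], rule exI[of _ 1]) (simp add: prod_eq_iff)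
  have avoid: "hyperplane (\<chi> j. - cnj (v $ j)) 1 \<inter> closure proj_ball = {}" if "norm v < 1" for v :: "complex ^ 'm::finite"
    using that by (simp add: hyperplane_avoids_closed_ball_iff norm_vec_def)
  \<comment> \<open>Membership in \<open>H\<close> and in \<open>H'\<close> is the vanishing of
    \<open>snd (S u)\<close> and of \<kappa> times its k-th power. As \<kappa> and k are nonzero,
    one equivalence gives both inclusions.\<close>
  have key: "proj_pt (fst u) (snd u) \<in> ?H \<longleftrightarrow>
      proj_pt (fst (homog_map P q u)) (snd (homog_map P q u)) \<in> ?H'"
    if "u \<noteq> 0" "homog_map P q u \<noteq> 0" for u
  proof -
    have "proj_pt (fst u) (snd u) \<in> ?H \<longleftrightarrow> snd (S u) = 0"
      using proj_pt_in_hyperplane_lift[OF that(1)] S(5)[of "fst u" "snd u"] by simp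
    moreover have "proj_pt (fst (homog_map P q u)) (snd (homog_map P q u)) \<in> ?H' \<longleftrightarrow> snd (B (homog_map P q u)) = 0"
      using proj_pt_in_hyperplane_lift[OF that(2)]
        B(5)[of "fst (homog_map P q u)" "snd (homog_map P q u)"] by simp
    moreover have "snd (B (homog_map P q u)) = \<kappa> * snd (S u) ^ rat_deg P q" using snd_T[of "S u"] by (simp add: S(4))
    ultimately show ?thesis using \<open>\<kappa> \<noteq> 0\<close> rat_deg_nonzero by simp
  qed
  have "induced_map P q `` ?H \<subseteq> ?H'" "induced_map P q `` (UNIV - ?H) \<subseteq> UNIV - ?H'"
    using key by (auto simp: induced_map_iff)
  then show ?thesis using avoid[OF a] avoid[OF b] by (intro exI[of _ ?H] exI[of _ ?H'] conjI hyper)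
qed

lemma equivalent_if_hyperplanes:
  fixes H :: "'n cproj set" and H' :: "'N cproj set"
  assumes H: "proj_hyperplane H" "H \<inter> closure proj_ball = {}"
    and H': "proj_hyperplane H'" "H' \<inter> closure proj_ball = {}"
    and compl: "induced_map P q `` (UNIV - H) \<subseteq> UNIV - H'"
  shows "\<exists>G :: complex ^ 'n \<Rightarrow> complex ^ 'N. polynomial_ball_map G \<and> holomorphic_map_on G (ball 0 1) \<and>
    proper_ball_map G \<and> ball_equivalent F G"
proof -
  have center: "\<exists>c. norm c < 1 \<and> (\<forall>u. u \<noteq> 0 \<longrightarrow> (proj_pt (fst u) (snd u) \<in> K \<longleftrightarrow> snd (mob_lift c u) = 0))"
    if K: "proj_hyperplane K" "K \<inter> closure proj_ball = {}" for K :: "'m::finite cproj set"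
  proof -
    obtain v w where vw: "K = hyperplane v w" using K(1) unfolding proj_hyperplane_iff by blast
    then have lt: "norm v < cmod w" using K(2) hyperplane_avoids_closed_ball_iff by blast
    then have "w \<noteq> 0" by auto
    \<comment> \<open>Chosen so that the equation of \<open>K\<close>, divided by \<open>w\<close>,
      becomes t - <z,c> = 0; its norm is |v| / |w| < 1.\<close>
    define c where "c = (- cnj (1 / w)) *s (\<chi> j. cnj (v $ j))"
    have "norm (\<chi> j. cnj (v $ j)) = norm v" by (simp add: norm_vec_def)
    then have "norm c < 1" using lt \<open>w \<noteq> 0\<close> by (simp add: c_def norm_vector_smult norm_divide)
    moreover have "w * snd (mob_lift c u) = (\<Sum>j\<in>UNIV. v $ j * fst u $ j) + w * snd u" for u
    proof -
      have "herm (fst u) c = - (1 / w) * (\<Sum>j\<in>UNIV. v $ j * fst u $ j)"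
        unfolding c_def herm_smult_right by (simp add: herm_def mult.commute)
      then show ?thesis using \<open>w \<noteq> 0\<close> by (simp add: mob_lift_def algebra_simps)
    qed
    then have "proj_pt (fst u) (snd u) \<in> K \<longleftrightarrow> snd (mob_lift c u) = 0" if "u \<noteq> 0" for u
      using proj_pt_in_hyperplane[of "fst u" "snd u" v w] that \<open>w \<noteq> 0\<close> vw
      by (metis mult_eq_0_iff prod.collapse)
    ultimately show ?thesis by blast
  qed
  obtain c where c: "norm c < 1" and inH: "\<And>u. u \<noteq> 0 \<Longrightarrow> proj_pt (fst u) (snd u) \<in> H \<longleftrightarrow> snd (mob_lift c u) = 0"
    using center[OF H] by blast
  obtain b where b: "norm b < 1" and inH': "\<And>u. u \<noteq> 0 \<Longrightarrow> proj_pt (fst u) (snd u) \<in> H' \<longleftrightarrow> snd (mob_lift b u) = 0"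
    using center[OF H'] by blast
  let ?A = "mob_lift c" and ?B = "mob_lift b"
  obtain A' where "lifts ?A A' c (mob c)" using lifts_mob[OF c] by blast
  then have A: "hlinear ?A" "hlinear A'" "\<And>x. ?A (A' x) = x" "\<And>x. A' (?A x) = x"
    unfolding lifts_def by blast+
  obtain B' where "lifts ?B B' b (mob b)" using lifts_mob[OF b] by blast
  then have B: "hlinear ?B" "hlinear B'" "\<And>x. ?B (B' x) = x" "\<And>x. B' (?B x) = x"
    unfolding lifts_def by blast+
  let ?T = "\<lambda>x. ?B (homog_map P q (?A x))"
  let ?D = "\<lambda>z. snd (?T (z, 1))"
  have T_ball: "\<exists>e. ?T (z, 1) = hscale e (mob b (F (mob c z)), 1) \<and> (cpoly_eval q (mob c z) \<noteq> 0 \<longrightarrow> e \<noteq> 0)"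
    if z: "norm z < 1" for z
  proof -
    have Fz: "norm (F (mob c z)) < 1" by (rule norm_F[OF norm_mob_less[OF c z]])
    have "?T (z, 1) = hscale ((1 - herm z c) ^ rat_deg P q * cpoly_eval q (mob c z) * (1 - herm (F (mob c z)) b))
        (mob b (F (mob c z)), 1)"
      by (rule transformed_ball[where A = ?A, OF B(1) mob_lift_mob(1)[OF c z] norm_mob_less[OF c z] mob_lift_mob(1)[OF b Fz]])
    then show ?thesis using mob_lift_mob(2)[OF c z] mob_lift_mob(2)[OF b Fz] by auto
  qed
  have pf: "polyfun (\<lambda>z. hcomp i (?T (z, 1)))" for i by (rule polyfun_transformed[OF A(1) B(1)])
  \<comment> \<open>Applying \<open>?A\<close> twice is a nonzero scalar, so points with t = 1 come
    from the complement of \<open>H\<close>. If the map were defined there, its image would avoid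
    \<open>H'\<close>, contradicting \<open>?D z = 0\<close>; hence all components vanish.\<close>
  have vanish: "hcomp i (?T (z, 1)) = 0" if D0: "?D z = 0" for z i
  proof -
    let ?u = "?A (z, 1)"
    have "snd (?A ?u) = (complex_of_real (mob_defect c))\<^sup>2" by (simp add: mob_lift_mob_lift[OF c])
    then have snd_u: "snd (?A ?u) \<noteq> 0" using mob_defect(1)[OF c] by simp
    then have "?u \<noteq> 0" using hlinear_0[OF A(1)] by (metis snd_zero)
    have "homog_map P q ?u = 0"
    proof (rule ccontr)
      assume Y: "homog_map P q ?u \<noteq> 0"
      then have "(proj_pt (fst ?u) (snd ?u), proj_pt (fst (homog_map P q ?u)) (snd (homog_map P q ?u))) \<in> induced_map P q"
        unfolding induced_map_iff using \<open>?u \<noteq> 0\<close> by blast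
      moreover have "proj_pt (fst ?u) (snd ?u) \<notin> H" using inH[OF \<open>?u \<noteq> 0\<close>] snd_u by simp
      ultimately have "proj_pt (fst (homog_map P q ?u)) (snd (homog_map P q ?u)) \<notin> H'" using compl by blast
      then show False using inH'[OF Y] D0 by simp
    qed
    then show ?thesis by (simp add: hlinear_0[OF B(1)])
  qed
  have "?D z = ?D 0" for z
  proof (rule ccontr)
    assume nonconst: "?D z \<noteq> ?D 0"
    have "polyfun ?D" using pf[of None] by simp
    from common_factor_of_vanishing[OF this pf vanish nonconst]
    obtain d z1 z2 where "polyfun d" "d z1 \<noteq> d z2"
      and "\<And>i. \<exists>h. polyfun h \<and> (\<forall>z. hcomp i (?T (z, 1)) = d z * h z)" by metis
    then show False
      using no_common_factor_after_linear_change[where d = d, OF q_nonzero coprime A(1,2,3) B(1,2,4)] by blast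
  qed
  then obtain \<kappa> where \<kappa>: "\<And>z. ?D z = \<kappa>" by blast
  have "\<kappa> \<noteq> 0"
  proof -
    obtain z where z: "norm z < 1" "cpoly_eval q z \<noteq> 0" by (rule denominator_nonzero_somewhere)
    then obtain e where "?T (mob c z, 1) = hscale e (mob b (F (mob c (mob c z))), 1)" "e \<noteq> 0"
      using T_ball[OF norm_mob_less[OF c z(1)]] mob_mob[OF c z(1)] by metis
    then show ?thesis using \<kappa>[of "mob c z"] by simp
  qed
  define G where "G z = inverse \<kappa> *s fst (?T (z, 1))" for z
  have G: "G z = mob b (F (mob c z))" if "norm z < 1" for z
  proof -
    obtain e where e: "?T (z, 1) = hscale e (mob b (F (mob c z)), 1)" using T_ball[OF \<open>norm z < 1\<close>] by blast
    then have "e = \<kappa>" using \<kappa>[of z] by simp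
    then show ?thesis using \<open>\<kappa> \<noteq> 0\<close> by (simp add: G_def e vector_smult_assoc)
  qed
  have "polynomial_ball_map G"
  proof -
    have "\<exists>p. \<forall>z. G z $ j = cpoly_eval p z" for j
    proof -
      have "polyfun (\<lambda>z. inverse \<kappa> * hcomp (Some j) (?T (z, 1)))" by (intro polyfun_mult polyfun_const pf)
      then show ?thesis unfolding polyfun_def G_def by (auto simp: fun_eq_iff)
    qed
    then obtain p where "\<And>j z. G z $ j = cpoly_eval (p j) z" by metis
    then show ?thesis unfolding polynomial_ball_map_def by (intro exI[of _ "\<chi> j. p j"]) simp
  qed
  moreover have "holomorphic_map_on G (ball 0 1)"
  proof (rule holomorphic_map_on_transform[of "\<lambda>z. mob b (F (mob c z))"])
    have "holomorphic_map_on (\<lambda>z. F (mob c z)) (ball 0 1)"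
      by (rule holomorphic_map_on_compose[OF holomorphic_mob[OF c] holo]) (use norm_mob_less[OF c] in auto)
    then show "holomorphic_map_on (\<lambda>z. mob b (F (mob c z))) (ball 0 1)"
      by (rule holomorphic_map_on_compose[OF _ holomorphic_mob[OF b]]) (use norm_mob_less[OF c] norm_F in auto)
  qed (use G in auto)
  moreover have "proper_ball_map G"
    by (rule proper_ball_map_compose_auts[OF proper mob_ball_aut[OF c] mob_ball_aut[OF b] G])
  moreover have "ball_equivalent F G"
    unfolding ball_equivalent_def
  proof (intro bexI ballI)
    fix z :: "complex ^ 'n" assume "z \<in> ball 0 1"
    then have z: "norm z < 1" by simp
    show "F z = mob b (G (mob c z))"
      by (simp add: G norm_mob_less c z mob_mob b norm_F)
  qed (rule mob_ball_aut, rule b, rule mob_ball_aut, rule c)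
  ultimately show ?thesis by blast
qed

end

theorem theorem2p2:
  fixes F :: "complex ^ 'n \<Rightarrow> complex ^ 'N"
    and P :: "'n cpoly ^ 'N" and q :: "'n cpoly"
  assumes holo: "holomorphic_map_on F (ball 0 1)"
    and proper: "proper_ball_map F"
    and rational: "lowest_terms_rep F P q"
  shows "(\<exists>G :: complex ^ 'n \<Rightarrow> complex ^ 'N.
            polynomial_ball_map G \<and> holomorphic_map_on G (ball 0 1) \<and> proper_ball_map G \<and>
            ball_equivalent F G) \<longleftrightarrow>
         (\<exists>(H :: 'n cproj set) (H' :: 'N cproj set).
            proj_hyperplane H \<and> proj_hyperplane H' \<and>
            H \<inter> closure proj_ball = {} \<and> H' \<inter> closure proj_ball = {} \<and>
            induced_map P q `` H \<subseteq> H' \<and>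
            induced_map P q `` (UNIV - H) \<subseteq> UNIV - H')"
proof -
  interpret rational_ball_map F P q
    by (rule rational_ball_map.intro[OF holo proper rational])
  show ?thesis
  proof (rule iffI, goal_cases)
    case 1
    then show ?case by (elim exE conjE) (rule hyperplanes_if_equivalent)
  next
    case 2
    then show ?case by (elim exE conjE) (rule equivalent_if_hyperplanes)
  qed
qed

end
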